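(* Let $V$ be a complex-analytic Lie group, $G$ a finite group acting on $V$, $\gimel\subset V$ a $G$-invariant subgroup, $v\in V$, and let $K=G_{\gimel\cdot v}=\{g\in G: g\cdot(\gimel\cdot v)=\gimel\cdot v\}$. Let $\mathcal A\subset\mathcal S(V)^{K}$ be a subalgebra, finitely generated over $H^0(V,\mathcal O^{K})$, which preserves the vector space $\mathfrak O^{K}|_{\gimel\cdot v/K}$. Assume that $H^0(V,\mathcal O^{K})$ separates $K$-orbits in $\gimel\cdot v$ and that, for any $\xi\in\gimel\cdot v$, the $H^0(V,\mathcal O^{K})$-module $\mathbb E^{K}_{\bar\xi}$ is generated by the class of a non-zero constant $c\in\mathbb C\setminus\{0\}$. Then: (i) For every $K$-orbit $\bar\xi\subset\gimel\cdot v$, the module $M(K,\gimel\cdot v)$ has a unique submodule $N(\bar\xi)$ which is maximal, with respect to inclusions, among all submodules of $M(K,\gimel\cdot v)$ that do not contain $\mathbb E^{K}_{\bar\xi}$. (ii) If the graph $\Gamma$ is connected as an oriented graph, then $M(K,\gimel\cdot v)$ is generated by the class of a non-trivial constant function (the class $c_{\bar\xi}\in\mathbb E^K_{\bar\xi}$ of a constant $c\neq 0$ for an orbit $\bar\xi$) and also has a unique maximal submodule.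
   Context: $G$ acts on $V$ by holomorphic group automorphisms, written $g\cdot v=gvg^{-1}$ in $G\ltimes V$; $e$ is the identity of $V$. $\mathcal O$ and $\mathcal M$ are the sheaves of holomorphic and meromorphic functions on $V$, with germs $\mathcal O_x,\mathcal M_x$. For $\xi\in V$, $\phi_\xi$ is left translation $x\mapsto \xi x$; on germs $\phi_\xi(f)(x)=f(\xi^{-1}x)$. Also $(g\cdot f)(x)=f(g^{-1}\cdot x)$. $H^0(V,\mathcal O^K)$ is the algebra of global $K$-invariant holomorphic functions. "Finitely generated over $H^0(V,\mathcal O^K)$" means that $\mathcal A$ contains $H^0(V,\mathcal O^K)$ and is generated by it and finitely many elements. $\mathcal S(V)$ is the skew-group ring of finite sums $\sum_i f_i\phi_{\xi_i}$ with $f_i$ meromorphic on $V$ and $\xi_i\in V$, with product $f\phi_\xi\circ f'\phi_{\xi'}=f\,\phi_\xi(f')\,\phi_{\xi\xi'}$; it acts on $\bigoplus_{x\in V}\mathcal M_x$ by $f\phi_\xi:\mathcal M_x\to\mathcal M_{\xi x}$, $F\mapsto f\phi_\xi(F)$. $K$ acts on it by $g\cdot(f\phi_\xi)=(g\cdot f)\phi_{g\cdot\xi}$, with invariants $\mathcal S(V)^K$. $\gimel\cdot v=\{\xi v:\xi\in\gimel\}$, which is $K$-invariant. For a $K$-orbit $\bar x$ put $\mathcal O^K_{\bar x}=\big(\bigoplus_{x'\in\bar x}\mathcal O_{x'}\big)^K$, and $\mathfrak O^K|_{\gimel\cdot v/K}=\bigoplus_{\bar x\in \gimel\cdot v/K}\mathcal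 O^K_{\bar x}$. For $\xi\in V$ let $K_\xi$ be its stabilizer in $K$ and $\mathcal O^K_\xi=\mathcal O_\xi^{K_\xi}=\phi_\xi(\mathcal O_e^{K_\xi})$. $\mathcal J_e\subset\mathcal O_e$ is the ideal generated by the $K$-invariant germs at $e$ vanishing at $e$; $\mathbb E_\xi=\mathcal O^K_\xi/\phi_\xi(\mathcal O_e^{K_\xi}\cap\mathcal J_e)$; $\mathbb E^K_{\bar\xi}=\big(\bigoplus_{\xi'\in\bar\xi}\mathbb E_{\xi'}\big)^K$; $M(K,\gimel\cdot v)=\bigoplus_{\bar\xi\in\gimel\cdot v/K}\mathbb E^K_{\bar\xi}$, a quotient of $\mathfrak O^K|_{\gimel\cdot v/K}$, with the induced $\mathcal A$-action. $\Gamma$ is the oriented graph whose vertices are the $K$-orbits in $\gimel\cdot v$; there is an arrow from $\bar\xi$ to $\bar\eta$ if there exists $A=\sum_i\sum_{h\in K}h\cdot(f_i\phi_{\xi_i})\in\mathcal A$ such that, for representatives $\xi\in\bar\xi$, $\eta\in\bar\eta$ and $\Lambda=\{(g,h,i): g,h\in K,\ (h\cdot\xi_i)(g\cdot\xi)=\eta\}$, the set $\Lambda$ is non-empty and the function $H=\sum_{(g,h,i)\in\Lambda}h\cdot f_i$ (which is holomorphic at $\eta$) is not equal to $0$ at $\eta$. "Connected as an oriented graph" means that for any two vertices there is an oriented path from the first to the second. *)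

theory Defs
  imports
    "HOL-Analysis.Analysis"
    "HOL-Algebra.Group_Action"
    "HOL-Algebra.Generated_Rings"
    "HOL-Algebra.Ideal"
begin

section \<open>Complex-analytic Lie groups\<close>

text \<open>
  Complex differentiability on a set: the real Frechet derivative exists and can be chosen
  linear over the complex numbers. The parameters \<open>s\<close>, \<open>t\<close> are the complex scalar
  multiplications of the two spaces.
\<close>

definition complex_diff_on ::
  "(complex \<Rightarrow> 'a \<Rightarrow> 'a) \<Rightarrow> (complex \<Rightarrow> 'b \<Rightarrow> 'b) \<Rightarrow>
    ('a::real_normed_vector \<Rightarrow> 'b::real_normed_vector) \<Rightarrow> 'a set \<Rightarrow> bool"
  where "complex_diff_on s t f W \<longleftrightarrow>
    (\<forall>z\<in>W. \<exists>D. (f has_derivative D) (at z within W) \<and> (\<forall>c w. D (s c w) = t c (D w)))"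

definition pair_scale :: "complex \<Rightarrow> (complex^'n) \<times> (complex^'n) \<Rightarrow> (complex^'n) \<times> (complex^'n)"
  where "pair_scale c p = (c *s fst p, c *s snd p)"

text \<open>
  The manifold is modelled on a complex linear subspace \<open>model V\<close> of a coordinate space; taking
  a subspace instead of the whole (never zero) space \<open>complex^'n\<close> admits every finite dimension,
  including 0. Sets that are open in the model are relatively open in this subspace.
\<close>

record ('v, 'n::finite) lie_data = "'v monoid" +
  top_of :: "'v topology"
  model :: "(complex^'n) set"
  atlas :: "('v set \<times> ('v \<Rightarrow> complex^'n)) set"

definition complex_manifold :: "('v, 'n::finite) lie_data \<Rightarrow> bool"
  where "complex_manifold V \<longleftrightarrow>
    topspace (top_of V) = carrier V \<and>
    Hausdorff_space (top_of V) \<and> second_countable (top_of V) \<and>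
    vec.subspace (model V) \<and>
    \<Union>(fst ` atlas V) = carrier V \<and>
    (\<forall>(U, \<phi>)\<in>atlas V. openin (top_of V) U \<and> openin (top_of_set (model V)) (\<phi> ` U) \<and>
       homeomorphic_map (subtopology (top_of V) U) (top_of_set (\<phi> ` U)) \<phi>) \<and>
    (\<forall>(U, \<phi>)\<in>atlas V. \<forall>(U', \<phi>')\<in>atlas V.
       complex_diff_on (*s) (*s) (\<phi>' \<circ> inv_into U \<phi>) (\<phi> ` (U \<inter> U')))"

definition holomorphic_map :: "('v, 'n::finite) lie_data \<Rightarrow> ('v \<Rightarrow> 'v) \<Rightarrow> bool"
  where "holomorphic_map V F \<longleftrightarrow>
    continuous_map (top_of V) (top_of V) F \<and>
    (\<forall>(U, \<phi>)\<in>atlas V. \<forall>(U', \<phi>')\<in>atlas V.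
       complex_diff_on (*s) (*s) (\<phi>' \<circ> F \<circ> inv_into U \<phi>) (\<phi> ` {x\<in>U. F x \<in> U'}))"

definition holomorphic_binop :: "('v, 'n::finite) lie_data \<Rightarrow> ('v \<Rightarrow> 'v \<Rightarrow> 'v) \<Rightarrow> bool"
  where "holomorphic_binop V F \<longleftrightarrow>
    continuous_map (prod_topology (top_of V) (top_of V)) (top_of V) (\<lambda>(x, y). F x y) \<and>
    (\<forall>(U, \<phi>)\<in>atlas V. \<forall>(U', \<phi>')\<in>atlas V. \<forall>(U'', \<phi>'')\<in>atlas V.
       complex_diff_on pair_scale (*s)
         (\<lambda>(a, b). \<phi>'' (F (inv_into U \<phi> a) (inv_into U' \<phi>' b)))
         {(\<phi> x, \<phi>' y) | x y. x \<in> U \<and> y \<in> U' \<and> F x y \<in> U''})"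

locale complex_lie_group = group V for V :: "('v, 'n::finite) lie_data" (structure) +
  assumes complex_manifold: "complex_manifold V"
    and holomorphic_mult: "holomorphic_binop V (\<lambda>x y. x \<otimes> y)"
    and holomorphic_inv: "holomorphic_map V (\<lambda>x. inv x)"

locale finite_holomorphic_action =
  complex_lie_group V + group_action G "carrier V" act
  for G :: "('g, 'k) monoid_scheme" and V :: "('v, 'n::finite) lie_data"
    and act :: "'g \<Rightarrow> 'v \<Rightarrow> 'v" +
  assumes finite_group: "finite (carrier G)"
    and act_hom: "g \<in> carrier G \<Longrightarrow> act g \<in> hom V V"
    and act_holomorphic: "g \<in> carrier G \<Longrightarrow> holomorphic_map V (act g)"

text \<open>
  The stabilizer of a set, as a group. Every later definition that takes a group \<open>K\<close> and its
  action \<open>act\<close> is meant for such a subgroup of a finite group acting holomorphically.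
\<close>

definition set_stabilizer ::
  "('g, 'k) monoid_scheme \<Rightarrow> ('g \<Rightarrow> 'v \<Rightarrow> 'v) \<Rightarrow> 'v set \<Rightarrow> ('g, 'k) monoid_scheme"
  where "set_stabilizer G act X = G\<lparr>carrier := {g \<in> carrier G. act g ` X = X}\<rparr>"


section \<open>Germs of holomorphic and meromorphic functions\<close>

definition hol_on :: "('v, 'n::finite) lie_data \<Rightarrow> ('v \<Rightarrow> complex) \<Rightarrow> 'v set \<Rightarrow> bool"
  where "hol_on V f W \<longleftrightarrow> openin (top_of V) W \<and>
    (\<forall>(U, \<phi>)\<in>atlas V. complex_diff_on (*s) (*) (f \<circ> inv_into U \<phi>) (\<phi> ` (U \<inter> W)))"

text \<open>Admissible denominators: holomorphic functions with non-zero germ at every point.\<close>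

definition denominator_on :: "('v, 'n::finite) lie_data \<Rightarrow> ('v \<Rightarrow> complex) \<Rightarrow> 'v set \<Rightarrow> bool"
  where "denominator_on V q W \<longleftrightarrow> hol_on V q W \<and>
    (\<forall>U. openin (top_of V) U \<and> U \<subseteq> W \<and> U \<noteq> {} \<longrightarrow> (\<exists>y\<in>U. q y \<noteq> 0))"

definition hol_at :: "('v, 'n::finite) lie_data \<Rightarrow> 'v \<Rightarrow> ('v \<Rightarrow> complex) \<Rightarrow> bool"
  where "hol_at V x f \<longleftrightarrow> (\<exists>W. x \<in> W \<and> hol_on V f W)"

definition mero_at :: "('v, 'n::finite) lie_data \<Rightarrow> 'v \<Rightarrow> ('v \<Rightarrow> complex) \<Rightarrow> bool"
  where "mero_at V x f \<longleftrightarrow> (\<exists>W p q. x \<in> W \<and> hol_on V p W \<and> denominator_on V q W \<and>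
    (\<forall>y\<in>W. q y \<noteq> 0 \<longrightarrow> f y = p y / q y))"

text \<open>
  Two functions have the same meromorphic germ at \<open>x\<close> if near \<open>x\<close> they agree off the zero set of a
  denominator. With this equality the quotients \<open>p / q\<close> form the field of fractions of the ring of
  holomorphic germs. Holomorphic functions with the same meromorphic germ agree near \<open>x\<close>, by
  continuity, so the holomorphic germs embed into the meromorphic ones.
\<close>

definition mero_eq :: "('v, 'n::finite) lie_data \<Rightarrow> 'v \<Rightarrow> ('v \<Rightarrow> complex) \<Rightarrow> ('v \<Rightarrow> complex) \<Rightarrow> bool"
  where "mero_eq V x f f' \<longleftrightarrow>
    (\<exists>W q. x \<in> W \<and> denominator_on V q W \<and> (\<forall>y\<in>W. q y \<noteq> 0 \<longrightarrow> f y = f' y))"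

type_synonym 'v germ = "('v \<Rightarrow> complex) set"

definition germ :: "('v, 'n::finite) lie_data \<Rightarrow> 'v \<Rightarrow> ('v \<Rightarrow> complex) \<Rightarrow> 'v germ"
  where "germ V x f = {f'. mero_eq V x f f'}"

definition mero_germs :: "('v, 'n::finite) lie_data \<Rightarrow> 'v \<Rightarrow> 'v germ ring"
  where "mero_germs V x = \<lparr>
    carrier = {germ V x f | f. mero_at V x f},
    mult = (\<lambda>a b. \<Union>f\<in>a. \<Union>g\<in>b. germ V x (\<lambda>y. f y * g y)),
    one = germ V x (\<lambda>_. 1),
    zero = germ V x (\<lambda>_. 0),
    add = (\<lambda>a b. \<Union>f\<in>a. \<Union>g\<in>b. germ V x (\<lambda>y. f y + g y))\<rparr>"

definition hol_germs :: "('v, 'n::finite) lie_data \<Rightarrow> 'v \<Rightarrow> 'v germ ring"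
  where "hol_germs V x = (mero_germs V x)\<lparr>carrier := {germ V x f | f. hol_at V x f}\<rparr>"

definition germ_value :: "('v, 'n::finite) lie_data \<Rightarrow> 'v \<Rightarrow> 'v germ \<Rightarrow> complex"
  where "germ_value V x a = (THE c. \<exists>f\<in>a. hol_at V x f \<and> f x = c)"

text \<open>For a germ \<open>a\<close> at \<open>\<theta> y\<close>, its composite with \<open>\<theta>\<close>, a germ at \<open>y\<close>.\<close>

definition germ_comp :: "('v, 'n::finite) lie_data \<Rightarrow> ('v \<Rightarrow> 'v) \<Rightarrow> 'v \<Rightarrow> 'v germ \<Rightarrow> 'v germ"
  where "germ_comp V \<theta> y a = (\<Union>F\<in>a. germ V y (\<lambda>x. F (\<theta> x)))"

text \<open>
  Left translation by \<open>\<xi>\<close> and the action of \<open>g\<close> on germs. The point \<open>y\<close> is where the \<^emph>\<open>result\<close>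
  lives; the argument is a germ at \<open>\<xi>\<^sup>-\<^sup>1 y\<close>, respectively at \<open>g\<^sup>-\<^sup>1 \<cdot> y\<close>.
\<close>

definition trans_germ :: "('v, 'n::finite) lie_data \<Rightarrow> 'v \<Rightarrow> 'v \<Rightarrow> 'v germ \<Rightarrow> 'v germ"
  where "trans_germ V \<xi> y = germ_comp V (\<lambda>x. inv\<^bsub>V\<^esub> \<xi> \<otimes>\<^bsub>V\<^esub> x) y"

definition act_germ ::
  "('v, 'n::finite) lie_data \<Rightarrow> ('g, 'k) monoid_scheme \<Rightarrow> ('g \<Rightarrow> 'v \<Rightarrow> 'v) \<Rightarrow>
    'g \<Rightarrow> 'v \<Rightarrow> 'v germ \<Rightarrow> 'v germ"
  where "act_germ V K act g y = germ_comp V (act (inv\<^bsub>K\<^esub> g)) y"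


section \<open>Meromorphic functions and the skew-group ring\<close>

text \<open>A meromorphic function on \<open>V\<close> is a global section of the sheaf of meromorphic germs.\<close>

definition mero_sections :: "('v, 'n::finite) lie_data \<Rightarrow> ('v \<Rightarrow> 'v germ) set"
  where "mero_sections V = {m \<in> (\<Pi>\<^sub>E x\<in>carrier V. carrier (mero_germs V x)).
    \<forall>x\<in>carrier V. \<exists>W f. openin (top_of V) W \<and> x \<in> W \<and> (\<forall>y\<in>W. m y = germ V y f)}"

definition mero_ring :: "('v, 'n::finite) lie_data \<Rightarrow> ('v \<Rightarrow> 'v germ) ring"
  where "mero_ring V = \<lparr>
    carrier = mero_sections V,
    mult = (\<lambda>m m'. \<lambda>x\<in>carrier V. m x \<otimes>\<^bsub>mero_germs V x\<^esub> m' x),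
    one = (\<lambda>x\<in>carrier V. \<one>\<^bsub>mero_germs V x\<^esub>),
    zero = (\<lambda>x\<in>carrier V. \<zero>\<^bsub>mero_germs V x\<^esub>),
    add = (\<lambda>m m'. \<lambda>x\<in>carrier V. m x \<oplus>\<^bsub>mero_germs V x\<^esub> m' x)\<rparr>"

definition fun_section :: "('v, 'n::finite) lie_data \<Rightarrow> ('v \<Rightarrow> complex) \<Rightarrow> 'v \<Rightarrow> 'v germ"
  where "fun_section V f = (\<lambda>x\<in>carrier V. germ V x f)"

definition trans_section :: "('v, 'n::finite) lie_data \<Rightarrow> 'v \<Rightarrow> ('v \<Rightarrow> 'v germ) \<Rightarrow> 'v \<Rightarrow> 'v germ"
  where "trans_section V \<xi> m = (\<lambda>y\<in>carrier V. trans_germ V \<xi> y (m (inv\<^bsub>V\<^esub> \<xi> \<otimes>\<^bsub>V\<^esub> y)))"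

definition act_section ::
  "('v, 'n::finite) lie_data \<Rightarrow> ('g, 'k) monoid_scheme \<Rightarrow> ('g \<Rightarrow> 'v \<Rightarrow> 'v) \<Rightarrow>
    'g \<Rightarrow> ('v \<Rightarrow> 'v germ) \<Rightarrow> 'v \<Rightarrow> 'v germ"
  where "act_section V K act g m = (\<lambda>y\<in>carrier V. act_germ V K act g y (m (act (inv\<^bsub>K\<^esub> g) y)))"

text \<open>
  An element \<open>\<Sum>\<^sub>\<xi> f\<^sub>\<xi> \<phi>\<^sub>\<xi>\<close> of the skew-group ring is encoded as the finitely supported
  function \<open>\<xi> \<mapsto> f\<^sub>\<xi>\<close>.
\<close>

definition skew_supp :: "('v, 'n::finite) lie_data \<Rightarrow> ('v \<Rightarrow> 'v \<Rightarrow> 'v germ) \<Rightarrow> 'v set"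
  where "skew_supp V a = {\<xi> \<in> carrier V. a \<xi> \<noteq> \<zero>\<^bsub>mero_ring V\<^esub>}"

definition skew_monom ::
  "('v, 'n::finite) lie_data \<Rightarrow> ('v \<Rightarrow> 'v germ) \<Rightarrow> 'v \<Rightarrow> 'v \<Rightarrow> 'v \<Rightarrow> 'v germ"
  where "skew_monom V f \<xi> = (\<lambda>\<zeta>\<in>carrier V. if \<zeta> = \<xi> then f else \<zero>\<^bsub>mero_ring V\<^esub>)"

definition skew_ring :: "('v, 'n::finite) lie_data \<Rightarrow> ('v \<Rightarrow> 'v \<Rightarrow> 'v germ) ring"
  where "skew_ring V = \<lparr>
    carrier = {a \<in> carrier V \<rightarrow>\<^sub>E mero_sections V. finite (skew_supp V a)},
    mult = (\<lambda>a b. \<lambda>\<zeta>\<in>carrier V. \<Oplus>\<^bsub>mero_ring V\<^esub>\<xi>\<in>skew_supp V a.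
              a \<xi> \<otimes>\<^bsub>mero_ring V\<^esub> trans_section V \<xi> (b (inv\<^bsub>V\<^esub> \<xi> \<otimes>\<^bsub>V\<^esub> \<zeta>))),
    one = skew_monom V \<one>\<^bsub>mero_ring V\<^esub> \<one>\<^bsub>V\<^esub>,
    zero = (\<lambda>\<zeta>\<in>carrier V. \<zero>\<^bsub>mero_ring V\<^esub>),
    add = (\<lambda>a b. \<lambda>\<zeta>\<in>carrier V. a \<zeta> \<oplus>\<^bsub>mero_ring V\<^esub> b \<zeta>)\<rparr>"

definition act_skew ::
  "('v, 'n::finite) lie_data \<Rightarrow> ('g, 'k) monoid_scheme \<Rightarrow> ('g \<Rightarrow> 'v \<Rightarrow> 'v) \<Rightarrow>
    'g \<Rightarrow> ('v \<Rightarrow> 'v \<Rightarrow> 'v germ) \<Rightarrow> 'v \<Rightarrow> 'v \<Rightarrow> 'v germ"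
  where "act_skew V K act g a =
    (\<lambda>\<zeta>\<in>carrier V. act_section V K act g (a (act (inv\<^bsub>K\<^esub> g) \<zeta>)))"

definition skew_invariants ::
  "('v, 'n::finite) lie_data \<Rightarrow> ('g, 'k) monoid_scheme \<Rightarrow> ('g \<Rightarrow> 'v \<Rightarrow> 'v) \<Rightarrow>
    ('v \<Rightarrow> 'v \<Rightarrow> 'v germ) set"
  where "skew_invariants V K act =
    {a \<in> carrier (skew_ring V). \<forall>g\<in>carrier K. act_skew V K act g a = a}"

definition invariant_hol_funs ::
  "('v, 'n::finite) lie_data \<Rightarrow> ('g, 'k) monoid_scheme \<Rightarrow> ('g \<Rightarrow> 'v \<Rightarrow> 'v) \<Rightarrow> ('v \<Rightarrow> complex) set"
  where "invariant_hol_funs V K act =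
    {f. hol_on V f (carrier V) \<and> (\<forall>g\<in>carrier K. \<forall>x\<in>carrier V. f (act (inv\<^bsub>K\<^esub> g) x) = f x)}"

text \<open>The algebra of global invariant holomorphic functions inside the skew-group ring.\<close>

definition H0 ::
  "('v, 'n::finite) lie_data \<Rightarrow> ('g, 'k) monoid_scheme \<Rightarrow> ('g \<Rightarrow> 'v \<Rightarrow> 'v) \<Rightarrow>
    ('v \<Rightarrow> 'v \<Rightarrow> 'v germ) set"
  where "H0 V K act = (\<lambda>f. skew_monom V (fun_section V f) \<one>\<^bsub>V\<^esub>) ` invariant_hol_funs V K act"

text \<open>
  Since \<open>H0\<close> contains the complex constants, a subring generated by \<open>H0\<close> and further elements is
  automatically a complex subalgebra.
\<close>

definition fin_gen_over_H0 ::
  "('v, 'n::finite) lie_data \<Rightarrow> ('g, 'k) monoid_scheme \<Rightarrow> ('g \<Rightarrow> 'v \<Rightarrow> 'v) \<Rightarrow>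
    ('v \<Rightarrow> 'v \<Rightarrow> 'v germ) set \<Rightarrow> bool"
  where "fin_gen_over_H0 V K act A \<longleftrightarrow>
    H0 V K act \<subseteq> A \<and>
    (\<exists>B. finite B \<and> B \<subseteq> A \<and> A = generate_ring (skew_ring V) (H0 V K act \<union> B))"


section \<open>Direct sums of germs\<close>

definition germ_sums :: "('v, 'n::finite) lie_data \<Rightarrow> ('v \<Rightarrow> 'v germ) set"
  where "germ_sums V = {s \<in> (\<Pi>\<^sub>E x\<in>carrier V. carrier (mero_germs V x)).
    finite {x \<in> carrier V. s x \<noteq> \<zero>\<^bsub>mero_germs V x\<^esub>}}"

definition skew_apply ::
  "('v, 'n::finite) lie_data \<Rightarrow> ('v \<Rightarrow> 'v \<Rightarrow> 'v germ) \<Rightarrow> ('v \<Rightarrow> 'v germ) \<Rightarrow> 'v \<Rightarrow> 'v germ"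
  where "skew_apply V a s = (\<lambda>y\<in>carrier V. \<Oplus>\<^bsub>mero_germs V y\<^esub>\<xi>\<in>skew_supp V a.
    a \<xi> y \<otimes>\<^bsub>mero_germs V y\<^esub> trans_germ V \<xi> y (s (inv\<^bsub>V\<^esub> \<xi> \<otimes>\<^bsub>V\<^esub> y)))"

text \<open>
  For a \<open>K\<close>-stable set \<open>X\<close>, the \<open>K\<close>-invariants of the direct sum of the rings of holomorphic germs
  at the points of \<open>X\<close>. For an orbit this is the space attached to that orbit; for general \<open>X\<close> it
  is the (internal) direct sum of these spaces over the orbits in \<open>X\<close>.
\<close>

definition inv_germ_sums ::
  "('v, 'n::finite) lie_data \<Rightarrow> ('g, 'k) monoid_scheme \<Rightarrow> ('g \<Rightarrow> 'v \<Rightarrow> 'v) \<Rightarrow> 'v set \<Rightarrow>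
    ('v \<Rightarrow> 'v germ) set"
  where "inv_germ_sums V K act X = {s \<in> germ_sums V.
    (\<forall>x\<in>X. s x \<in> carrier (hol_germs V x)) \<and>
    (\<forall>x\<in>carrier V - X. s x = \<zero>\<^bsub>mero_germs V x\<^esub>) \<and>
    (\<forall>g\<in>carrier K. act_section V K act g s = s)}"


section \<open>The quotient module\<close>

text \<open>Holomorphic germs at \<open>x\<close> invariant under a set \<open>H\<close> of group elements fixing \<open>x\<close>.\<close>

definition inv_germs ::
  "('v, 'n::finite) lie_data \<Rightarrow> ('g, 'k) monoid_scheme \<Rightarrow> ('g \<Rightarrow> 'v \<Rightarrow> 'v) \<Rightarrow> 'g set \<Rightarrow> 'v \<Rightarrow>
    'v germ set"
  where "inv_germs V K act H x =
    {a \<in> carrier (hol_germs V x). \<forall>g\<in>H. act_germ V K act g x a = a}"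

definition coinv_ideal ::
  "('v, 'n::finite) lie_data \<Rightarrow> ('g, 'k) monoid_scheme \<Rightarrow> ('g \<Rightarrow> 'v \<Rightarrow> 'v) \<Rightarrow> 'v germ set"
  where "coinv_ideal V K act = Idl\<^bsub>hol_germs V \<one>\<^bsub>V\<^esub>\<^esub>
    {a \<in> inv_germs V K act (carrier K) \<one>\<^bsub>V\<^esub>. germ_value V \<one>\<^bsub>V\<^esub> a = 0}"

definition fibre_kernel ::
  "('v, 'n::finite) lie_data \<Rightarrow> ('g, 'k) monoid_scheme \<Rightarrow> ('g \<Rightarrow> 'v \<Rightarrow> 'v) \<Rightarrow> 'v \<Rightarrow> 'v germ set"
  where "fibre_kernel V K act \<xi> = trans_germ V \<xi> \<xi> `
    (inv_germs V K act (stabilizer K act \<xi>) \<one>\<^bsub>V\<^esub> \<inter> coinv_ideal V K act)"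

text \<open>The quotient of the invariant germs at \<open>\<xi>\<close> as a group; its elements are cosets, i.e. sets of germs at \<open>\<xi>\<close>.\<close>

definition fibre ::
  "('v, 'n::finite) lie_data \<Rightarrow> ('g, 'k) monoid_scheme \<Rightarrow> ('g \<Rightarrow> 'v \<Rightarrow> 'v) \<Rightarrow> 'v \<Rightarrow>
    'v germ set monoid"
  where "fibre V K act \<xi> =
    (hol_germs V \<xi>)\<lparr>carrier := inv_germs V K act (stabilizer K act \<xi>) \<xi>\<rparr>
      A_Mod fibre_kernel V K act \<xi>"

text \<open>
  The module \<open>M(K, X)\<close>, as the group of \<open>K\<close>-invariant elements of the direct sum of the
  quotients \<open>fibre V K act \<xi>\<close>, \<open>\<xi> \<in> X\<close>. The element \<open>g\<close> of \<open>K\<close> maps a coset at \<open>\<xi>\<close> to its image, a coset at \<open>g \<cdot> \<xi>\<close>.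
\<close>

definition quot_module ::
  "('v, 'n::finite) lie_data \<Rightarrow> ('g, 'k) monoid_scheme \<Rightarrow> ('g \<Rightarrow> 'v \<Rightarrow> 'v) \<Rightarrow> 'v set \<Rightarrow>
    ('v \<Rightarrow> 'v germ set) monoid"
  where "quot_module V K act X = \<lparr>
    carrier = {t \<in> (\<Pi>\<^sub>E \<xi>\<in>X. carrier (fibre V K act \<xi>)).
      finite {\<xi> \<in> X. t \<xi> \<noteq> \<one>\<^bsub>fibre V K act \<xi>\<^esub>} \<and>
      (\<forall>g\<in>carrier K. \<forall>\<xi>\<in>X. t (act g \<xi>) = act_germ V K act g (act g \<xi>) ` t \<xi>)},
    mult = (\<lambda>t u. \<lambda>\<xi>\<in>X. t \<xi> \<otimes>\<^bsub>fibre V K act \<xi>\<^esub> u \<xi>),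
    one = (\<lambda>\<xi>\<in>X. \<one>\<^bsub>fibre V K act \<xi>\<^esub>)\<rparr>"

definition orbit_part ::
  "('v, 'n::finite) lie_data \<Rightarrow> ('g, 'k) monoid_scheme \<Rightarrow> ('g \<Rightarrow> 'v \<Rightarrow> 'v) \<Rightarrow> 'v set \<Rightarrow>
    'v set \<Rightarrow> ('v \<Rightarrow> 'v germ set) set"
  where "orbit_part V K act X B =
    {t \<in> carrier (quot_module V K act X). \<forall>\<xi>\<in>X - B. t \<xi> = \<one>\<^bsub>fibre V K act \<xi>\<^esub>}"

definition quot_class ::
  "('v, 'n::finite) lie_data \<Rightarrow> ('g, 'k) monoid_scheme \<Rightarrow> ('g \<Rightarrow> 'v \<Rightarrow> 'v) \<Rightarrow> 'v set \<Rightarrow>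
    ('v \<Rightarrow> 'v germ) \<Rightarrow> 'v \<Rightarrow> 'v germ set"
  where "quot_class V K act X s =
    (\<lambda>\<xi>\<in>X. fibre_kernel V K act \<xi> +>\<^bsub>mero_germs V \<xi>\<^esub> s \<xi>)"

text \<open>
  The induced action on the quotient: lift a class to a representative, act on it and project back.
  For the algebras considered here the result does not depend on the representative.
\<close>

definition quot_act ::
  "('v, 'n::finite) lie_data \<Rightarrow> ('g, 'k) monoid_scheme \<Rightarrow> ('g \<Rightarrow> 'v \<Rightarrow> 'v) \<Rightarrow> 'v set \<Rightarrow>
    ('v \<Rightarrow> 'v \<Rightarrow> 'v germ) \<Rightarrow> ('v \<Rightarrow> 'v germ set) \<Rightarrow> 'v \<Rightarrow> 'v germ set"
  where "quot_act V K act X a t = quot_class V K act X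
    (skew_apply V a (inv_into (inv_germ_sums V K act X) (quot_class V K act X) t))"

definition submodule_of ::
  "('v, 'n::finite) lie_data \<Rightarrow> ('g, 'k) monoid_scheme \<Rightarrow> ('g \<Rightarrow> 'v \<Rightarrow> 'v) \<Rightarrow> 'v set \<Rightarrow>
    ('v \<Rightarrow> 'v \<Rightarrow> 'v germ) set \<Rightarrow> ('v \<Rightarrow> 'v germ set) set \<Rightarrow> bool"
  where "submodule_of V K act X A N \<longleftrightarrow>
    subgroup N (quot_module V K act X) \<and> (\<forall>a\<in>A. \<forall>t\<in>N. quot_act V K act X a t \<in> N)"

definition submodule_gen ::
  "('v, 'n::finite) lie_data \<Rightarrow> ('g, 'k) monoid_scheme \<Rightarrow> ('g \<Rightarrow> 'v \<Rightarrow> 'v) \<Rightarrow> 'v set \<Rightarrow>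
    ('v \<Rightarrow> 'v \<Rightarrow> 'v germ) set \<Rightarrow> ('v \<Rightarrow> 'v germ set) set \<Rightarrow> ('v \<Rightarrow> 'v germ set) set"
  where "submodule_gen V K act X A S = \<Inter>{N. submodule_of V K act X A N \<and> S \<subseteq> N}"

definition const_class ::
  "('v, 'n::finite) lie_data \<Rightarrow> ('g, 'k) monoid_scheme \<Rightarrow> ('g \<Rightarrow> 'v \<Rightarrow> 'v) \<Rightarrow> 'v set \<Rightarrow>
    'v set \<Rightarrow> complex \<Rightarrow> 'v \<Rightarrow> 'v germ set"
  where "const_class V K act X B c = quot_class V K act X
    (\<lambda>x\<in>carrier V. if x \<in> B then germ V x (\<lambda>_. c) else \<zero>\<^bsub>mero_germs V x\<^esub>)"

definition maximal_in :: "'a set set \<Rightarrow> 'a set \<Rightarrow> bool"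
  where "maximal_in \<S> N \<longleftrightarrow> N \<in> \<S> \<and> (\<forall>N'\<in>\<S>. N \<subseteq> N' \<longrightarrow> N' = N)"


section \<open>The graph\<close>

definition arrow ::
  "('v, 'n::finite) lie_data \<Rightarrow> ('g, 'k) monoid_scheme \<Rightarrow> ('g \<Rightarrow> 'v \<Rightarrow> 'v) \<Rightarrow>
    ('v \<Rightarrow> 'v \<Rightarrow> 'v germ) set \<Rightarrow> 'v set \<Rightarrow> 'v set \<Rightarrow> bool"
  where "arrow V K act A B C \<longleftrightarrow>
    (\<exists>(n::nat) f \<xi>s. (\<forall>i<n. f i \<in> mero_sections V \<and> \<xi>s i \<in> carrier V) \<and>
      (\<Oplus>\<^bsub>skew_ring V\<^esub>i\<in>{..<n}. \<Oplus>\<^bsub>skew_ring V\<^esub>h\<in>carrier K.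
         act_skew V K act h (skew_monom V (f i) (\<xi>s i))) \<in> A \<and>
      (\<exists>\<xi>\<in>B. \<exists>\<eta>\<in>C.
        let \<Lambda> = {(g, h, i). g \<in> carrier K \<and> h \<in> carrier K \<and> i < n \<and>
                   act h (\<xi>s i) \<otimes>\<^bsub>V\<^esub> act g \<xi> = \<eta>};
            H = finsum (mero_ring V) (\<lambda>(g, h, i). act_section V K act h (f i)) \<Lambda>
        in \<Lambda> \<noteq> {} \<and> H \<eta> \<in> carrier (hol_germs V \<eta>) \<and> germ_value V \<eta> (H \<eta>) \<noteq> 0))"

definition orbit_graph ::
  "('v, 'n::finite) lie_data \<Rightarrow> ('g, 'k) monoid_scheme \<Rightarrow> ('g \<Rightarrow> 'v \<Rightarrow> 'v) \<Rightarrow> 'v set \<Rightarrow>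
    ('v \<Rightarrow> 'v \<Rightarrow> 'v germ) set \<Rightarrow> 'v set rel"
  where "orbit_graph V K act X A =
    {(B, C). B \<in> orbits K X act \<and> C \<in> orbits K X act \<and> arrow V K act A B C}"

definition graph_connected :: "'a set \<Rightarrow> 'a rel \<Rightarrow> bool"
  where "graph_connected vs E \<longleftrightarrow> (\<forall>x\<in>vs. \<forall>y\<in>vs. (x, y) \<in> E\<^sup>*)"

end

theory Submission
  imports Defs
begin

text \<open>
  Let \<open>X\<close> be the coset and \<open>K\<close> its stabilizer. Everything rests on the interplay of two actions on the
  module \<open>M\<close>: that of the ring of invariant holomorphic functions, which splits \<open>M\<close> into local
  pieces, and that of the algebra \<open>A\<close>, which moves between them.

  The fibre over a point \<open>\<xi>\<close> is a quotient by the translate of the ideal \<open>J\<close> that is generated by the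
  invariant germs vanishing at the identity. A germ \<open>F\<close> vanishing at the identity is a root of the
  polynomial \<open>\<Prod>\<^sub>g (T - g \<cdot> F)\<close>, whose coefficients below the leading one are invariant and vanish
  at the identity; hence \<open>F\<^sup>n \<in> J\<close> for the order \<open>n\<close> of \<open>K\<close> (\<open>power_card_in_coinv_ideal\<close>). So an
  invariant function \<open>f\<close> acts on the fibres over an orbit as the scalar \<open>f(\<xi>)\<close> plus a nilpotent map of
  exponent \<open>n\<close>. Since invariant functions separate the orbits, the component of an element of \<open>M\<close>
  over one orbit can be isolated, up to an invertible factor, by an invariant function. The part of
  \<open>M\<close> over an orbit is generated by the class of a constant, so it is a cyclic module over a local
  ring, and an element of it is a generator as soon as its value at a point of the orbit is non-zero.
  Consequently a submodule contains the part over \<open>B\<close> if and only if it contains an element whose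
  value on \<open>B\<close> is non-zero (\<open>part_subset_if_value\<close>, \<open>part_subset_iff\<close>).

  The values at a fixed point of \<open>B\<close> are additive. The submodules that do not contain the part over \<open>B\<close>
  are therefore those contained in the kernel of the value map, and among them there is a largest one:
  all \<open>s\<close> such that \<open>a s\<close> has value zero for every \<open>a\<close> in the algebra
  (\<open>ex1_maximal_not_containing_part\<close>). An arrow from \<open>B\<close> to \<open>C\<close> says precisely that some element of the
  algebra sends a section over \<open>B\<close> to one whose value on \<open>C\<close> is non-zero, so a submodule that contains the
  part over \<open>B\<close> contains the part over \<open>C\<close> (\<open>arrow_part_subset\<close>). If the graph is connected, a
  submodule that contains one orbit part is everything, and then the proper submodules are those that
  do not contain a given orbit part.

  For all this the algebra has to act on the quotient \<open>M\<close>, that is, preserve the kernel of the map from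
  invariant sums of germs to \<open>M\<close>. The reason is that \<open>\<phi>\<^sub>\<xi> \<phi>\<^sub>\<eta> = \<phi>\<^bsub>\<xi>\<eta>\<^esub>\<close>: multiplying the
  component at every \<open>y\<close> by the translate \<open>\<phi>\<^sub>y(p)\<close> of one invariant germ \<open>p\<close> commutes with the skew-group
  ring. The coefficients in a combination of such germs need not be invariant, which is repaired by
  averaging over \<open>K\<close> (\<open>kernel_stable\<close>); averaging also lifts the elements of \<open>M\<close> to invariant sums
  (\<open>cls_surj\<close>).
\<close>

section \<open>Complex differentiability and holomorphic functions\<close>

lemma complex_diff_on_subset:
  "complex_diff_on s t f W \<Longrightarrow> W' \<subseteq> W \<Longrightarrow> complex_diff_on s t f W'"
  unfolding complex_diff_on_def by (meson has_derivative_subset subsetD)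

lemma complex_diff_on_cong:
  assumes "complex_diff_on s t f W" "\<And>z. z \<in> W \<Longrightarrow> f' z = f z"
  shows "complex_diff_on s t f' W"
  unfolding complex_diff_on_def
proof
  fix z assume z: "z \<in> W"
  then obtain D where D: "(f has_derivative D) (at z within W)" "\<forall>c w. D (s c w) = t c (D w)"
    using assms(1) unfolding complex_diff_on_def by blast
  have "(f' has_derivative D) (at z within W)"
    using has_derivative_transform[OF z _ D(1)] assms(2) by blast
  with D(2) show "\<exists>D. (f' has_derivative D) (at z within W) \<and> (\<forall>c w. D (s c w) = t c (D w))"
    by blast
qed

lemma complex_diff_on_compose:
  assumes "complex_diff_on s t f W" "complex_diff_on t u g W'" "f ` W \<subseteq> W'"
  shows "complex_diff_on s u (g \<circ> f) W"
  unfolding complex_diff_on_def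
proof
  fix z assume z: "z \<in> W"
  obtain D where D: "(f has_derivative D) (at z within W)" "\<forall>c w. D (s c w) = t c (D w)"
    using assms(1) z unfolding complex_diff_on_def by blast
  obtain E where E: "(g has_derivative E) (at (f z) within W')" "\<forall>c w. E (t c w) = u c (E w)"
    using assms(2,3) z unfolding complex_diff_on_def by blast
  have "(g \<circ> f has_derivative E \<circ> D) (at z within W)"
    by (rule diff_chain_within[OF D(1) has_derivative_subset[OF E(1) assms(3)]])
  with D(2) E(2) show "\<exists>D. (g \<circ> f has_derivative D) (at z within W) \<and>
      (\<forall>c w. D (s c w) = u c (D w))"
    by (intro exI[of _ "E \<circ> D"]) simp
qed

text \<open>
  Charts have values in a subspace, so that derivatives are taken within sets that are open only in
  that subspace. At a point of a relatively open subset the two filters coincide.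
\<close>

lemma complex_diff_on_localI:
  assumes "\<And>z. z \<in> W \<Longrightarrow> \<exists>T. openin (top_of_set W) T \<and> z \<in> T \<and> complex_diff_on s t f T"
  shows "complex_diff_on s t f W"
  unfolding complex_diff_on_def
proof
  fix z assume z: "z \<in> W"
  obtain T where T: "openin (top_of_set W) T" "z \<in> T" "complex_diff_on s t f T"
    using assms[OF z] by blast
  obtain D where D: "(f has_derivative D) (at z within T)" "\<forall>c w. D (s c w) = t c (D w)"
    using T unfolding complex_diff_on_def by blast
  obtain Q where Q: "open Q" "T = W \<inter> Q"
    using T(1) by (auto simp: openin_open)
  have "at z within W = at z within T"
    using Q T(2) by (intro at_within_nhd[of z Q]) auto
  with D show "\<exists>D. (f has_derivative D) (at z within W) \<and> (\<forall>c w. D (s c w) = t c (D w))"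
    by auto
qed

lemma complex_diff_on_imp_continuous_on:
  "complex_diff_on s t f W \<Longrightarrow> continuous_on W f"
  unfolding complex_diff_on_def continuous_on_eq_continuous_within
  using has_derivative_continuous by blast

lemma complex_diff_on_const: "complex_diff_on s (*) (\<lambda>_. k) W"
  unfolding complex_diff_on_def by (intro ballI exI[of _ "\<lambda>_. 0"]) auto

lemma complex_diff_on_add:
  assumes "complex_diff_on s (*) f W" "complex_diff_on s (*) g W"
  shows "complex_diff_on s (*) (\<lambda>z. f z + g z) W"
  unfolding complex_diff_on_def
proof
  fix z assume z: "z \<in> W"
  obtain D where D: "(f has_derivative D) (at z within W)" "\<forall>c w. D (s c w) = c * D w"
    using assms(1) z unfolding complex_diff_on_def by blast
  obtain E where E: "(g has_derivative E) (at z within W)" "\<forall>c w. E (s c w) = c * E w"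
    using assms(2) z unfolding complex_diff_on_def by blast
  show "\<exists>D. ((\<lambda>z. f z + g z) has_derivative D) (at z within W) \<and> (\<forall>c w. D (s c w) = c * D w)"
    using has_derivative_add[OF D(1) E(1)] D(2) E(2)
    by (intro exI[of _ "\<lambda>w. D w + E w"]) (simp add: algebra_simps)
qed

lemma complex_diff_on_mult:
  assumes "complex_diff_on s (*) f W" "complex_diff_on s (*) g W"
  shows "complex_diff_on s (*) (\<lambda>z. f z * g z) W"
  unfolding complex_diff_on_def
proof
  fix z assume z: "z \<in> W"
  obtain D where D: "(f has_derivative D) (at z within W)" "\<forall>c w. D (s c w) = c * D w"
    using assms(1) z unfolding complex_diff_on_def by blast
  obtain E where E: "(g has_derivative E) (at z within W)" "\<forall>c w. E (s c w) = c * E w"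
    using assms(2) z unfolding complex_diff_on_def by blast
  show "\<exists>D. ((\<lambda>z. f z * g z) has_derivative D) (at z within W) \<and> (\<forall>c w. D (s c w) = c * D w)"
    using has_derivative_mult[OF D(1) E(1)] D(2) E(2)
    by (intro exI[of _ "\<lambda>w. f z * E w + D w * g z"]) (simp add: algebra_simps)
qed

context complex_lie_group
begin

lemma topspace_V: "topspace (top_of V) = carrier V"
  using complex_manifold unfolding complex_manifold_def by blast

lemma openin_carrier: "openin (top_of V) (carrier V)"
  using openin_topspace topspace_V by metis

lemma openin_subset_carrier: "openin (top_of V) W \<Longrightarrow> W \<subseteq> carrier V"
  using openin_subset topspace_V by metis

lemma chartD:
  assumes "(U, \<phi>) \<in> atlas V"
  shows "openin (top_of V) U" "U \<subseteq> carrier V" "inj_on \<phi> U"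
    and "openin (top_of V) T \<Longrightarrow> openin (top_of_set (\<phi> ` U)) (\<phi> ` (U \<inter> T))"
    and "continuous_map (subtopology (top_of V) U) (top_of_set (\<phi> ` U)) \<phi>"
proof -
  have h: "openin (top_of V) U" 
    "homeomorphic_map (subtopology (top_of V) U) (top_of_set (\<phi> ` U)) \<phi>"
    using complex_manifold assms unfolding complex_manifold_def by auto
  then show U: "openin (top_of V) U" "U \<subseteq> carrier V"
    using openin_subset_carrier by auto
  have ts: "topspace (subtopology (top_of V) U) = U"
    using U topspace_V by auto
  show "inj_on \<phi> U"
    using homeomorphic_imp_injective_map[OF h(2)] ts by simp
  show "continuous_map (subtopology (top_of V) U) (top_of_set (\<phi> ` U)) \<phi>"
    using homeomorphic_imp_continuous_map[OF h(2)] .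
  assume T: "openin (top_of V) T"
  have "openin (subtopology (top_of V) U) (U \<inter> T)"
    using T by (metis inf_commute openin_subtopology_Int)
  then show "openin (top_of_set (\<phi> ` U)) (\<phi> ` (U \<inter> T))"
    using homeomorphic_imp_open_map[OF h(2)] unfolding open_map_def by blast
qed

lemma chart_at:
  assumes "x \<in> carrier V"
  obtains U \<phi> where "(U, \<phi>) \<in> atlas V" "x \<in> U"
  using assms complex_manifold unfolding complex_manifold_def by force

lemma hol_onD_open: "hol_on V f W \<Longrightarrow> openin (top_of V) W"
  by (simp add: hol_on_def)

lemma hol_on_subset:
  assumes "hol_on V f W" "openin (top_of V) W'" "W' \<subseteq> W"
  shows "hol_on V f W'"
  using assms unfolding hol_on_def
  by (auto intro!: complex_diff_on_subset[of _ _ _ _ "_ ` (_ \<inter> W')"])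

lemma hol_on_const: "openin (top_of V) W \<Longrightarrow> hol_on V (\<lambda>_. c) W"
  unfolding hol_on_def by (auto simp: o_def complex_diff_on_const)

lemma hol_on_add:
  assumes "hol_on V f W" "hol_on V g W"
  shows "hol_on V (\<lambda>x. f x + g x) W"
  using assms unfolding hol_on_def o_def by (auto intro!: complex_diff_on_add)

lemma hol_on_mult:
  assumes "hol_on V f W" "hol_on V g W"
  shows "hol_on V (\<lambda>x. f x * g x) W"
  using assms unfolding hol_on_def o_def by (auto intro!: complex_diff_on_mult)

text \<open>
  The chain rule, applied near each point in a chart around the image point; the points that land in
  this chart form a relatively open set.
\<close>

lemma hol_on_comp:
  assumes f: "hol_on V f W" and \<theta>: "holomorphic_map V \<theta>"
  shows "hol_on V (\<lambda>x. f (\<theta> x)) {x \<in> carrier V. \<theta> x \<in> W}" (is "hol_on V ?h ?W")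
  unfolding hol_on_def
proof (intro conjI ballI, goal_cases)
  case 1
  show ?case
    using openin_continuous_map_preimage[of "top_of V" "top_of V" \<theta> W] \<theta> hol_onD_open[OF f]
    by (simp add: holomorphic_map_def topspace_V)
next
  case (2 Up)
  note open_W = hol_onD_open[OF f]
  from 2 obtain U \<phi> where U: "Up = (U, \<phi>)" "(U, \<phi>) \<in> atlas V" by (metis surj_pair)
  have cont: "continuous_map (top_of V) (top_of V) \<theta>"
    using \<theta> unfolding holomorphic_map_def by blast
  have "complex_diff_on (*s) (*) (?h \<circ> inv_into U \<phi>) (\<phi> ` (U \<inter> ?W))"
  proof (rule complex_diff_on_localI)
    fix z assume "z \<in> \<phi> ` (U \<inter> ?W)"
    then obtain x where x: "x \<in> U" "\<theta> x \<in> W" "z = \<phi> x" by blast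
    obtain U' \<phi>' where U': "(U', \<phi>') \<in> atlas V" "\<theta> x \<in> U'"
      using chart_at openin_subset_carrier[OF open_W] x(2) by blast
    define Q where "Q = {x \<in> carrier V. \<theta> x \<in> U' \<inter> W}"
    have Q: "openin (top_of V) Q"
      unfolding Q_def using openin_continuous_map_preimage[OF cont, of "U' \<inter> W"] open_W
        chartD(1)[OF U'(1)] topspace_V by auto
    let ?T = "\<phi> ` (U \<inter> Q)"
    have sub: "U \<inter> Q \<subseteq> U \<inter> ?W" unfolding Q_def by blast
    have "openin (top_of_set (\<phi> ` U)) ?T"
      using chartD(4)[OF U(2) Q] .
    then have 1: "openin (top_of_set (\<phi> ` (U \<inter> ?W))) ?T"
      by (rule openin_subset_trans) (use sub in auto)
    have 2: "z \<in> ?T"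
      using x U' chartD(2)[OF U(2)] unfolding Q_def by blast
    have d1: "complex_diff_on (*s) (*s) (\<phi>' \<circ> \<theta> \<circ> inv_into U \<phi>) ?T"
    proof (rule complex_diff_on_subset)
      show "complex_diff_on (*s) (*s) (\<phi>' \<circ> \<theta> \<circ> inv_into U \<phi>) (\<phi> ` {x \<in> U. \<theta> x \<in> U'})"
        using \<theta> U(2) U'(1) unfolding holomorphic_map_def by auto
    qed (auto simp: Q_def)
    have d2: "complex_diff_on (*s) (*) (f \<circ> inv_into U' \<phi>') (\<phi>' ` (U' \<inter> W))"
      using f U'(1) unfolding hol_on_def by auto
    have "complex_diff_on (*s) (*) ((f \<circ> inv_into U' \<phi>') \<circ> (\<phi>' \<circ> \<theta> \<circ> inv_into U \<phi>)) ?T"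
      by (rule complex_diff_on_compose[OF d1 d2])
        (auto simp: Q_def inv_into_f_f chartD(3)[OF U(2)])
    then have 3: "complex_diff_on (*s) (*) (?h \<circ> inv_into U \<phi>) ?T"
      by (rule complex_diff_on_cong)
        (auto simp: Q_def inv_into_f_f chartD(3)[OF U(2)] chartD(3)[OF U'(1)])
    show "\<exists>T. openin (top_of_set (\<phi> ` (U \<inter> ?W))) T \<and> z \<in> T \<and>
        complex_diff_on (*s) (*) (?h \<circ> inv_into U \<phi>) T"
      using 1 2 3 by blast
  qed
  then show ?case using U by simp
qed

lemma openin_nonzero_set:
  assumes f: "hol_on V f W"
  shows "openin (top_of V) {x \<in> W. f x \<noteq> 0}"
proof (subst openin_subopen, intro ballI)
  fix x assume x: "x \<in> {x \<in> W. f x \<noteq> 0}"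
  note open_W = hol_onD_open[OF f]
  obtain U \<phi> where U: "(U, \<phi>) \<in> atlas V" "x \<in> U"
    using chart_at openin_subset_carrier[OF open_W] x by blast
  have "complex_diff_on (*s) (*) (f \<circ> inv_into U \<phi>) (\<phi> ` (U \<inter> W))"
    using f U(1) unfolding hol_on_def by auto
  then have c1: "continuous_map (top_of_set (\<phi> ` (U \<inter> W))) euclidean (f \<circ> inv_into U \<phi>)"
    using complex_diff_on_imp_continuous_on continuous_map_iff_continuous by blast
  have c2: "continuous_map (subtopology (top_of V) (U \<inter> W)) (top_of_set (\<phi> ` (U \<inter> W))) \<phi>"
    using chartD(5)[OF U(1)]
    by (auto simp: continuous_map_in_subtopology continuous_map_from_subtopology_mono)
  have "continuous_map (subtopology (top_of V) (U \<inter> W)) euclidean ((f \<circ> inv_into U \<phi>) \<circ> \<phi>)"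
    using continuous_map_compose[OF c2 c1] .
  then have c: "continuous_map (subtopology (top_of V) (U \<inter> W)) euclidean f"
    by (rule continuous_map_eq) (auto simp: inv_into_f_f chartD(3)[OF U(1)])
  have "openin (subtopology (top_of V) (U \<inter> W))
      {y \<in> topspace (subtopology (top_of V) (U \<inter> W)). f y \<in> - {0}}"
    by (rule openin_continuous_map_preimage[OF c]) (simp add: open_Compl)
  moreover have "openin (top_of V) (U \<inter> W)"
    using chartD(1)[OF U(1)] open_W by blast
  ultimately have "openin (top_of V) {y \<in> topspace (subtopology (top_of V) (U \<inter> W)). f y \<in> - {0}}"
    using openin_trans_full by blast
  moreover have "{y \<in> topspace (subtopology (top_of V) (U \<inter> W)). f y \<in> - {0}} =
      {y \<in> U \<inter> W. f y \<noteq> 0}"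
    using chartD(2)[OF U(1)] topspace_V by auto
  ultimately show "\<exists>T. openin (top_of V) T \<and> x \<in> T \<and> T \<subseteq> {x \<in> W. f x \<noteq> 0}"
    using x U by (intro exI[of _ "{y \<in> U \<inter> W. f y \<noteq> 0}"]) auto
qed

lemma denominator_on_subset:
  "denominator_on V q W \<Longrightarrow> openin (top_of V) W' \<Longrightarrow> W' \<subseteq> W \<Longrightarrow> denominator_on V q W'"
  unfolding denominator_on_def using hol_on_subset by blast

lemma denominator_on_one: "openin (top_of V) W \<Longrightarrow> denominator_on V (\<lambda>_. 1) W"
  unfolding denominator_on_def by (auto intro: hol_on_const)

text \<open>
  The zeros of a denominator have an open dense complement, and the second factor is non-zero
  somewhere on each open subset of it. In this way products of denominators are controlled by
  continuity alone.
\<close>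

lemma denominator_on_mult:
  assumes p: "denominator_on V p W" and q: "denominator_on V q W"
  shows "denominator_on V (\<lambda>x. p x * q x) W"
  unfolding denominator_on_def
proof (intro conjI allI impI)
  show "hol_on V (\<lambda>x. p x * q x) W"
    by (rule hol_on_mult) (use p q in \<open>simp_all add: denominator_on_def\<close>)
  fix U assume U: "openin (top_of V) U \<and> U \<subseteq> W \<and> U \<noteq> {}"
  let ?U = "U \<inter> {x \<in> W. p x \<noteq> 0}"
  have "openin (top_of V) ?U"
    using U openin_nonzero_set p unfolding denominator_on_def by blast
  moreover have "?U \<noteq> {}"
    using p U unfolding denominator_on_def by blast
  ultimately obtain y where "y \<in> ?U" "q y \<noteq> 0"
    using q U unfolding denominator_on_def by (elim conjE allE[of _ "?U"]) auto
  then show "\<exists>y\<in>U. p y * q y \<noteq> 0" by auto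
qed

text \<open>
  A holomorphic map with a holomorphic inverse pulls denominators back to denominators; this is
  why left translations and the given automorphisms act on meromorphic germs.
\<close>

definition biholomorphic :: "('v \<Rightarrow> 'v) \<Rightarrow> bool"
  where "biholomorphic \<theta> \<longleftrightarrow> holomorphic_map V \<theta> \<and> (\<exists>\<theta>'. holomorphic_map V \<theta>' \<and>
    (\<forall>x\<in>carrier V. \<theta> x \<in> carrier V \<and> \<theta>' x \<in> carrier V \<and> \<theta>' (\<theta> x) = x \<and> \<theta> (\<theta>' x) = x))"

lemma biholomorphic_closed: "biholomorphic \<theta> \<Longrightarrow> x \<in> carrier V \<Longrightarrow> \<theta> x \<in> carrier V"
  unfolding biholomorphic_def by blast

lemma denominator_on_comp:
  assumes q: "denominator_on V q W" and \<theta>: "biholomorphic \<theta>"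
  shows "denominator_on V (\<lambda>x. q (\<theta> x)) {x \<in> carrier V. \<theta> x \<in> W}"
  unfolding denominator_on_def
proof (intro conjI allI impI)
  show "hol_on V (\<lambda>x. q (\<theta> x)) {x \<in> carrier V. \<theta> x \<in> W}"
    by (rule hol_on_comp) (use q \<theta> in \<open>simp_all add: denominator_on_def biholomorphic_def\<close>)
  fix U assume U: "openin (top_of V) U \<and> U \<subseteq> {x \<in> carrier V. \<theta> x \<in> W} \<and> U \<noteq> {}"
  obtain \<theta>' where \<theta>': "holomorphic_map V \<theta>'"
    "\<And>x. x \<in> carrier V \<Longrightarrow> \<theta> x \<in> carrier V \<and> \<theta>' x \<in> carrier V \<and> \<theta>' (\<theta> x) = x \<and> \<theta> (\<theta>' x) = x"
    using \<theta> unfolding biholomorphic_def by blast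
  let ?U = "{y \<in> carrier V. \<theta>' y \<in> U}"
  have "openin (top_of V) ?U"
    using openin_continuous_map_preimage[of "top_of V" "top_of V" \<theta>' U] \<theta>'(1) U
    by (simp add: holomorphic_map_def topspace_V)
  moreover have "?U \<subseteq> W"
  proof
    fix y assume "y \<in> ?U"
    then have "y \<in> carrier V" "\<theta> (\<theta>' y) \<in> W" using U by auto
    then show "y \<in> W" using \<theta>'(2) by simp
  qed
  moreover obtain u where "u \<in> U" "u \<in> carrier V" using U by blast
  then have "\<theta> u \<in> ?U" using \<theta>'(2) by simp
  then have "?U \<noteq> {}" by blast
  ultimately have "\<exists>y\<in>?U. q y \<noteq> 0"
    using q unfolding denominator_on_def by (elim conjE allE[of _ "?U"]) auto
  then obtain y where "y \<in> carrier V" "\<theta>' y \<in> U" "q y \<noteq> 0" by blast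
  then show "\<exists>y\<in>U. q (\<theta> y) \<noteq> 0"
    using \<theta>'(2) by (intro bexI[of _ "\<theta>' y"]) simp_all
qed

lemma hol_at_comp:
  assumes "hol_at V (\<theta> x) f" "biholomorphic \<theta>" "x \<in> carrier V"
  shows "hol_at V x (\<lambda>y. f (\<theta> y))"
proof -
  obtain W where W: "\<theta> x \<in> W" "hol_on V f W"
    using assms(1) unfolding hol_at_def by blast
  have "hol_on V (\<lambda>y. f (\<theta> y)) {y \<in> carrier V. \<theta> y \<in> W}"
    by (rule hol_on_comp[OF W(2)]) (use assms(2) in \<open>simp add: biholomorphic_def\<close>)
  with W(1) assms(3) show ?thesis
    unfolding hol_at_def by (intro exI[of _ "{y \<in> carrier V. \<theta> y \<in> W}"]) simp
qed

lemma holomorphic_left_translation: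
  assumes a: "a \<in> carrier V"
  shows "holomorphic_map V (\<lambda>x. a \<otimes> x)"
  unfolding holomorphic_map_def
proof (intro conjI ballI, goal_cases)
  case 1
  have "continuous_map (prod_topology (top_of V) (top_of V)) (top_of V) (\<lambda>(x, y). x \<otimes> y)"
    using holomorphic_mult by (simp add: holomorphic_binop_def)
  moreover have "continuous_map (top_of V) (prod_topology (top_of V) (top_of V)) (\<lambda>x. (a, x))"
    using a topspace_V by (intro continuous_map_pairedI) auto
  ultimately have "continuous_map (top_of V) (top_of V) ((\<lambda>(x, y). x \<otimes> y) \<circ> (\<lambda>x. (a, x)))"
    using continuous_map_compose by blast
  then show ?case by (simp add: o_def)
next
  case (2 p)
  then obtain U \<phi> where U: "p = (U, \<phi>)" "(U, \<phi>) \<in> atlas V" by (metis surj_pair)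
  obtain U0 \<phi>0 where U0: "(U0, \<phi>0) \<in> atlas V" "a \<in> U0"
    using chart_at a by blast
  have "complex_diff_on (*s) (*s) (\<phi>' \<circ> (\<otimes>) a \<circ> inv_into U \<phi>) (\<phi> ` {x \<in> U. a \<otimes> x \<in> U'})"
    if U': "(U', \<phi>') \<in> atlas V" for U' \<phi>'
  proof -
    have d2: "complex_diff_on pair_scale (*s)
         (\<lambda>(\<alpha>, b). \<phi>' (inv_into U0 \<phi>0 \<alpha> \<otimes> inv_into U \<phi> b))
         {(\<phi>0 x, \<phi> y) | x y. x \<in> U0 \<and> y \<in> U \<and> x \<otimes> y \<in> U'}"
      using holomorphic_mult U0(1) U(2) U' unfolding holomorphic_binop_def by fast
    have d1: "complex_diff_on (*s) pair_scale (\<lambda>b. (\<phi>0 a, b)) (\<phi> ` {x \<in> U. a \<otimes> x \<in> U'})"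
      unfolding complex_diff_on_def
      by (intro ballI exI[of _ "\<lambda>w. (0, w)"])
        (auto simp: pair_scale_def intro!: has_derivative_Pair derivative_eq_intros)
    have "complex_diff_on (*s) (*s) ((\<lambda>(\<alpha>, b). \<phi>' (inv_into U0 \<phi>0 \<alpha> \<otimes> inv_into U \<phi> b)) \<circ>
        (\<lambda>b. (\<phi>0 a, b))) (\<phi> ` {x \<in> U. a \<otimes> x \<in> U'})"
      by (rule complex_diff_on_compose[OF d1 d2]) (use U0(2) in auto)
    then show ?thesis
      by (rule complex_diff_on_cong) (auto simp: inv_into_f_f chartD(3)[OF U0(1)] U0(2))
  qed
  then show ?case using U by auto
qed

lemma biholomorphic_left_translation:
  assumes a: "a \<in> carrier V"
  shows "biholomorphic (\<lambda>x. a \<otimes> x)"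
  unfolding biholomorphic_def
  using holomorphic_left_translation[OF a] holomorphic_left_translation[OF inv_closed[OF a]] a
  by (intro conjI exI[of _ "\<lambda>x. inv a \<otimes> x"]) (auto simp: m_assoc[symmetric])

end

section \<open>Rings of germs\<close>

context complex_lie_group
begin

abbreviation \<M> where "\<M> \<equiv> mero_germs V"
abbreviation \<O> where "\<O> \<equiv> hol_germs V"

lemma mero_eqI:
  assumes "openin (top_of V) W" "x \<in> W" "\<And>y. y \<in> W \<Longrightarrow> f y = g y"
  shows "mero_eq V x f g"
  unfolding mero_eq_def
  by (rule exI[of _ W], rule exI[of _ "\<lambda>_. 1"]) (use assms denominator_on_one in auto)

lemma mero_eq_common:
  assumes "mero_eq V x f f'" "mero_eq V x g g'"
  obtains W q where "x \<in> W" "denominator_on V q W"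
    "\<And>y. y \<in> W \<Longrightarrow> q y \<noteq> 0 \<Longrightarrow> f y = f' y \<and> g y = g' y"
proof -
  obtain W1 q1 where 1: "x \<in> W1" "denominator_on V q1 W1" "\<forall>y\<in>W1. q1 y \<noteq> 0 \<longrightarrow> f y = f' y"
    using assms(1) unfolding mero_eq_def by blast
  obtain W2 q2 where 2: "x \<in> W2" "denominator_on V q2 W2" "\<forall>y\<in>W2. q2 y \<noteq> 0 \<longrightarrow> g y = g' y"
    using assms(2) unfolding mero_eq_def by blast
  have "openin (top_of V) (W1 \<inter> W2)"
    using 1(2) 2(2) hol_onD_open unfolding denominator_on_def by blast
  then have "denominator_on V (\<lambda>y. q1 y * q2 y) (W1 \<inter> W2)"
    using denominator_on_subset[OF 1(2)] denominator_on_subset[OF 2(2)]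
    by (intro denominator_on_mult) auto
  then show ?thesis
    using 1 2 by (intro that[of "W1 \<inter> W2" "\<lambda>y. q1 y * q2 y"]) auto
qed

lemma mero_eq_refl: "x \<in> carrier V \<Longrightarrow> mero_eq V x f f"
  using mero_eqI[OF openin_carrier] by blast

lemma mero_eq_sym: "mero_eq V x f g \<Longrightarrow> mero_eq V x g f"
  unfolding mero_eq_def by metis

lemma mero_eq_trans:
  assumes "mero_eq V x f g" "mero_eq V x g h"
  shows "mero_eq V x f h"
proof -
  from assms obtain W q where "x \<in> W" "denominator_on V q W"
    "\<And>y. y \<in> W \<Longrightarrow> q y \<noteq> 0 \<Longrightarrow> f y = g y \<and> g y = h y"
    by (rule mero_eq_common) blast
  then show ?thesis unfolding mero_eq_def by (intro exI[of _ W] exI[of _ q]) auto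
qed

lemma germ_eq_iff: "x \<in> carrier V \<Longrightarrow> germ V x f = germ V x g \<longleftrightarrow> mero_eq V x f g"
  unfolding germ_def using mero_eq_refl mero_eq_sym mero_eq_trans by blast

lemma germ_self: "x \<in> carrier V \<Longrightarrow> f \<in> germ V x f"
  unfolding germ_def using mero_eq_refl by blast

lemma germ_eqI:
  assumes "x \<in> carrier V" "\<And>y. y \<in> carrier V \<Longrightarrow> f y = g y"
  shows "germ V x f = germ V x g"
  using assms mero_eqI[OF openin_carrier] germ_eq_iff by blast

lemma mero_eq_binop:
  assumes "mero_eq V x f f'" "mero_eq V x g g'"
  shows "mero_eq V x (\<lambda>y. h (f y) (g y)) (\<lambda>y. h (f' y) (g' y))"
proof -
  from assms obtain W q where "x \<in> W" "denominator_on V q W"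
    "\<And>y. y \<in> W \<Longrightarrow> q y \<noteq> 0 \<Longrightarrow> f y = f' y \<and> g y = g' y"
    by (rule mero_eq_common) blast
  then show ?thesis unfolding mero_eq_def by (intro exI[of _ W] exI[of _ q]) auto
qed

lemma germ_binop:
  assumes "x \<in> carrier V"
  shows "(\<Union>f'\<in>germ V x f. \<Union>g'\<in>germ V x g. germ V x (\<lambda>y. h (f' y) (g' y))) =
    germ V x (\<lambda>y. h (f y) (g y))"
proof -
  have "germ V x (\<lambda>y. h (f' y) (g' y)) = germ V x (\<lambda>y. h (f y) (g y))"
    if "f' \<in> germ V x f" "g' \<in> germ V x g" for f' g'
    using that assms germ_eq_iff mero_eq_binop[of x f f' g g' h] unfolding germ_def[of V x f] germ_def[of V x g]
    by (simp add: mero_eq_sym)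
  then show ?thesis using germ_self[OF assms] by blast
qed

lemma germ_mult:
  "x \<in> carrier V \<Longrightarrow> germ V x f \<otimes>\<^bsub>\<M> x\<^esub> germ V x g = germ V x (\<lambda>y. f y * g y)"
  unfolding mero_germs_def using germ_binop[where h = "(*)" and f = f and g = g] by simp

lemma germ_add:
  "x \<in> carrier V \<Longrightarrow> germ V x f \<oplus>\<^bsub>\<M> x\<^esub> germ V x g = germ V x (\<lambda>y. f y + g y)"
  unfolding mero_germs_def using germ_binop[where h = "(+)" and f = f and g = g] by simp

lemma germ_one: "\<one>\<^bsub>\<M> x\<^esub> = germ V x (\<lambda>_. 1)"
  by (simp add: mero_germs_def)

lemma germ_zero: "\<zero>\<^bsub>\<M> x\<^esub> = germ V x (\<lambda>_. 0)"
  by (simp add: mero_germs_def)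

lemma hol_germs_simps [simp]:
  "a \<otimes>\<^bsub>\<O> x\<^esub> b = a \<otimes>\<^bsub>\<M> x\<^esub> b" "a \<oplus>\<^bsub>\<O> x\<^esub> b = a \<oplus>\<^bsub>\<M> x\<^esub> b" "\<one>\<^bsub>\<O> x\<^esub> = \<one>\<^bsub>\<M> x\<^esub>" "\<zero>\<^bsub>\<O> x\<^esub> = \<zero>\<^bsub>\<M> x\<^esub>"
  by (simp_all add: hol_germs_def)

lemma hol_at_const: "x \<in> carrier V \<Longrightarrow> hol_at V x (\<lambda>_. c)"
  unfolding hol_at_def using hol_on_const[OF openin_carrier] by blast

lemma hol_at_common:
  assumes "hol_at V x f" "hol_at V x g"
  obtains W where "x \<in> W" "hol_on V f W" "hol_on V g W"
proof -
  obtain W1 W2 where "x \<in> W1" "hol_on V f W1" "x \<in> W2" "hol_on V g W2"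
    using assms unfolding hol_at_def by blast
  then show ?thesis
    using that[of "W1 \<inter> W2"] hol_on_subset[of _ _ "W1 \<inter> W2"] hol_onD_open by (meson IntI Int_lower1 Int_lower2 openin_Int)
qed

lemma hol_at_add: "hol_at V x f \<Longrightarrow> hol_at V x g \<Longrightarrow> hol_at V x (\<lambda>y. f y + g y)"
  by (erule (1) hol_at_common) (auto simp: hol_at_def intro: hol_on_add)

lemma hol_at_mult: "hol_at V x f \<Longrightarrow> hol_at V x g \<Longrightarrow> hol_at V x (\<lambda>y. f y * g y)"
  by (erule (1) hol_at_common) (auto simp: hol_at_def intro: hol_on_mult)

lemma mero_at_binop:
  assumes "mero_at V x f" "mero_at V x g"
  obtains W p q r s where "x \<in> W" "hol_on V p W" "denominator_on V q W" "hol_on V r W"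
    "denominator_on V s W" "\<And>y. y \<in> W \<Longrightarrow> q y \<noteq> 0 \<Longrightarrow> f y = p y / q y"
    "\<And>y. y \<in> W \<Longrightarrow> s y \<noteq> 0 \<Longrightarrow> g y = r y / s y"
proof -
  obtain W1 p q where 1: "x \<in> W1" "hol_on V p W1" "denominator_on V q W1"
    "\<forall>y\<in>W1. q y \<noteq> 0 \<longrightarrow> f y = p y / q y"
    using assms(1) unfolding mero_at_def by blast
  obtain W2 r s where 2: "x \<in> W2" "hol_on V r W2" "denominator_on V s W2"
    "\<forall>y\<in>W2. s y \<noteq> 0 \<longrightarrow> g y = r y / s y"
    using assms(2) unfolding mero_at_def by blast
  have "openin (top_of V) (W1 \<inter> W2)"
    using 1(2) 2(2) hol_onD_open by blast
  then show ?thesis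
    using 1 2 by (intro that[of "W1 \<inter> W2" p q r s]) (auto intro: hol_on_subset denominator_on_subset)
qed

lemma mero_at_add:
  assumes "mero_at V x f" "mero_at V x g"
  shows "mero_at V x (\<lambda>y. f y + g y)"
proof -
  obtain W p q r s where *: "x \<in> W" "hol_on V p W" "denominator_on V q W" "hol_on V r W"
    "denominator_on V s W" "\<And>y. y \<in> W \<Longrightarrow> q y \<noteq> 0 \<Longrightarrow> f y = p y / q y"
    "\<And>y. y \<in> W \<Longrightarrow> s y \<noteq> 0 \<Longrightarrow> g y = r y / s y"
    using mero_at_binop[OF assms] by metis
  have "hol_on V (\<lambda>y. p y * s y + r y * q y) W"
    using * unfolding denominator_on_def by (intro hol_on_add hol_on_mult) auto
  moreover have "denominator_on V (\<lambda>y. q y * s y) W"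
    using * by (intro denominator_on_mult)
  ultimately show ?thesis
    unfolding mero_at_def
    by (intro exI[of _ W] exI[of _ "\<lambda>y. p y * s y + r y * q y"] exI[of _ "\<lambda>y. q y * s y"])
      (use * in \<open>auto simp: add_frac_eq\<close>)
qed

lemma mero_at_mult:
  assumes "mero_at V x f" "mero_at V x g"
  shows "mero_at V x (\<lambda>y. f y * g y)"
proof -
  obtain W p q r s where *: "x \<in> W" "hol_on V p W" "denominator_on V q W" "hol_on V r W"
    "denominator_on V s W" "\<And>y. y \<in> W \<Longrightarrow> q y \<noteq> 0 \<Longrightarrow> f y = p y / q y"
    "\<And>y. y \<in> W \<Longrightarrow> s y \<noteq> 0 \<Longrightarrow> g y = r y / s y"
    using mero_at_binop[OF assms] by metis
  have "hol_on V (\<lambda>y. p y * r y) W" "denominator_on V (\<lambda>y. q y * s y) W"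
    using * by (auto intro: denominator_on_mult hol_on_mult)
  then show ?thesis
    unfolding mero_at_def
    by (intro exI[of _ W] exI[of _ "\<lambda>y. p y * r y"] exI[of _ "\<lambda>y. q y * s y"])
      (use * in auto)
qed

lemma hol_at_imp_mero_at:
  assumes "hol_at V x f"
  shows "mero_at V x f"
proof -
  obtain W where "x \<in> W" "hol_on V f W" using assms unfolding hol_at_def by blast
  then show ?thesis
    unfolding mero_at_def using hol_onD_open denominator_on_one
    by (intro exI[of _ W] exI[of _ f] exI[of _ "\<lambda>_. 1"]) auto
qed

lemma mero_at_const: "x \<in> carrier V \<Longrightarrow> mero_at V x (\<lambda>_. c)"
  using hol_at_const hol_at_imp_mero_at by blast

lemma mero_germsE:
  assumes "a \<in> carrier (\<M> x)"
  obtains f where "a = germ V x f" "mero_at V x f"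
  using assms by (auto simp: mero_germs_def)

lemma mero_germsI: "mero_at V x f \<Longrightarrow> germ V x f \<in> carrier (\<M> x)"
  by (auto simp: mero_germs_def)

lemma hol_germsE:
  assumes "a \<in> carrier (\<O> x)"
  obtains f where "a = germ V x f" "hol_at V x f"
  using assms by (auto simp: hol_germs_def)

lemma hol_germsI: "hol_at V x f \<Longrightarrow> germ V x f \<in> carrier (\<O> x)"
  by (auto simp: hol_germs_def)

lemma hol_germs_subset: "carrier (\<O> x) \<subseteq> carrier (\<M> x)"
  using mero_germsI hol_at_imp_mero_at by (auto simp: hol_germs_def)

lemma cring_mero_germs:
  assumes x: "x \<in> carrier V"
  shows "cring (\<M> x)"
proof (rule cringI)
  note E = mero_germsE and S = germ_add[OF x] germ_mult[OF x] germ_one germ_zero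
  show "abelian_group (\<M> x)"
  proof (rule abelian_groupI)
    fix a assume "a \<in> carrier (\<M> x)"
    then obtain f where f: "a = germ V x f" "mero_at V x f" by (rule E)
    have "mero_at V x (\<lambda>y. (-1) * f y)"
      using f(2) mero_at_const[OF x] by (intro mero_at_mult)
    then show "\<exists>b\<in>carrier (\<M> x). b \<oplus>\<^bsub>\<M> x\<^esub> a = \<zero>\<^bsub>\<M> x\<^esub>"
      by (intro bexI[of _ "germ V x (\<lambda>y. (-1) * f y)"] mero_germsI) (simp_all add: S f(1))
  qed (auto elim!: E simp: S algebra_simps mero_at_const x intro!: mero_germsI mero_at_add)
  show "comm_monoid (\<M> x)"
    by (rule comm_monoidI)
      (auto elim!: E simp: S algebra_simps mero_at_const x intro!: mero_germsI mero_at_mult)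
qed (auto elim!: mero_germsE simp: germ_add germ_mult x algebra_simps)

lemma germ_uminus:
  assumes x: "x \<in> carrier V" and f: "mero_at V x f"
  shows "\<ominus>\<^bsub>\<M> x\<^esub> germ V x f = germ V x (\<lambda>y. - f y)"
proof -
  interpret R: cring "\<M> x" using cring_mero_germs[OF x] .
  have "mero_at V x (\<lambda>y. (-1) * f y)"
    using f mero_at_const[OF x] by (intro mero_at_mult)
  then have "germ V x (\<lambda>y. - f y) \<in> carrier (\<M> x)" by (simp add: mero_germsI)
  then show ?thesis
    by (intro R.minus_equality) (simp_all add: germ_add x germ_zero mero_germsI f)
qed

lemma subring_hol_germs:
  assumes x: "x \<in> carrier V"
  shows "subring (carrier (\<O> x)) (\<M> x)"
proof -
  interpret R: cring "\<M> x" using cring_mero_germs[OF x] .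
  show ?thesis
  proof (rule R.subringI)
    show "carrier (\<O> x) \<subseteq> carrier (\<M> x)" by (rule hol_germs_subset)
    show "\<one>\<^bsub>\<M> x\<^esub> \<in> carrier (\<O> x)" by (simp add: germ_one hol_germsI hol_at_const x)
  next
    fix h assume "h \<in> carrier (\<O> x)"
    then obtain f where f: "h = germ V x f" "hol_at V x f" by (rule hol_germsE)
    have "hol_at V x (\<lambda>y. (-1) * f y)" using f(2) hol_at_const[OF x] by (intro hol_at_mult)
    then show "\<ominus>\<^bsub>\<M> x\<^esub> h \<in> carrier (\<O> x)"
      by (simp add: f germ_uminus x hol_at_imp_mero_at hol_germsI)
  qed (auto elim!: hol_germsE simp: germ_mult germ_add x intro!: hol_germsI hol_at_mult hol_at_add)
qed

lemma hol_germs_eq: "\<O> x = (\<M> x)\<lparr>carrier := carrier (\<O> x)\<rparr>"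
  by (simp add: hol_germs_def)

lemma cring_hol_germs:
  assumes x: "x \<in> carrier V"
  shows "cring (\<O> x)"
  using cring.subcringI'[OF cring_mero_germs subring_hol_germs]
    ring.subcring_iff[OF cring.axioms(1)[OF cring_mero_germs] hol_germs_subset] hol_germs_eq x
  by metis

text \<open>
  If the values differed, the two functions would differ on a neighbourhood, which contains a
  point where the denominator does not vanish.
\<close>

lemma hol_at_mero_eq_imp_eq:
  assumes f: "hol_at V x f" and g: "hol_at V x g" and eq: "mero_eq V x f g"
  shows "f x = g x"
proof (rule ccontr)
  assume ne: "f x \<noteq> g x"
  obtain W where W: "x \<in> W" "hol_on V f W" "hol_on V g W"
    using hol_at_common[OF f g] by blast
  obtain W' q where q: "x \<in> W'" "denominator_on V q W'" "\<forall>y\<in>W'. q y \<noteq> 0 \<longrightarrow> f y = g y"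
    using eq unfolding mero_eq_def by blast
  have "hol_on V (\<lambda>y. f y + (-1) * g y) W"
    using W hol_onD_open by (intro hol_on_add hol_on_mult hol_on_const) auto
  then have "openin (top_of V) {y \<in> W. f y + (-1) * g y \<noteq> 0}"
    by (rule openin_nonzero_set)
  moreover have "openin (top_of V) W'"
    using q(2) hol_onD_open unfolding denominator_on_def by blast
  ultimately have "openin (top_of V) ({y \<in> W. f y + (-1) * g y \<noteq> 0} \<inter> W')" (is "openin _ ?U")
    by blast
  moreover have "x \<in> ?U" using ne W q by simp
  ultimately have "\<exists>y\<in>?U. q y \<noteq> 0"
    using q(2) unfolding denominator_on_def by (elim conjE allE[of _ ?U]) auto
  then show False using q(3) by auto
qed

lemma germ_value_germ:
  assumes x: "x \<in> carrier V" and f: "hol_at V x f"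
  shows "germ_value V x (germ V x f) = f x"
  unfolding germ_value_def
proof (rule the_equality)
  show "\<exists>g\<in>germ V x f. hol_at V x g \<and> g x = f x"
    using germ_self[OF x] f by blast
  fix c assume "\<exists>g\<in>germ V x f. hol_at V x g \<and> g x = c"
  then obtain g where "mero_eq V x f g" "hol_at V x g" "g x = c"
    unfolding germ_def by blast
  then show "c = f x" using hol_at_mero_eq_imp_eq[OF f] by metis
qed

lemma germ_value_add:
  assumes x: "x \<in> carrier V" and "a \<in> carrier (\<O> x)" "b \<in> carrier (\<O> x)"
  shows "germ_value V x (a \<oplus>\<^bsub>\<M> x\<^esub> b) = germ_value V x a + germ_value V x b"
  using assms(2,3) by (auto elim!: hol_germsE simp: germ_add germ_value_germ x hol_at_add)

lemma germ_value_mult: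
  assumes x: "x \<in> carrier V" and "a \<in> carrier (\<O> x)" "b \<in> carrier (\<O> x)"
  shows "germ_value V x (a \<otimes>\<^bsub>\<M> x\<^esub> b) = germ_value V x a * germ_value V x b"
  using assms(2,3) by (auto elim!: hol_germsE simp: germ_mult germ_value_germ x hol_at_mult)

lemma germ_value_zero: "x \<in> carrier V \<Longrightarrow> germ_value V x \<zero>\<^bsub>\<M> x\<^esub> = 0"
  by (simp add: germ_zero germ_value_germ hol_at_const)


section \<open>Transport of germs along biholomorphic maps\<close>

lemma mero_eq_comp:
  assumes "mero_eq V (\<theta> x) f g" "biholomorphic \<theta>" "x \<in> carrier V"
  shows "mero_eq V x (\<lambda>y. f (\<theta> y)) (\<lambda>y. g (\<theta> y))"
proof -
  obtain W q where W: "\<theta> x \<in> W" "denominator_on V q W" "\<forall>y\<in>W. q y \<noteq> 0 \<longrightarrow> f y = g y"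
    using assms(1) unfolding mero_eq_def by blast
  show ?thesis
    unfolding mero_eq_def
    by (intro exI[of _ "{y \<in> carrier V. \<theta> y \<in> W}"] exI[of _ "\<lambda>y. q (\<theta> y)"])
      (use W denominator_on_comp[OF W(2) assms(2)] assms(3) in auto)
qed

lemma mero_at_comp:
  assumes "mero_at V (\<theta> x) f" "biholomorphic \<theta>" "x \<in> carrier V"
  shows "mero_at V x (\<lambda>y. f (\<theta> y))"
proof -
  obtain W p q where W: "\<theta> x \<in> W" "hol_on V p W" "denominator_on V q W"
    "\<forall>y\<in>W. q y \<noteq> 0 \<longrightarrow> f y = p y / q y"
    using assms(1) unfolding mero_at_def by blast
  have \<theta>: "holomorphic_map V \<theta>" using assms(2) by (simp add: biholomorphic_def)
  show ?thesis
    unfolding mero_at_def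
    by (intro exI[of _ "{y \<in> carrier V. \<theta> y \<in> W}"] exI[of _ "\<lambda>y. p (\<theta> y)"] exI[of _ "\<lambda>y. q (\<theta> y)"])
      (use W denominator_on_comp[OF W(3) assms(2)] hol_on_comp[OF W(2) \<theta>] assms(3) in auto)
qed

lemma germ_comp_germ:
  assumes "biholomorphic \<theta>" "x \<in> carrier V"
  shows "germ_comp V \<theta> x (germ V (\<theta> x) f) = germ V x (\<lambda>y. f (\<theta> y))"
proof -
  have "germ V x (\<lambda>y. g (\<theta> y)) = germ V x (\<lambda>y. f (\<theta> y))" if "g \<in> germ V (\<theta> x) f" for g
    using that mero_eq_comp[OF _ assms, of f g] germ_eq_iff[OF assms(2)] unfolding germ_def[of V "\<theta> x"]
    by (simp add: mero_eq_sym)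
  then show ?thesis
    unfolding germ_comp_def using germ_self[OF biholomorphic_closed[OF assms]] by blast
qed

lemma ring_hom_germ_comp:
  assumes \<theta>: "biholomorphic \<theta>" and x: "x \<in> carrier V"
  shows "ring_hom_cring (\<M> (\<theta> x)) (\<M> x) (germ_comp V \<theta> x)"
proof -
  have \<theta>x: "\<theta> x \<in> carrier V" using biholomorphic_closed[OF \<theta> x] .
  interpret R: cring "\<M> x" using cring_mero_germs[OF x] .
  interpret S: cring "\<M> (\<theta> x)" using cring_mero_germs[OF \<theta>x] .
  have "germ_comp V \<theta> x \<in> ring_hom (\<M> (\<theta> x)) (\<M> x)"
    by (rule ring_hom_memI)
      (auto elim!: mero_germsE simp: germ_comp_germ[OF \<theta> x] germ_mult germ_add germ_one x \<theta>x
        intro!: mero_germsI mero_at_comp[OF _ \<theta>])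
  then show ?thesis by unfold_locales
qed

lemma germ_comp_hol:
  assumes \<theta>: "biholomorphic \<theta>" and x: "x \<in> carrier V" and a: "a \<in> carrier (\<O> (\<theta> x))"
  shows "germ_comp V \<theta> x a \<in> carrier (\<O> x)"
    and "germ_value V x (germ_comp V \<theta> x a) = germ_value V (\<theta> x) a"
proof -
  obtain f where f: "a = germ V (\<theta> x) f" "hol_at V (\<theta> x) f" using a by (rule hol_germsE)
  have h: "hol_at V x (\<lambda>y. f (\<theta> y))" using hol_at_comp[OF f(2) \<theta> x] .
  show "germ_comp V \<theta> x a \<in> carrier (\<O> x)"
    using h by (simp add: f(1) germ_comp_germ[OF \<theta> x] hol_germsI)
  show "germ_value V x (germ_comp V \<theta> x a) = germ_value V (\<theta> x) a"
    using h f(2) biholomorphic_closed[OF \<theta> x]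
    by (simp add: f(1) germ_comp_germ[OF \<theta> x] germ_value_germ x)
qed

text \<open>
  The composite is a separate map \<open>\<theta>''\<close> because translations and automorphisms are total functions
  that are determined by the group structure only on the manifold.
\<close>

lemma germ_comp_comp:
  assumes \<theta>: "biholomorphic \<theta>" and \<theta>': "biholomorphic \<theta>'" and \<theta>'': "biholomorphic \<theta>''"
    and x: "x \<in> carrier V" and a: "a \<in> carrier (\<M> (\<theta>' (\<theta> x)))"
    and eq: "\<And>y. y \<in> carrier V \<Longrightarrow> \<theta>'' y = \<theta>' (\<theta> y)"
  shows "germ_comp V \<theta> x (germ_comp V \<theta>' (\<theta> x) a) = germ_comp V \<theta>'' x a"
proof -
  have \<theta>x: "\<theta> x \<in> carrier V" using biholomorphic_closed[OF \<theta> x] .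
  obtain f where f: "a = germ V (\<theta>' (\<theta> x)) f" using a by (rule mero_germsE)
  have "germ_comp V \<theta>'' x a = germ V x (\<lambda>y. f (\<theta>'' y))"
    using germ_comp_germ[OF \<theta>'' x, of f] eq[OF x] f by simp
  also have "\<dots> = germ V x (\<lambda>y. f (\<theta>' (\<theta> y)))"
    by (rule germ_eqI[OF x]) (simp add: eq)
  finally show ?thesis
    by (simp add: f germ_comp_germ[OF \<theta>' \<theta>x] germ_comp_germ[OF \<theta> x])
qed

lemma germ_comp_id:
  assumes \<theta>: "biholomorphic \<theta>" and x: "x \<in> carrier V" and a: "a \<in> carrier (\<M> x)"
    and eq: "\<And>y. y \<in> carrier V \<Longrightarrow> \<theta> y = y"
  shows "germ_comp V \<theta> x a = a"
proof -
  obtain f where f: "a = germ V x f" using a by (rule mero_germsE)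
  have "germ_comp V \<theta> x a = germ V x (\<lambda>y. f (\<theta> y))"
    using germ_comp_germ[OF \<theta> x, of f] eq[OF x] f by simp
  also have "\<dots> = germ V x f"
    by (rule germ_eqI[OF x]) (simp add: eq)
  finally show ?thesis using f by simp
qed

lemma trans_germ_germ:
  assumes "\<xi> \<in> carrier V" "y \<in> carrier V"
  shows "trans_germ V \<xi> y (germ V (inv \<xi> \<otimes> y) f) = germ V y (\<lambda>x. f (inv \<xi> \<otimes> x))"
  unfolding trans_germ_def
  using germ_comp_germ[OF biholomorphic_left_translation[OF inv_closed[OF assms(1)]] assms(2)] .

lemma trans_germ_hol:
  assumes "\<xi> \<in> carrier V" "y \<in> carrier V" "a \<in> carrier (\<O> (inv \<xi> \<otimes> y))"
  shows "trans_germ V \<xi> y a \<in> carrier (\<O> y)"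
    and "germ_value V y (trans_germ V \<xi> y a) = germ_value V (inv \<xi> \<otimes> y) a"
  unfolding trans_germ_def
  using germ_comp_hol[OF biholomorphic_left_translation[OF inv_closed[OF assms(1)]] assms(2,3)] .

lemma trans_germ_trans_germ:
  assumes "\<xi> \<in> carrier V" "\<zeta> \<in> carrier V" "y \<in> carrier V"
    "a \<in> carrier (\<M> (inv \<zeta> \<otimes> (inv \<xi> \<otimes> y)))"
  shows "trans_germ V \<xi> y (trans_germ V \<zeta> (inv \<xi> \<otimes> y) a) = trans_germ V (\<xi> \<otimes> \<zeta>) y a"
  unfolding trans_germ_def
  by (rule germ_comp_comp)
    (use assms in \<open>auto intro!: biholomorphic_left_translation simp: inv_mult_group m_assoc\<close>)

lemma trans_germ_one:
  assumes "y \<in> carrier V" "a \<in> carrier (\<M> y)"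
  shows "trans_germ V \<one> y a = a"
  unfolding trans_germ_def
  by (rule germ_comp_id) (use assms in \<open>auto intro!: biholomorphic_left_translation\<close>)

end

section \<open>Meromorphic sections and the skew-group ring\<close>

lemma (in abelian_monoid) finsum_swap:
  assumes "finite A" "finite B" "\<And>i j. i \<in> A \<Longrightarrow> j \<in> B \<Longrightarrow> f i j \<in> carrier G"
  shows "finsum G (\<lambda>i. finsum G (f i) B) A = finsum G (\<lambda>j. finsum G (\<lambda>i. f i j) A) B"
  using assms(1,3)
proof (induction A rule: finite_induct)
  case empty
  show ?case by (simp add: finsum_zero)
next
  case (insert a A)
  have "finsum G (\<lambda>i. finsum G (f i) B) (insert a A) =
      finsum G (f a) B \<oplus> finsum G (\<lambda>i. finsum G (f i) B) A"
    using insert.hyps insert.prems by (intro finsum_insert) (auto intro!: finsum_closed)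
  also have "\<dots> = finsum G (f a) B \<oplus> finsum G (\<lambda>j. finsum G (\<lambda>i. f i j) A) B"
    using insert by simp
  also have "\<dots> = finsum G (\<lambda>j. f a j \<oplus> finsum G (\<lambda>i. f i j) A) B"
    using insert.prems by (intro finsum_addf[symmetric]) (auto intro!: finsum_closed)
  also have "\<dots> = finsum G (\<lambda>j. finsum G (\<lambda>i. f i j) (insert a A)) B"
    using insert.hyps insert.prems
    by (intro finsum_cong') (auto intro!: finsum_closed finsum_insert[symmetric])
  finally show ?case .
qed

context complex_lie_group
begin

abbreviation germ_families :: "('v \<Rightarrow> 'v germ) set"
  where "germ_families \<equiv> \<Pi>\<^sub>E x\<in>carrier V. carrier (\<M> x)"

lemma mero_germs_laws:
  assumes "y \<in> carrier V" "a \<in> carrier (\<M> y)" "b \<in> carrier (\<M> y)"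
  shows mero_add_in: "a \<oplus>\<^bsub>\<M> y\<^esub> b \<in> carrier (\<M> y)"
    and mero_mult_in: "a \<otimes>\<^bsub>\<M> y\<^esub> b \<in> carrier (\<M> y)"
    and mero_add_comm: "a \<oplus>\<^bsub>\<M> y\<^esub> b = b \<oplus>\<^bsub>\<M> y\<^esub> a"
    and mero_add_assoc: "c \<in> carrier (\<M> y) \<Longrightarrow> a \<oplus>\<^bsub>\<M> y\<^esub> b \<oplus>\<^bsub>\<M> y\<^esub> c = a \<oplus>\<^bsub>\<M> y\<^esub> (b \<oplus>\<^bsub>\<M> y\<^esub> c)"
proof -
  interpret M: cring "\<M> y" using cring_mero_germs[OF assms(1)] .
  show "a \<oplus>\<^bsub>\<M> y\<^esub> b \<in> carrier (\<M> y)" "a \<otimes>\<^bsub>\<M> y\<^esub> b \<in> carrier (\<M> y)"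
    "a \<oplus>\<^bsub>\<M> y\<^esub> b = b \<oplus>\<^bsub>\<M> y\<^esub> a"
    "c \<in> carrier (\<M> y) \<Longrightarrow> a \<oplus>\<^bsub>\<M> y\<^esub> b \<oplus>\<^bsub>\<M> y\<^esub> c = a \<oplus>\<^bsub>\<M> y\<^esub> (b \<oplus>\<^bsub>\<M> y\<^esub> c)"
    using assms by (simp_all add: M.a_ac)
qed

lemma mero_zero_add:
  assumes "y \<in> carrier V" "a \<in> carrier (\<M> y)"
  shows "\<zero>\<^bsub>\<M> y\<^esub> \<oplus>\<^bsub>\<M> y\<^esub> a = a"
proof -
  interpret M: cring "\<M> y" using cring_mero_germs[OF assms(1)] .
  show ?thesis using assms(2) by simp
qed

lemma germ_comp_hom:
  assumes \<theta>: "biholomorphic \<theta>" and y: "y \<in> carrier V"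
  shows germ_comp_in: "a \<in> carrier (\<M> (\<theta> y)) \<Longrightarrow> germ_comp V \<theta> y a \<in> carrier (\<M> y)"
    and germ_comp_add: "a \<in> carrier (\<M> (\<theta> y)) \<Longrightarrow> b \<in> carrier (\<M> (\<theta> y)) \<Longrightarrow>
      germ_comp V \<theta> y (a \<oplus>\<^bsub>\<M> (\<theta> y)\<^esub> b) = germ_comp V \<theta> y a \<oplus>\<^bsub>\<M> y\<^esub> germ_comp V \<theta> y b"
    and germ_comp_mult: "a \<in> carrier (\<M> (\<theta> y)) \<Longrightarrow> b \<in> carrier (\<M> (\<theta> y)) \<Longrightarrow>
      germ_comp V \<theta> y (a \<otimes>\<^bsub>\<M> (\<theta> y)\<^esub> b) = germ_comp V \<theta> y a \<otimes>\<^bsub>\<M> y\<^esub> germ_comp V \<theta> y b"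
    and germ_comp_zero: "germ_comp V \<theta> y \<zero>\<^bsub>\<M> (\<theta> y)\<^esub> = \<zero>\<^bsub>\<M> y\<^esub>"
    and germ_comp_uminus: "a \<in> carrier (\<M> (\<theta> y)) \<Longrightarrow>
      germ_comp V \<theta> y (\<ominus>\<^bsub>\<M> (\<theta> y)\<^esub> a) = \<ominus>\<^bsub>\<M> y\<^esub> germ_comp V \<theta> y a"
    and germ_comp_finsum: "(\<And>i. i \<in> F \<Longrightarrow> m i \<in> carrier (\<M> (\<theta> y))) \<Longrightarrow>
      germ_comp V \<theta> y (finsum (\<M> (\<theta> y)) m F) = finsum (\<M> y) (\<lambda>i. germ_comp V \<theta> y (m i)) F"
proof -
  interpret ring_hom_cring "\<M> (\<theta> y)" "\<M> y" "germ_comp V \<theta> y"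
    using ring_hom_germ_comp[OF \<theta> y] .
  show "a \<in> carrier (\<M> (\<theta> y)) \<Longrightarrow> germ_comp V \<theta> y a \<in> carrier (\<M> y)"
    "a \<in> carrier (\<M> (\<theta> y)) \<Longrightarrow> b \<in> carrier (\<M> (\<theta> y)) \<Longrightarrow>
      germ_comp V \<theta> y (a \<oplus>\<^bsub>\<M> (\<theta> y)\<^esub> b) = germ_comp V \<theta> y a \<oplus>\<^bsub>\<M> y\<^esub> germ_comp V \<theta> y b"
    "a \<in> carrier (\<M> (\<theta> y)) \<Longrightarrow> b \<in> carrier (\<M> (\<theta> y)) \<Longrightarrow>
      germ_comp V \<theta> y (a \<otimes>\<^bsub>\<M> (\<theta> y)\<^esub> b) = germ_comp V \<theta> y a \<otimes>\<^bsub>\<M> y\<^esub> germ_comp V \<theta> y b"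
    "germ_comp V \<theta> y \<zero>\<^bsub>\<M> (\<theta> y)\<^esub> = \<zero>\<^bsub>\<M> y\<^esub>"
    "a \<in> carrier (\<M> (\<theta> y)) \<Longrightarrow>
      germ_comp V \<theta> y (\<ominus>\<^bsub>\<M> (\<theta> y)\<^esub> a) = \<ominus>\<^bsub>\<M> y\<^esub> germ_comp V \<theta> y a"
    by simp_all
  show "germ_comp V \<theta> y (finsum (\<M> (\<theta> y)) m F) = finsum (\<M> y) (\<lambda>i. germ_comp V \<theta> y (m i)) F"
    if "\<And>i. i \<in> F \<Longrightarrow> m i \<in> carrier (\<M> (\<theta> y))"
    using that by (subst hom_finsum) (auto simp: o_def)
qed

lemmas trans_germ_hom = germ_comp_hom[OF biholomorphic_left_translation[OF inv_closed],
  folded trans_germ_def]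
lemmas trans_germ_in = trans_germ_hom(1)
  and trans_germ_add = trans_germ_hom(2)
  and trans_germ_mult = trans_germ_hom(3)
  and trans_germ_zero = trans_germ_hom(4)
  and trans_germ_finsum = trans_germ_hom(6)

lemma family_apply_in: "s \<in> germ_families \<Longrightarrow> y \<in> carrier V \<Longrightarrow> s y \<in> carrier (\<M> y)"
  by (rule PiE_mem)

lemma mero_sectionsD:
  "m \<in> mero_sections V \<Longrightarrow> m \<in> germ_families"
  "m \<in> mero_sections V \<Longrightarrow> y \<in> carrier V \<Longrightarrow> m y \<in> carrier (\<M> y)"
  unfolding mero_sections_def by (simp_all only: mem_Collect_eq family_apply_in)

abbreviation family_add (infixl "\<uplus>" 65)
  where "s \<uplus> t \<equiv> s \<oplus>\<^bsub>mero_ring V\<^esub> t"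

lemma family_eqI:
  assumes "s \<in> germ_families" "t \<in> germ_families" "\<And>y. y \<in> carrier V \<Longrightarrow> s y = t y"
  shows "s = t"
  by (rule PiE_ext[OF assms])

lemma section_localE:
  assumes "m \<in> mero_sections V" "x \<in> carrier V"
  obtains W f where "openin (top_of V) W" "x \<in> W" "\<And>y. y \<in> W \<Longrightarrow> m y = germ V y f"
proof -
  have "\<exists>W f. openin (top_of V) W \<and> x \<in> W \<and> (\<forall>y\<in>W. m y = germ V y f)"
    using assms by (simp add: mero_sections_def)
  then show ?thesis by (elim exE conjE) (rule that, auto)
qed

lemma mero_sectionsI:
  assumes "\<And>y. y \<in> carrier V \<Longrightarrow> m y \<in> carrier (\<M> y)"
    and "\<And>x. x \<in> carrier V \<Longrightarrow> \<exists>W f. openin (top_of V) W \<and> x \<in> W \<and> (\<forall>y\<in>W. m y = germ V y f)"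
  shows "(\<lambda>y\<in>carrier V. m y) \<in> mero_sections V"
  unfolding mero_sections_def
proof (intro CollectI conjI ballI)
  show "(\<lambda>y\<in>carrier V. m y) \<in> germ_families" using assms(1) by auto
  fix x assume "x \<in> carrier V"
  then obtain W f where "openin (top_of V) W" "x \<in> W" "\<forall>y\<in>W. m y = germ V y f"
    using assms(2) by blast
  moreover from this have "W \<subseteq> carrier V" using openin_subset_carrier by blast
  ultimately show "\<exists>W f. openin (top_of V) W \<and> x \<in> W \<and>
      (\<forall>y\<in>W. restrict m (carrier V) y = germ V y f)"
    by (intro exI[of _ W] exI[of _ f]) auto
qed

lemma fun_section_in: 
  assumes "hol_on V f (carrier V)"
  shows "fun_section V f \<in> mero_sections V"
  unfolding fun_section_def
proof (rule mero_sectionsI)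
  show "germ V y f \<in> carrier (\<M> y)" if "y \<in> carrier V" for y
    using that assms by (intro mero_germsI hol_at_imp_mero_at) (auto simp: hol_at_def)
qed (use openin_carrier in blast)

lemma section_binop:
  assumes m: "m \<in> mero_sections V" "m' \<in> mero_sections V"
    and closed: "\<And>y a b. y \<in> carrier V \<Longrightarrow> a \<in> carrier (\<M> y) \<Longrightarrow> b \<in> carrier (\<M> y) \<Longrightarrow>
      h y a b \<in> carrier (\<M> y)"
    and germ: "\<And>y f g. y \<in> carrier V \<Longrightarrow> h y (germ V y f) (germ V y g) = germ V y (k f g)"
  shows "(\<lambda>y\<in>carrier V. h y (m y) (m' y)) \<in> mero_sections V"
proof (rule mero_sectionsI)
  show "h y (m y) (m' y) \<in> carrier (\<M> y)" if "y \<in> carrier V" for y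
    by (rule closed[OF that mero_sectionsD(2)[OF m(1) that] mero_sectionsD(2)[OF m(2) that]])
  fix x assume x: "x \<in> carrier V"
  obtain W f where 1: "openin (top_of V) W" "x \<in> W" "\<And>y. y \<in> W \<Longrightarrow> m y = germ V y f"
    by (rule section_localE[OF m(1) x]) (rule that)
  obtain W' g where 2: "openin (top_of V) W'" "x \<in> W'" "\<And>y. y \<in> W' \<Longrightarrow> m' y = germ V y g"
    by (rule section_localE[OF m(2) x]) (rule that)
  have "y \<in> carrier V" if "y \<in> W" for y
    using 1(1) openin_subset_carrier that by blast
  then show "\<exists>W f. openin (top_of V) W \<and> x \<in> W \<and> (\<forall>y\<in>W. h y (m y) (m' y) = germ V y f)"
    using 1 2 germ by (intro exI[of _ "W \<inter> W'"] exI[of _ "k f g"]) auto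
qed

lemma section_add_in:
  assumes "m \<in> mero_sections V" "m' \<in> mero_sections V"
  shows "m \<uplus> m' \<in> mero_sections V"
proof -
  have "(\<lambda>y\<in>carrier V. m y \<oplus>\<^bsub>\<M> y\<^esub> m' y) \<in> mero_sections V"
    by (rule section_binop[OF assms, where h = "\<lambda>y a b. a \<oplus>\<^bsub>\<M> y\<^esub> b"
          and k = "\<lambda>f g y. f y + g y"])
      (simp_all add: germ_add mero_add_in)
  then show ?thesis by (simp add: mero_ring_def)
qed

lemma section_mult_in:
  assumes "m \<in> mero_sections V" "m' \<in> mero_sections V"
  shows "m \<otimes>\<^bsub>mero_ring V\<^esub> m' \<in> mero_sections V"
proof -
  have "(\<lambda>y\<in>carrier V. m y \<otimes>\<^bsub>\<M> y\<^esub> m' y) \<in> mero_sections V"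
    by (rule section_binop[OF assms, where h = "\<lambda>y a b. a \<otimes>\<^bsub>\<M> y\<^esub> b"
          and k = "\<lambda>f g y. f y * g y"])
      (simp_all add: germ_mult mero_mult_in)
  then show ?thesis by (simp add: mero_ring_def)
qed

lemma section_comp_in:
  assumes m: "m \<in> mero_sections V" and \<theta>: "biholomorphic \<theta>"
  shows "(\<lambda>y\<in>carrier V. germ_comp V \<theta> y (m (\<theta> y))) \<in> mero_sections V"
proof (rule mero_sectionsI)
  show "germ_comp V \<theta> y (m (\<theta> y)) \<in> carrier (\<M> y)" if "y \<in> carrier V" for y
    by (rule germ_comp_in[OF \<theta> that mero_sectionsD(2)[OF m biholomorphic_closed[OF \<theta> that]]])
  fix x assume x: "x \<in> carrier V"
  obtain W f where W: "openin (top_of V) W" "\<theta> x \<in> W" "\<And>y. y \<in> W \<Longrightarrow> m y = germ V y f"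
    by (rule section_localE[OF m biholomorphic_closed[OF \<theta> x]]) (rule that)
  have "continuous_map (top_of V) (top_of V) \<theta>"
    using \<theta> by (simp add: biholomorphic_def holomorphic_map_def)
  then have "openin (top_of V) {y \<in> carrier V. \<theta> y \<in> W}"
    using openin_continuous_map_preimage[OF _ W(1)] topspace_V by metis
  then show "\<exists>W f. openin (top_of V) W \<and> x \<in> W \<and> (\<forall>y\<in>W. germ_comp V \<theta> y (m (\<theta> y)) = germ V y f)"
    using W x germ_comp_germ[OF \<theta>]
    by (intro exI[of _ "{y \<in> carrier V. \<theta> y \<in> W}"] exI[of _ "\<lambda>y. f (\<theta> y)"]) auto
qed

lemma trans_section_in:
  assumes "m \<in> mero_sections V" "\<xi> \<in> carrier V"
  shows "trans_section V \<xi> m \<in> mero_sections V"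
  using section_comp_in[OF assms(1) biholomorphic_left_translation[OF inv_closed[OF assms(2)]]]
  by (simp add: trans_section_def trans_germ_def)

lemma section_zero_in: "\<zero>\<^bsub>mero_ring V\<^esub> \<in> mero_sections V"
  using fun_section_in[OF hol_on_const[OF openin_carrier, of 0]]
  by (simp add: mero_ring_def fun_section_def germ_zero cong: restrict_cong)

lemma section_zero_apply: "y \<in> carrier V \<Longrightarrow> \<zero>\<^bsub>mero_ring V\<^esub> y = \<zero>\<^bsub>\<M> y\<^esub>"
  by (simp add: mero_ring_def)

lemma family_add_apply: "y \<in> carrier V \<Longrightarrow> (s \<uplus> t) y = s y \<oplus>\<^bsub>\<M> y\<^esub> t y"
  by (simp add: mero_ring_def)

lemma family_add_in:
  "s \<in> germ_families \<Longrightarrow> t \<in> germ_families \<Longrightarrow> s \<uplus> t \<in> germ_families"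
  by (auto simp: mero_ring_def intro!: mero_add_in)

lemma carrier_mero_ring [simp]: "carrier (mero_ring V) = mero_sections V"
  by (simp add: mero_ring_def)

lemma abelian_monoid_mero_ring: "abelian_monoid (mero_ring V)"
proof (rule abelian_monoidI)
  show "x \<uplus> y \<uplus> z = x \<uplus> (y \<uplus> z)"
    "\<zero>\<^bsub>mero_ring V\<^esub> \<uplus> x = x"
    if "x \<in> carrier (mero_ring V)" "y \<in> carrier (mero_ring V)" "z \<in> carrier (mero_ring V)"
    for x y z :: "'v \<Rightarrow> 'v germ"
    by (rule family_eqI;
        use that in \<open>simp add: family_add_apply section_zero_apply mero_sectionsD
          family_add_in section_zero_in mero_zero_add mero_add_assoc mero_add_in\<close>)+
next
  fix x y assume xy: "x \<in> carrier (mero_ring V)" "y \<in> carrier (mero_ring V)"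
  show "x \<uplus> y = y \<uplus> x"
  proof (rule family_eqI)
    fix z assume z: "z \<in> carrier V"
    show "(x \<uplus> y) z = (y \<uplus> x) z"
      unfolding family_add_apply[OF z]
      by (rule mero_add_comm) (use xy z in \<open>simp_all add: mero_sectionsD\<close>)
  qed (use xy in \<open>simp_all add: mero_sectionsD family_add_in\<close>)
qed (auto simp: section_add_in section_zero_in)

lemma mero_ring_finsum_apply:
  assumes "\<And>i. i \<in> F \<Longrightarrow> m i \<in> mero_sections V" and y: "y \<in> carrier V"
  shows "finsum (mero_ring V) m F y = finsum (\<M> y) (\<lambda>i. m i y) F"
proof -
  interpret R: abelian_monoid "mero_ring V" by (rule abelian_monoid_mero_ring)
  interpret M: cring "\<M> y" using cring_mero_germs[OF y] .
  show ?thesis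
  proof (cases "finite F")
    case True
    then show ?thesis using assms(1)
    proof (induction F rule: finite_induct)
      case empty
      then show ?case by (simp add: section_zero_apply y)
    next
      case (insert i F)
      have "finsum (mero_ring V) m (insert i F) = m i \<uplus> finsum (mero_ring V) m F"
        using insert by (intro R.finsum_insert) auto
      then show ?case
        using insert mero_sectionsD(2) y
        by (simp add: family_add_apply M.finsum_insert Pi_def)
    qed
  qed (simp add: R.finsum_infinite M.finsum_infinite section_zero_apply y)
qed

lemma mero_ring_finsum_in:
  "(\<And>i. i \<in> F \<Longrightarrow> m i \<in> mero_sections V) \<Longrightarrow> finsum (mero_ring V) m F \<in> mero_sections V"
  using abelian_monoid.finsum_closed[OF abelian_monoid_mero_ring, of m F] by auto

lemma skewD:
  assumes "a \<in> carrier (skew_ring V)"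
  shows "a \<in> carrier V \<rightarrow>\<^sub>E mero_sections V" "finite (skew_supp V a)"
    and "\<xi> \<in> carrier V \<Longrightarrow> a \<xi> \<in> mero_sections V"
    and "\<xi> \<in> carrier V \<Longrightarrow> y \<in> carrier V \<Longrightarrow> a \<xi> y \<in> carrier (\<M> y)"
  using assms mero_sectionsD by (auto simp: skew_ring_def)

lemma skew_add_apply:
  "\<zeta> \<in> carrier V \<Longrightarrow> (a \<oplus>\<^bsub>skew_ring V\<^esub> b) \<zeta> = a \<zeta> \<uplus> b \<zeta>"
  by (simp add: skew_ring_def)

lemma skew_zero_apply: "\<zeta> \<in> carrier V \<Longrightarrow> \<zero>\<^bsub>skew_ring V\<^esub> \<zeta> = \<zero>\<^bsub>mero_ring V\<^esub>"
  by (simp add: skew_ring_def)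

lemma skewI:
  assumes "a \<in> carrier V \<rightarrow>\<^sub>E mero_sections V" "finite T"
    and "\<And>\<xi>. \<xi> \<in> carrier V \<Longrightarrow> \<xi> \<notin> T \<Longrightarrow> a \<xi> = \<zero>\<^bsub>mero_ring V\<^esub>"
  shows "a \<in> carrier (skew_ring V)"
proof -
  have "skew_supp V a \<subseteq> T" using assms(3) by (auto simp: skew_supp_def)
  then show ?thesis using assms(1,2) by (auto simp: skew_ring_def intro: finite_subset)
qed

lemma skew_zero_outside_supp:
  "\<xi> \<in> carrier V \<Longrightarrow> \<xi> \<notin> skew_supp V a \<Longrightarrow> a \<xi> = \<zero>\<^bsub>mero_ring V\<^esub>"
  by (simp add: skew_supp_def)

lemma skew_supp_subset: "skew_supp V a \<subseteq> carrier V"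
  by (auto simp: skew_supp_def)

lemma skew_supp_in: "\<xi> \<in> skew_supp V a \<Longrightarrow> \<xi> \<in> carrier V"
  by (simp add: skew_supp_def)

lemma skew_add_in:
  assumes "a \<in> carrier (skew_ring V)" "b \<in> carrier (skew_ring V)"
  shows "a \<oplus>\<^bsub>skew_ring V\<^esub> b \<in> carrier (skew_ring V)"
proof (rule skewI)
  interpret R: abelian_monoid "mero_ring V" by (rule abelian_monoid_mero_ring)
  show "a \<oplus>\<^bsub>skew_ring V\<^esub> b \<in> carrier V \<rightarrow>\<^sub>E mero_sections V"
    using skewD(3)[OF assms(1)] skewD(3)[OF assms(2)]
    by (auto simp: skew_ring_def intro!: section_add_in)
  show "finite (skew_supp V a \<union> skew_supp V b)" using skewD(2) assms by blast
  show "(a \<oplus>\<^bsub>skew_ring V\<^esub> b) \<xi> = \<zero>\<^bsub>mero_ring V\<^esub>"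
    if "\<xi> \<in> carrier V" "\<xi> \<notin> skew_supp V a \<union> skew_supp V b" for \<xi>
    using that by (simp add: skew_add_apply skew_zero_outside_supp section_zero_in)
qed

lemma abelian_monoid_skew_ring: "abelian_monoid (skew_ring V)"
proof (rule abelian_monoidI)
  interpret R: abelian_monoid "mero_ring V" by (rule abelian_monoid_mero_ring)
  show zero: "\<zero>\<^bsub>skew_ring V\<^esub> \<in> carrier (skew_ring V)"
    by (rule skewI[of _ "{}"]) (auto simp: skew_ring_def section_zero_in)
  show "x \<oplus>\<^bsub>skew_ring V\<^esub> y \<oplus>\<^bsub>skew_ring V\<^esub> z = x \<oplus>\<^bsub>skew_ring V\<^esub> (y \<oplus>\<^bsub>skew_ring V\<^esub> z)"
    "\<zero>\<^bsub>skew_ring V\<^esub> \<oplus>\<^bsub>skew_ring V\<^esub> x = x"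
    "x \<oplus>\<^bsub>skew_ring V\<^esub> y = y \<oplus>\<^bsub>skew_ring V\<^esub> x"
    if that: "x \<in> carrier (skew_ring V)" "y \<in> carrier (skew_ring V)" "z \<in> carrier (skew_ring V)"
    for x y z
    by (rule PiE_ext[OF skewD(1) skewD(1)];
        use that skewD(3)[OF that(1)] skewD(3)[OF that(2)] skewD(3)[OF that(3)]
        in \<open>simp add: skew_add_in zero skew_add_apply skew_zero_apply R.a_ac\<close>)+
qed (auto simp: skew_add_in)

subsection \<open>The action of the skew-group ring on families of germs\<close>

lemma trans_term_in:
  assumes "a \<in> carrier (skew_ring V)" "s \<in> germ_families" "\<xi> \<in> carrier V" "y \<in> carrier V"
  shows "trans_germ V \<xi> y (s (inv \<xi> \<otimes> y)) \<in> carrier (\<M> y)"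
    and "a \<xi> y \<otimes>\<^bsub>\<M> y\<^esub> trans_germ V \<xi> y (s (inv \<xi> \<otimes> y)) \<in> carrier (\<M> y)"
proof -
  interpret M: cring "\<M> y" using cring_mero_germs[OF assms(4)] .
  show *: "trans_germ V \<xi> y (s (inv \<xi> \<otimes> y)) \<in> carrier (\<M> y)"
    using assms by (intro trans_germ_in family_apply_in) auto
  show "a \<xi> y \<otimes>\<^bsub>\<M> y\<^esub> trans_germ V \<xi> y (s (inv \<xi> \<otimes> y)) \<in> carrier (\<M> y)"
    using * skewD(4)[OF assms(1,3,4)] by simp
qed

lemma skew_apply_superset:
  assumes a: "a \<in> carrier (skew_ring V)" and s: "s \<in> germ_families" and y: "y \<in> carrier V"
    and T: "finite T" "skew_supp V a \<subseteq> T" "T \<subseteq> carrier V"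
  shows "skew_apply V a s y =
    finsum (\<M> y) (\<lambda>\<xi>. a \<xi> y \<otimes>\<^bsub>\<M> y\<^esub> trans_germ V \<xi> y (s (inv \<xi> \<otimes> y))) T"
proof -
  interpret M: cring "\<M> y" using cring_mero_germs[OF y] .
  have "finsum (\<M> y) (\<lambda>\<xi>. a \<xi> y \<otimes>\<^bsub>\<M> y\<^esub> trans_germ V \<xi> y (s (inv \<xi> \<otimes> y))) (skew_supp V a) =
    finsum (\<M> y) (\<lambda>\<xi>. a \<xi> y \<otimes>\<^bsub>\<M> y\<^esub> trans_germ V \<xi> y (s (inv \<xi> \<otimes> y))) T"
  proof (rule M.add.finprod_mono_neutral_cong_left[OF T(1,2)])
    fix \<xi> assume "\<xi> \<in> T - skew_supp V a"
    then show "a \<xi> y \<otimes>\<^bsub>\<M> y\<^esub> trans_germ V \<xi> y (s (inv \<xi> \<otimes> y)) = \<zero>\<^bsub>\<M> y\<^esub>"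
      using T(3) y trans_term_in(1)[OF a s _ y, of \<xi>]
      by (auto simp: skew_zero_outside_supp section_zero_apply)
  qed (use trans_term_in(2)[OF a s _ y] T(3) in auto)
  then show ?thesis by (simp add: skew_apply_def y)
qed

lemma skew_apply_in:
  assumes "a \<in> carrier (skew_ring V)" "s \<in> germ_families"
  shows "skew_apply V a s \<in> germ_families"
proof -
  have "finsum (\<M> y) (\<lambda>\<xi>. a \<xi> y \<otimes>\<^bsub>\<M> y\<^esub> trans_germ V \<xi> y (s (inv \<xi> \<otimes> y))) (skew_supp V a)
    \<in> carrier (\<M> y)" if y: "y \<in> carrier V" for y
  proof -
    interpret M: cring "\<M> y" using cring_mero_germs[OF y] .
    show ?thesis
      by (rule M.finsum_closed) (use trans_term_in(2)[OF assms _ y] skew_supp_subset in auto)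
  qed
  then show ?thesis by (auto simp: skew_apply_def)
qed

lemma skew_apply_add:
  assumes a: "a \<in> carrier (skew_ring V)" and s: "s \<in> germ_families" and t: "t \<in> germ_families"
  shows "skew_apply V a (s \<uplus> t) =
    skew_apply V a s \<uplus> skew_apply V a t"
proof (rule family_eqI)
  fix y assume y: "y \<in> carrier V"
  interpret M: cring "\<M> y" using cring_mero_germs[OF y] .
  let ?c = "\<lambda>s \<xi>. a \<xi> y \<otimes>\<^bsub>\<M> y\<^esub> trans_germ V \<xi> y (s (inv \<xi> \<otimes> y))"
  let ?T = "skew_supp V a"
  have "?c (s \<uplus> t) \<xi> = ?c s \<xi> \<oplus>\<^bsub>\<M> y\<^esub> ?c t \<xi>" if \<xi>: "\<xi> \<in> carrier V" for \<xi>
  proof -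
    have "trans_germ V \<xi> y ((s \<uplus> t) (inv \<xi> \<otimes> y)) =
        trans_germ V \<xi> y (s (inv \<xi> \<otimes> y)) \<oplus>\<^bsub>\<M> y\<^esub> trans_germ V \<xi> y (t (inv \<xi> \<otimes> y))"
      using \<xi> y s t by (simp add: family_add_apply trans_germ_add family_apply_in)
    then show ?thesis
      using skewD(4)[OF a \<xi> y] trans_term_in(1)[OF a s \<xi> y] trans_term_in(1)[OF a t \<xi> y]
      by (simp add: M.r_distr)
  qed
  then have "finsum (\<M> y) (?c (s \<uplus> t)) ?T = finsum (\<M> y) (\<lambda>\<xi>. ?c s \<xi> \<oplus>\<^bsub>\<M> y\<^esub> ?c t \<xi>) ?T"
    using trans_term_in(2)[OF a s _ y] trans_term_in(2)[OF a t _ y]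
    by (intro M.finsum_cong') (simp_all add: skew_supp_in)
  also have "\<dots> = finsum (\<M> y) (?c s) ?T \<oplus>\<^bsub>\<M> y\<^esub> finsum (\<M> y) (?c t) ?T"
    using trans_term_in(2)[OF a s _ y] trans_term_in(2)[OF a t _ y]
    by (intro M.finsum_addf) (simp_all add: skew_supp_in)
  finally show "skew_apply V a (s \<uplus> t) y =
      (skew_apply V a s \<uplus> skew_apply V a t) y"
    by (simp add: skew_apply_def family_add_apply y)
qed (auto intro!: skew_apply_in family_add_in assms)

lemma skew_mult_apply:
  assumes a: "a \<in> carrier (skew_ring V)" and b: "b \<in> carrier (skew_ring V)"
    and \<zeta>: "\<zeta> \<in> carrier V" and y: "y \<in> carrier V"
  shows "(a \<otimes>\<^bsub>skew_ring V\<^esub> b) \<zeta> y = finsum (\<M> y)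
    (\<lambda>\<xi>. a \<xi> y \<otimes>\<^bsub>\<M> y\<^esub> trans_germ V \<xi> y (b (inv \<xi> \<otimes> \<zeta>) (inv \<xi> \<otimes> y))) (skew_supp V a)"
    and "(a \<otimes>\<^bsub>skew_ring V\<^esub> b) \<zeta> \<in> mero_sections V"
proof -
  have in_sec: "a \<xi> \<otimes>\<^bsub>mero_ring V\<^esub> trans_section V \<xi> (b (inv \<xi> \<otimes> \<zeta>)) \<in> mero_sections V"
    if "\<xi> \<in> skew_supp V a" for \<xi>
  proof -
    have "\<xi> \<in> carrier V" using that skew_supp_subset by blast
    then show ?thesis
      using \<zeta> skewD(3)[OF a] skewD(3)[OF b] by (intro section_mult_in trans_section_in) simp_all
  qed
  have eq: "(a \<otimes>\<^bsub>skew_ring V\<^esub> b) \<zeta> = finsum (mero_ring V)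
      (\<lambda>\<xi>. a \<xi> \<otimes>\<^bsub>mero_ring V\<^esub> trans_section V \<xi> (b (inv \<xi> \<otimes> \<zeta>))) (skew_supp V a)"
    using \<zeta> by (simp add: skew_ring_def)
  show "(a \<otimes>\<^bsub>skew_ring V\<^esub> b) \<zeta> \<in> mero_sections V"
    unfolding eq using in_sec by (rule mero_ring_finsum_in)
  show "(a \<otimes>\<^bsub>skew_ring V\<^esub> b) \<zeta> y = finsum (\<M> y)
    (\<lambda>\<xi>. a \<xi> y \<otimes>\<^bsub>\<M> y\<^esub> trans_germ V \<xi> y (b (inv \<xi> \<otimes> \<zeta>) (inv \<xi> \<otimes> y))) (skew_supp V a)"
    unfolding eq by (subst mero_ring_finsum_apply[OF in_sec y])
      (simp_all add: y mero_ring_def trans_section_def)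
qed

text \<open>
  Substituting \<open>\<zeta> = \<xi> \<otimes> \<tau>\<close> turns the convolution that defines the product into an iterated sum over
  the two supports.
\<close>

lemma skew_apply_mult:
  assumes a: "a \<in> carrier (skew_ring V)" and b: "b \<in> carrier (skew_ring V)"
    and s: "s \<in> germ_families" and ab: "a \<otimes>\<^bsub>skew_ring V\<^esub> b \<in> carrier (skew_ring V)"
  shows "skew_apply V (a \<otimes>\<^bsub>skew_ring V\<^esub> b) s = skew_apply V a (skew_apply V b s)"
proof (rule family_eqI)
  fix y assume y: "y \<in> carrier V"
  interpret M: cring "\<M> y" using cring_mero_germs[OF y] .
  define A where "A = skew_supp V a"
  define B where "B = skew_supp V b"
  define T where "T = (\<lambda>(\<xi>, \<zeta>). \<xi> \<otimes> \<zeta>) ` (A \<times> B)"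
  have fin: "finite A" "finite B" "finite T"
    using skewD(2)[OF a] skewD(2)[OF b] by (auto simp: A_def B_def T_def)
  have A: "\<xi> \<in> carrier V" if "\<xi> \<in> A" for \<xi> using that by (simp add: A_def skew_supp_in)
  have B: "\<xi> \<in> carrier V" if "\<xi> \<in> B" for \<xi> using that by (simp add: B_def skew_supp_in)
  have T: "\<xi> \<in> carrier V" if "\<xi> \<in> T" for \<xi> using that A B by (auto simp: T_def)
  \<comment> \<open>the summand of the double sum at \<open>\<xi>\<close> and the product point \<open>\<zeta>\<close>\<close>
  define c where "c \<xi> \<zeta> = a \<xi> y \<otimes>\<^bsub>\<M> y\<^esub> trans_germ V \<xi> y (b (inv \<xi> \<otimes> \<zeta>) (inv \<xi> \<otimes> y))" for \<xi> \<zeta>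
  define u where "u \<zeta> = trans_germ V \<zeta> y (s (inv \<zeta> \<otimes> y))" for \<zeta>
  have c_in: "c \<xi> \<zeta> \<in> carrier (\<M> y)" if "\<xi> \<in> carrier V" "\<zeta> \<in> carrier V" for \<xi> \<zeta>
    unfolding c_def using that y skewD(4)[OF a] skewD(4)[OF b] by (simp add: trans_germ_in)
  have u_in: "u \<zeta> \<in> carrier (\<M> y)" if "\<zeta> \<in> carrier V" for \<zeta>
    unfolding u_def using trans_term_in(1)[OF a s that y] .
  have zero: "c \<xi> \<zeta> = \<zero>\<^bsub>\<M> y\<^esub>" if "\<xi> \<in> carrier V" "\<zeta> \<in> carrier V" "inv \<xi> \<otimes> \<zeta> \<notin> B" for \<xi> \<zeta>
  proof -
    have "b (inv \<xi> \<otimes> \<zeta>) (inv \<xi> \<otimes> y) = \<zero>\<^bsub>\<M> (inv \<xi> \<otimes> y)\<^esub>"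
      using that y by (simp add: B_def skew_zero_outside_supp section_zero_apply)
    then show ?thesis
      using that(1) y skewD(4)[OF a] by (simp add: c_def trans_germ_zero)
  qed
  have supp: "skew_supp V (a \<otimes>\<^bsub>skew_ring V\<^esub> b) \<subseteq> T"
  proof
    fix \<zeta> assume \<zeta>: "\<zeta> \<in> skew_supp V (a \<otimes>\<^bsub>skew_ring V\<^esub> b)"
    show "\<zeta> \<in> T"
    proof (rule ccontr)
      assume nT: "\<zeta> \<notin> T"
      have \<zeta>V: "\<zeta> \<in> carrier V" using \<zeta> by (rule skew_supp_in)
      have z: "b (inv \<xi> \<otimes> \<zeta>) = \<zero>\<^bsub>mero_ring V\<^esub>" if \<xi>: "\<xi> \<in> A" for \<xi>
      proof (rule skew_zero_outside_supp)
        show "inv \<xi> \<otimes> \<zeta> \<notin> skew_supp V b"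
        proof
          assume "inv \<xi> \<otimes> \<zeta> \<in> skew_supp V b"
          then have "\<xi> \<otimes> (inv \<xi> \<otimes> \<zeta>) \<in> T"
            using \<xi> by (auto simp: T_def B_def)
          then show False using nT A[OF \<xi>] \<zeta>V by (simp add: m_assoc[symmetric])
        qed
      qed (use A[OF \<xi>] \<zeta>V in simp)
      have "(a \<otimes>\<^bsub>skew_ring V\<^esub> b) \<zeta> = \<zero>\<^bsub>mero_ring V\<^esub>"
      proof (rule family_eqI)
        show "(a \<otimes>\<^bsub>skew_ring V\<^esub> b) \<zeta> \<in> germ_families"
          by (rule mero_sectionsD(1)[OF skewD(3)[OF ab \<zeta>V]])
        show "\<zero>\<^bsub>mero_ring V\<^esub> \<in> germ_families" by (rule mero_sectionsD(1)[OF section_zero_in])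
        fix x assume x: "x \<in> carrier V"
        interpret Mx: cring "\<M> x" using cring_mero_germs[OF x] .
        have "(a \<otimes>\<^bsub>skew_ring V\<^esub> b) \<zeta> x = finsum (\<M> x) (\<lambda>\<xi>. \<zero>\<^bsub>\<M> x\<^esub>) A"
          unfolding skew_mult_apply(1)[OF a b \<zeta>V x] A_def[symmetric]
          using x A skewD(4)[OF a]
          by (intro Mx.finsum_cong') (simp_all add: z section_zero_apply trans_germ_zero)
        then show "(a \<otimes>\<^bsub>skew_ring V\<^esub> b) \<zeta> x = \<zero>\<^bsub>mero_ring V\<^esub> x"
          using x by (simp add: section_zero_apply)
      qed
      then show False using \<zeta> by (simp add: skew_supp_def)
    qed
  qed
  have "skew_apply V (a \<otimes>\<^bsub>skew_ring V\<^esub> b) s y =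
      finsum (\<M> y) (\<lambda>\<zeta>. finsum (\<M> y) (\<lambda>\<xi>. c \<xi> \<zeta>) A \<otimes>\<^bsub>\<M> y\<^esub> u \<zeta>) T"
  proof -
    have "skew_apply V (a \<otimes>\<^bsub>skew_ring V\<^esub> b) s y =
      finsum (\<M> y) (\<lambda>\<zeta>. (a \<otimes>\<^bsub>skew_ring V\<^esub> b) \<zeta> y \<otimes>\<^bsub>\<M> y\<^esub> u \<zeta>) T"
      unfolding u_def by (rule skew_apply_superset[OF ab s y fin(3) supp]) (use T in blast)
    also have "\<dots> = finsum (\<M> y) (\<lambda>\<zeta>. finsum (\<M> y) (\<lambda>\<xi>. c \<xi> \<zeta>) A \<otimes>\<^bsub>\<M> y\<^esub> u \<zeta>) T"
      using c_in u_in A T y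
      by (intro M.finsum_cong') (simp_all add: skew_mult_apply(1)[OF a b] c_def A_def)
    finally show ?thesis .
  qed
  also have "\<dots> = finsum (\<M> y) (\<lambda>\<zeta>. finsum (\<M> y) (\<lambda>\<xi>. c \<xi> \<zeta> \<otimes>\<^bsub>\<M> y\<^esub> u \<zeta>) A) T"
    using c_in u_in A T fin
    by (intro M.finsum_cong') (simp_all add: M.finsum_ldistr Pi_def)
  also have "\<dots> = finsum (\<M> y) (\<lambda>\<xi>. finsum (\<M> y) (\<lambda>\<zeta>. c \<xi> \<zeta> \<otimes>\<^bsub>\<M> y\<^esub> u \<zeta>) T) A"
    by (rule M.finsum_swap) (use fin c_in u_in A T in simp_all)
  also have "\<dots> = finsum (\<M> y) (\<lambda>\<xi>. a \<xi> y \<otimes>\<^bsub>\<M> y\<^esub> trans_germ V \<xi> y (skew_apply V b s (inv \<xi> \<otimes> y))) A"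
  proof (rule M.finsum_cong')
    fix \<xi> assume \<xi>A: "\<xi> \<in> A"
    then have \<xi>: "\<xi> \<in> carrier V" by (rule A)
    have y': "inv \<xi> \<otimes> y \<in> carrier V" using \<xi> y by simp
    let ?d = "\<lambda>\<tau>. b \<tau> (inv \<xi> \<otimes> y) \<otimes>\<^bsub>\<M> (inv \<xi> \<otimes> y)\<^esub> trans_germ V \<tau> (inv \<xi> \<otimes> y) (s (inv \<tau> \<otimes> (inv \<xi> \<otimes> y)))"
    have d_in: "?d \<tau> \<in> carrier (\<M> (inv \<xi> \<otimes> y))" if "\<tau> \<in> carrier V" for \<tau>
      by (rule trans_term_in(2)[OF b s that y'])
    have sub: "(\<lambda>\<tau>. \<xi> \<otimes> \<tau>) ` B \<subseteq> T" using \<xi>A by (auto simp: T_def)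
    have "finsum (\<M> y) (\<lambda>\<zeta>. c \<xi> \<zeta> \<otimes>\<^bsub>\<M> y\<^esub> u \<zeta>) T =
        finsum (\<M> y) (\<lambda>\<zeta>. c \<xi> \<zeta> \<otimes>\<^bsub>\<M> y\<^esub> u \<zeta>) ((\<lambda>\<tau>. \<xi> \<otimes> \<tau>) ` B)"
    proof (rule M.add.finprod_mono_neutral_cong_left[OF fin(3) sub, symmetric])
      fix \<zeta> assume \<zeta>: "\<zeta> \<in> T - (\<lambda>\<tau>. \<xi> \<otimes> \<tau>) ` B"
      then have \<zeta>V: "\<zeta> \<in> carrier V" using T by blast
      have "inv \<xi> \<otimes> \<zeta> \<notin> B"
      proof
        assume "inv \<xi> \<otimes> \<zeta> \<in> B"
        then have "\<xi> \<otimes> (inv \<xi> \<otimes> \<zeta>) \<in> (\<lambda>\<tau>. \<xi> \<otimes> \<tau>) ` B" by blast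
        then show False using \<zeta> \<xi> \<zeta>V by (simp add: m_assoc[symmetric])
      qed
      then show "c \<xi> \<zeta> \<otimes>\<^bsub>\<M> y\<^esub> u \<zeta> = \<zero>\<^bsub>\<M> y\<^esub>"
        using zero \<xi> \<zeta>V u_in by simp
    qed (use c_in u_in \<xi> T in simp_all)
    also have "\<dots> = finsum (\<M> y) (\<lambda>\<tau>. c \<xi> (\<xi> \<otimes> \<tau>) \<otimes>\<^bsub>\<M> y\<^esub> u (\<xi> \<otimes> \<tau>)) B"
      by (rule M.finsum_reindex) (use B \<xi> c_in u_in in \<open>auto simp: inj_on_def\<close>)
    also have "\<dots> = finsum (\<M> y) (\<lambda>\<tau>. a \<xi> y \<otimes>\<^bsub>\<M> y\<^esub> trans_germ V \<xi> y (?d \<tau>)) B"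
    proof (rule M.finsum_cong')
      fix \<tau> assume "\<tau> \<in> B"
      then have \<tau>: "\<tau> \<in> carrier V" by (rule B)
      have s': "s (inv \<tau> \<otimes> (inv \<xi> \<otimes> y)) \<in> carrier (\<M> (inv \<tau> \<otimes> (inv \<xi> \<otimes> y)))"
        using s \<tau> y' by (simp add: family_apply_in)
      have u: "trans_germ V \<xi> y (trans_germ V \<tau> (inv \<xi> \<otimes> y) (s (inv \<tau> \<otimes> (inv \<xi> \<otimes> y)))) = u (\<xi> \<otimes> \<tau>)"
        using \<xi> \<tau> y by (simp add: trans_germ_trans_germ[OF \<xi> \<tau> y s'] u_def inv_mult_group m_assoc)
      have "trans_germ V \<xi> y (?d \<tau>) =
          trans_germ V \<xi> y (b \<tau> (inv \<xi> \<otimes> y)) \<otimes>\<^bsub>\<M> y\<^esub> u (\<xi> \<otimes> \<tau>)"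
        using \<xi> \<tau> y y' s' by (simp add: trans_germ_mult skewD(4)[OF b] trans_germ_in u)
      then show "c \<xi> (\<xi> \<otimes> \<tau>) \<otimes>\<^bsub>\<M> y\<^esub> u (\<xi> \<otimes> \<tau>) = a \<xi> y \<otimes>\<^bsub>\<M> y\<^esub> trans_germ V \<xi> y (?d \<tau>)"
        using \<xi> \<tau> y y' u_in[of "\<xi> \<otimes> \<tau>"] skewD(4)[OF a \<xi> y] trans_germ_in[OF \<xi> y skewD(4)[OF b \<tau> y']]
        by (simp add: c_def m_assoc[symmetric] M.m_assoc)
    qed (use B \<xi> y d_in skewD(4)[OF a] in \<open>simp_all add: trans_germ_in\<close>)
    also have "\<dots> = a \<xi> y \<otimes>\<^bsub>\<M> y\<^esub> finsum (\<M> y) (\<lambda>\<tau>. trans_germ V \<xi> y (?d \<tau>)) B"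
      by (rule M.finsum_rdistr[symmetric])
        (use fin B \<xi> y d_in skewD(4)[OF a] in \<open>simp_all add: trans_germ_in\<close>)
    also have "finsum (\<M> y) (\<lambda>\<tau>. trans_germ V \<xi> y (?d \<tau>)) B =
        trans_germ V \<xi> y (skew_apply V b s (inv \<xi> \<otimes> y))"
      using B d_in y' by (simp add: trans_germ_finsum[OF \<xi> y] skew_apply_def B_def skew_supp_in)
    finally show "finsum (\<M> y) (\<lambda>\<zeta>. c \<xi> \<zeta> \<otimes>\<^bsub>\<M> y\<^esub> u \<zeta>) T =
        a \<xi> y \<otimes>\<^bsub>\<M> y\<^esub> trans_germ V \<xi> y (skew_apply V b s (inv \<xi> \<otimes> y))" .
  qed (use A trans_term_in(2)[OF a skew_apply_in[OF b s] _ y] in simp_all)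
  also have "\<dots> = skew_apply V a (skew_apply V b s) y"
    by (simp add: skew_apply_def[of V a] A_def y)
  finally show "skew_apply V (a \<otimes>\<^bsub>skew_ring V\<^esub> b) s y = skew_apply V a (skew_apply V b s) y" .
qed (intro skew_apply_in ab a b s)+

lemma skew_apply_add_left:
  assumes a: "a \<in> carrier (skew_ring V)" and b: "b \<in> carrier (skew_ring V)" and s: "s \<in> germ_families"
  shows "skew_apply V (a \<oplus>\<^bsub>skew_ring V\<^esub> b) s =
    skew_apply V a s \<uplus> skew_apply V b s"
proof (rule family_eqI)
  note ab = skew_add_in[OF a b]
  fix y assume y: "y \<in> carrier V"
  interpret M: cring "\<M> y" using cring_mero_germs[OF y] .
  define T where "T = skew_supp V (a \<oplus>\<^bsub>skew_ring V\<^esub> b) \<union> skew_supp V a \<union> skew_supp V b"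
  have T: "finite T" "T \<subseteq> carrier V"
    using skewD(2)[OF a] skewD(2)[OF b] skewD(2)[OF ab] skew_supp_subset by (auto simp: T_def)
  have Ta: "skew_supp V a \<subseteq> T" and Tb: "skew_supp V b \<subseteq> T"
    and Tab: "skew_supp V (a \<oplus>\<^bsub>skew_ring V\<^esub> b) \<subseteq> T"
    by (auto simp: T_def)
  let ?u = "\<lambda>\<xi>. trans_germ V \<xi> y (s (inv \<xi> \<otimes> y))"
  have E: "skew_apply V c s y = finsum (\<M> y) (\<lambda>\<xi>. c \<xi> y \<otimes>\<^bsub>\<M> y\<^esub> ?u \<xi>) T"
    if "c \<in> carrier (skew_ring V)" "skew_supp V c \<subseteq> T" for c
    by (rule skew_apply_superset[OF that(1) s y T(1) that(2) T(2)])
  have TV: "\<xi> \<in> carrier V" if "\<xi> \<in> T" for \<xi> using that T(2) by blast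
  have "skew_apply V (a \<oplus>\<^bsub>skew_ring V\<^esub> b) s y =
      finsum (\<M> y) (\<lambda>\<xi>. (a \<xi> y \<otimes>\<^bsub>\<M> y\<^esub> ?u \<xi>) \<oplus>\<^bsub>\<M> y\<^esub> (b \<xi> y \<otimes>\<^bsub>\<M> y\<^esub> ?u \<xi>)) T"
    unfolding E[OF ab Tab]
    using skewD(4)[OF a _ y] skewD(4)[OF b _ y] trans_term_in(1)[OF a s _ y] TV
    by (intro M.finsum_cong') (simp_all add: skew_add_apply family_add_apply y M.l_distr)
  also have "\<dots> = finsum (\<M> y) (\<lambda>\<xi>. a \<xi> y \<otimes>\<^bsub>\<M> y\<^esub> ?u \<xi>) T \<oplus>\<^bsub>\<M> y\<^esub>
      finsum (\<M> y) (\<lambda>\<xi>. b \<xi> y \<otimes>\<^bsub>\<M> y\<^esub> ?u \<xi>) T"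
    using trans_term_in(2)[OF a s _ y] trans_term_in(2)[OF b s _ y] TV
    by (intro M.finsum_addf) simp_all
  finally show "skew_apply V (a \<oplus>\<^bsub>skew_ring V\<^esub> b) s y =
      (skew_apply V a s \<uplus> skew_apply V b s) y"
    using E[OF a Ta] E[OF b Tb] y by (simp add: family_add_apply)
qed (intro skew_apply_in family_add_in skew_add_in a b s)+

lemma skew_monom_in:
  assumes f: "f \<in> mero_sections V"
  shows "skew_monom V f \<xi> \<in> carrier (skew_ring V)"
  by (rule skewI[of _ "{\<xi>}"]) (use f section_zero_in in \<open>auto simp: skew_monom_def\<close>)

lemma skew_apply_monom:
  assumes f: "f \<in> mero_sections V" and \<xi>: "\<xi> \<in> carrier V" and s: "s \<in> germ_families"
    and y: "y \<in> carrier V"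
  shows "skew_apply V (skew_monom V f \<xi>) s y = f y \<otimes>\<^bsub>\<M> y\<^esub> trans_germ V \<xi> y (s (inv \<xi> \<otimes> y))"
proof -
  interpret M: cring "\<M> y" using cring_mero_germs[OF y] .
  have "skew_supp V (skew_monom V f \<xi>) \<subseteq> {\<xi>}"
    by (auto simp: skew_supp_def skew_monom_def)
  then have "skew_apply V (skew_monom V f \<xi>) s y = finsum (\<M> y)
      (\<lambda>\<zeta>. skew_monom V f \<xi> \<zeta> y \<otimes>\<^bsub>\<M> y\<^esub> trans_germ V \<zeta> y (s (inv \<zeta> \<otimes> y))) {\<xi>}"
    using \<xi> by (intro skew_apply_superset skew_monom_in f s y) auto
  also have "\<dots> = f y \<otimes>\<^bsub>\<M> y\<^esub> trans_germ V \<xi> y (s (inv \<xi> \<otimes> y))"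
    using trans_term_in(2)[OF skew_monom_in[OF f] s \<xi> y, of \<xi>] \<xi>
    by (simp add: M.finsum_insert skew_monom_def mero_sectionsD(2)[OF f y])
  finally show ?thesis .
qed

end

section \<open>The finite group acting on germs\<close>

context finite_holomorphic_action
begin

abbreviation e where "e \<equiv> \<one>\<^bsub>V\<^esub>"

lemma group_G: "group G"
  by (rule group_hom.axioms(1)[OF group_hom])

lemma inv_G_closed [simp]: "g \<in> carrier G \<Longrightarrow> inv\<^bsub>G\<^esub> g \<in> carrier G"
  using group.inv_closed[OF group_G] .

lemma one_G_closed [simp]: "\<one>\<^bsub>G\<^esub> \<in> carrier G"
  using monoid.one_closed[OF group.is_monoid[OF group_G]] .

lemma mult_G_closed [simp]: "g \<in> carrier G \<Longrightarrow> h \<in> carrier G \<Longrightarrow> g \<otimes>\<^bsub>G\<^esub> h \<in> carrier G"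
  using monoid.m_closed[OF group.is_monoid[OF group_G]] .

lemma inv_inv_G [simp]: "g \<in> carrier G \<Longrightarrow> inv\<^bsub>G\<^esub> (inv\<^bsub>G\<^esub> g) = g"
  using group.inv_inv[OF group_G] .

lemma card_G_pos: "card (carrier G) > 0"
  using finite_group one_G_closed by (metis card_gt_0_iff empty_iff)

lemma act_closed [simp]: "g \<in> carrier G \<Longrightarrow> x \<in> carrier V \<Longrightarrow> act g x \<in> carrier V"
  by (rule element_image) simp_all

lemma act_mult_G:
  "g \<in> carrier G \<Longrightarrow> h \<in> carrier G \<Longrightarrow> x \<in> carrier V \<Longrightarrow> act (g \<otimes>\<^bsub>G\<^esub> h) x = act g (act h x)"
  using composition_rule .

lemma act_one_G [simp]: "x \<in> carrier V \<Longrightarrow> act \<one>\<^bsub>G\<^esub> x = x"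
  using id_eq_one by (metis restrict_apply')

lemma act_inv_act [simp]: "g \<in> carrier G \<Longrightarrow> x \<in> carrier V \<Longrightarrow> act (inv\<^bsub>G\<^esub> g) (act g x) = x"
  by (rule orbit_sym_aux) simp_all

lemma act_act_inv [simp]: "g \<in> carrier G \<Longrightarrow> x \<in> carrier V \<Longrightarrow> act g (act (inv\<^bsub>G\<^esub> g) x) = x"
  using act_inv_act[of "inv\<^bsub>G\<^esub> g" x] by simp

lemma act_inv_eq_iff:
  "g \<in> carrier G \<Longrightarrow> x \<in> carrier V \<Longrightarrow> y \<in> carrier V \<Longrightarrow> act (inv\<^bsub>G\<^esub> g) x = y \<longleftrightarrow> x = act g y"
  using act_act_inv act_inv_act by metis

lemma act_inv_mult_G:
  assumes "g \<in> carrier G" "h \<in> carrier G" "x \<in> carrier V"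
  shows "act (inv\<^bsub>G\<^esub> (g \<otimes>\<^bsub>G\<^esub> h)) x = act (inv\<^bsub>G\<^esub> h) (act (inv\<^bsub>G\<^esub> g) x)"
  using assms by (simp add: group.inv_mult_group[OF group_G] act_mult_G)

lemma act_mult_V:
  "g \<in> carrier G \<Longrightarrow> x \<in> carrier V \<Longrightarrow> y \<in> carrier V \<Longrightarrow> act g (x \<otimes>\<^bsub>V\<^esub> y) = act g x \<otimes>\<^bsub>V\<^esub> act g y"
  by (rule hom_mult[OF act_hom])

lemma group_hom_act: "g \<in> carrier G \<Longrightarrow> group_hom V V (act g)"
  by (intro group_hom.intro group_hom_axioms.intro is_group act_hom)

lemma act_one_V [simp]: "g \<in> carrier G \<Longrightarrow> act g e = e"
  using group_hom.hom_one[OF group_hom_act] .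

lemma act_inv_V: "g \<in> carrier G \<Longrightarrow> x \<in> carrier V \<Longrightarrow> act g (inv\<^bsub>V\<^esub> x) = inv\<^bsub>V\<^esub> (act g x)"
  using group_hom.hom_inv[OF group_hom_act] .

lemma biholomorphic_act:
  assumes "g \<in> carrier G"
  shows "biholomorphic (act g)"
  unfolding biholomorphic_def
  using act_holomorphic[OF assms] act_holomorphic[OF inv_G_closed[OF assms]] assms
  by (intro conjI exI[of _ "act (inv\<^bsub>G\<^esub> g)"]) auto

lemmas act_germ_hom = germ_comp_hom[OF biholomorphic_act[OF inv_G_closed], folded act_germ_def]
lemmas act_germ_in = act_germ_hom(1)
  and act_germ_add = act_germ_hom(2)
  and act_germ_mult = act_germ_hom(3)
  and act_germ_zero = act_germ_hom(4)
  and act_germ_uminus = act_germ_hom(5)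
  and act_germ_finsum = act_germ_hom(6)
lemmas act_germ_hol = germ_comp_hol[OF biholomorphic_act[OF inv_G_closed], folded act_germ_def]
lemmas act_germ_germ = germ_comp_germ[OF biholomorphic_act[OF inv_G_closed], folded act_germ_def]

lemma act_germ_act_germ:
  assumes "g \<in> carrier G" "h \<in> carrier G" "y \<in> carrier V"
    "a \<in> carrier (\<M> (act (inv\<^bsub>G\<^esub> h) (act (inv\<^bsub>G\<^esub> g) y)))"
  shows "act_germ V G act g y (act_germ V G act h (act (inv\<^bsub>G\<^esub> g) y) a) =
    act_germ V G act (g \<otimes>\<^bsub>G\<^esub> h) y a"
  unfolding act_germ_def
  by (rule germ_comp_comp) (use assms in \<open>simp_all add: biholomorphic_act act_inv_mult_G\<close>)

lemma inv_one_G: "inv\<^bsub>G\<^esub> \<one>\<^bsub>G\<^esub> = \<one>\<^bsub>G\<^esub>"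
  using monoid.inv_one[OF group.is_monoid[OF group_G]] .

lemma act_germ_one:
  assumes "y \<in> carrier V" "a \<in> carrier (\<M> y)"
  shows "act_germ V G act \<one>\<^bsub>G\<^esub> y a = a"
  unfolding act_germ_def inv_one_G
  by (rule germ_comp_id[OF biholomorphic_act assms]) simp_all

text \<open>In the semidirect product this is the identity \<open>g \<phi>\<^sub>\<xi> = \<phi>\<^bsub>g \<cdot> \<xi>\<^esub> g\<close>.\<close>

lemma act_germ_trans_germ:
  assumes g: "g \<in> carrier G" and \<xi>: "\<xi> \<in> carrier V" and y: "y \<in> carrier V"
    and a: "a \<in> carrier (\<M> (inv\<^bsub>V\<^esub> \<xi> \<otimes>\<^bsub>V\<^esub> act (inv\<^bsub>G\<^esub> g) y))"
  shows "act_germ V G act g y (trans_germ V \<xi> (act (inv\<^bsub>G\<^esub> g) y) a) =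
    trans_germ V (act g \<xi>) y (act_germ V G act g (inv\<^bsub>V\<^esub> (act g \<xi>) \<otimes>\<^bsub>V\<^esub> y) a)"
proof -
  have eq: "act (inv\<^bsub>G\<^esub> g) (inv\<^bsub>V\<^esub> (act g \<xi>) \<otimes>\<^bsub>V\<^esub> x) = inv\<^bsub>V\<^esub> \<xi> \<otimes>\<^bsub>V\<^esub> act (inv\<^bsub>G\<^esub> g) x"
    if "x \<in> carrier V" for x
    using that g \<xi> by (simp add: act_mult_V act_inv_V)
  obtain f where f: "a = germ V (inv\<^bsub>V\<^esub> \<xi> \<otimes>\<^bsub>V\<^esub> act (inv\<^bsub>G\<^esub> g) y) f"
    using a by (rule mero_germsE)
  have "act_germ V G act g y (trans_germ V \<xi> (act (inv\<^bsub>G\<^esub> g) y) a) =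
      germ V y (\<lambda>x. f (inv\<^bsub>V\<^esub> \<xi> \<otimes>\<^bsub>V\<^esub> act (inv\<^bsub>G\<^esub> g) x))"
    using g \<xi> y by (simp add: f trans_germ_germ act_germ_germ)
  moreover have "act_germ V G act g (inv\<^bsub>V\<^esub> (act g \<xi>) \<otimes>\<^bsub>V\<^esub> y) a =
      germ V (inv\<^bsub>V\<^esub> (act g \<xi>) \<otimes>\<^bsub>V\<^esub> y) (\<lambda>x. f (act (inv\<^bsub>G\<^esub> g) x))"
    using act_germ_germ[OF g, of "inv\<^bsub>V\<^esub> (act g \<xi>) \<otimes>\<^bsub>V\<^esub> y" f] eq[OF y] g \<xi> y by (simp add: f)
  moreover have "germ V y (\<lambda>x. f (act (inv\<^bsub>G\<^esub> g) (inv\<^bsub>V\<^esub> (act g \<xi>) \<otimes>\<^bsub>V\<^esub> x))) =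
      germ V y (\<lambda>x. f (inv\<^bsub>V\<^esub> \<xi> \<otimes>\<^bsub>V\<^esub> act (inv\<^bsub>G\<^esub> g) x))"
    by (rule germ_eqI[OF y]) (simp add: eq)
  ultimately show ?thesis
    using g \<xi> y by (simp add: trans_germ_germ)
qed

abbreviation J where "J \<equiv> coinv_ideal V G act"

lemma inv_germs_hol: "a \<in> inv_germs V G act H x \<Longrightarrow> a \<in> carrier (\<O> x)"
  by (simp add: inv_germs_def)

lemma hol_in_mero: "a \<in> carrier (\<O> x) \<Longrightarrow> a \<in> carrier (\<M> x)"
  using hol_germs_subset by blast

lemma hol_germs_laws:
  assumes "x \<in> carrier V"
  shows hol_add_in: "a \<in> carrier (\<O> x) \<Longrightarrow> b \<in> carrier (\<O> x) \<Longrightarrow> a \<oplus>\<^bsub>\<M> x\<^esub> b \<in> carrier (\<O> x)"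
    and hol_mult_in: "a \<in> carrier (\<O> x) \<Longrightarrow> b \<in> carrier (\<O> x) \<Longrightarrow> a \<otimes>\<^bsub>\<M> x\<^esub> b \<in> carrier (\<O> x)"
    and hol_zero_in: "\<zero>\<^bsub>\<M> x\<^esub> \<in> carrier (\<O> x)"
    and hol_uminus_in: "a \<in> carrier (\<O> x) \<Longrightarrow> \<ominus>\<^bsub>\<M> x\<^esub> a \<in> carrier (\<O> x)"
  using subringE[OF subring_hol_germs[OF assms]] by auto

lemma ideal_coinv_ideal: "ideal J (\<O> e)"
  unfolding coinv_ideal_def
  by (rule ring.genideal_ideal[OF cring.axioms(1)[OF cring_hol_germs]]) (auto intro: inv_germs_hol)

lemma coinv_ideal_gen:
  "a \<in> inv_germs V G act (carrier G) e \<Longrightarrow> germ_value V e a = 0 \<Longrightarrow> a \<in> J"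
  unfolding coinv_ideal_def genideal_def by blast

lemma coinv_ideal_closed:
  shows coinv_ideal_hol: "a \<in> J \<Longrightarrow> a \<in> carrier (\<O> e)"
    and coinv_ideal_add: "a \<in> J \<Longrightarrow> b \<in> J \<Longrightarrow> a \<oplus>\<^bsub>\<M> e\<^esub> b \<in> J"
    and coinv_ideal_mult: "a \<in> J \<Longrightarrow> b \<in> carrier (\<O> e) \<Longrightarrow> b \<otimes>\<^bsub>\<M> e\<^esub> a \<in> J"
    and coinv_ideal_zero: "\<zero>\<^bsub>\<M> e\<^esub> \<in> J"
proof -
  interpret ideal J "\<O> e" by (rule ideal_coinv_ideal)
  show "a \<in> J \<Longrightarrow> a \<in> carrier (\<O> e)" "a \<in> J \<Longrightarrow> b \<in> J \<Longrightarrow> a \<oplus>\<^bsub>\<M> e\<^esub> b \<in> J"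
    "a \<in> J \<Longrightarrow> b \<in> carrier (\<O> e) \<Longrightarrow> b \<otimes>\<^bsub>\<M> e\<^esub> a \<in> J" "\<zero>\<^bsub>\<M> e\<^esub> \<in> J"
    using a_Hcarr additive_subgroup.a_closed[OF is_additive_subgroup] I_l_closed additive_subgroup.zero_closed[OF is_additive_subgroup] by simp_all
qed

lemma coinv_ideal_induct [consumes 1, case_names gen zero add mult]:
  assumes "a \<in> J"
    and gen: "\<And>p. p \<in> inv_germs V G act (carrier G) e \<Longrightarrow> germ_value V e p = 0 \<Longrightarrow> P p"
    and zero: "P \<zero>\<^bsub>\<M> e\<^esub>"
    and add: "\<And>a b. a \<in> carrier (\<O> e) \<Longrightarrow> b \<in> carrier (\<O> e) \<Longrightarrow> P a \<Longrightarrow> P b \<Longrightarrow>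
      P (a \<oplus>\<^bsub>\<M> e\<^esub> b)"
    and mult: "\<And>a b. a \<in> carrier (\<O> e) \<Longrightarrow> b \<in> carrier (\<O> e) \<Longrightarrow> P a \<Longrightarrow> P (b \<otimes>\<^bsub>\<M> e\<^esub> a)"
  shows "P a"
proof -
  interpret R: cring "\<O> e" by (rule cring_hol_germs) simp
  let ?I = "{a \<in> carrier (\<O> e). P a}"
  have "subgroup ?I (add_monoid (\<O> e))"
  proof (rule group.subgroupI[OF R.a_group])
    show "?I \<noteq> {}" using zero R.zero_closed by auto
    fix a assume a: "a \<in> ?I"
    have "\<ominus>\<^bsub>\<O> e\<^esub> a = (\<ominus>\<^bsub>\<O> e\<^esub> \<one>\<^bsub>\<O> e\<^esub>) \<otimes>\<^bsub>\<O> e\<^esub> a"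
      using a R.l_minus[of "\<one>\<^bsub>\<O> e\<^esub>" a] R.l_one[of a] R.one_closed by simp
    moreover have "P ((\<ominus>\<^bsub>\<O> e\<^esub> \<one>\<^bsub>\<O> e\<^esub>) \<otimes>\<^bsub>\<M> e\<^esub> a)"
      using a R.a_inv_closed[OF R.one_closed] by (intro mult) auto
    ultimately have "\<ominus>\<^bsub>\<O> e\<^esub> a \<in> ?I"
      using a R.a_inv_closed[of a] by simp
    then show "inv\<^bsub>add_monoid (\<O> e)\<^esub> a \<in> ?I"
      by (simp only: a_inv_def)
  next
    fix a b assume "a \<in> ?I" "b \<in> ?I"
    then show "a \<otimes>\<^bsub>add_monoid (\<O> e)\<^esub> b \<in> ?I"
      using add R.a_closed[of a b] by simp
  qed auto
  then have "ideal ?I (\<O> e)"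
    using mult R.m_comm R.m_closed by (intro idealI) (auto intro: R.ring_axioms)
  then have "J \<subseteq> ?I"
    unfolding coinv_ideal_def using gen
    by (intro R.genideal_minimal) (auto intro: inv_germs_hol)
  then show ?thesis using assms(1) by blast
qed

text \<open>
  The germs of value zero form an ideal that contains the generators. This keeps the constants out of
  the ideal, so that the value survives in the quotient.
\<close>

lemma coinv_ideal_value: "a \<in> J \<Longrightarrow> germ_value V e a = 0"
  by (induction rule: coinv_ideal_induct)
    (simp_all add: germ_value_zero germ_value_add germ_value_mult)

lemma act_coinv_ideal:
  assumes g: "g \<in> carrier G" and "a \<in> J"
  shows "act_germ V G act g e a \<in> J"
  using assms(2)
proof (induction rule: coinv_ideal_induct)
  case (gen p)
  then show ?case using g coinv_ideal_gen by (simp add: inv_germs_def)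
next
  case zero
  then show ?case
    using act_germ_zero[OF g, of "e"] g by (simp add: coinv_ideal_zero)
next
  case (add a b)
  then show ?case
    using act_germ_add[OF g, of "e" a b] g by (simp add: coinv_ideal_add hol_in_mero)
next
  case (mult a b)
  then show ?case
    using act_germ_mult[OF g, of "e" b a] act_germ_hol(1)[OF g, of "e" b] g
    by (simp add: coinv_ideal_mult hol_in_mero)
qed

text \<open>
  A function \<open>F\<close> is a root of the polynomial \<open>\<Prod>\<^sub>g (T - g \<cdot> F)\<close>, whose coefficients are invariant; when
  \<open>F\<close> vanishes at the identity so do all coefficients but the leading one, and \<open>F\<^sup>n\<close> is a combination
  of them.
\<close>

lemma power_card_in_coinv_ideal:
  assumes F: "hol_on V F (carrier V)" and F1: "F e = 0"
  shows "germ V e (\<lambda>y. F y ^ card (carrier G)) \<in> J"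
proof -
  define n where "n = card (carrier G)"
  define P where "P S y = (\<Prod>g\<in>S. [:- F (act g y), 1:])" for S y
  define c where "c k y = poly.coeff (P (carrier G) y) k" for k y
  have Fg: "hol_at V e (\<lambda>y. F (act g y))" if "g \<in> carrier G" for g
    using F that by (intro hol_at_comp[OF _ biholomorphic_act]) (auto simp: hol_at_def)
  have "hol_at V e (\<lambda>y. poly.coeff (P S y) k)" if "finite S" "S \<subseteq> carrier G" for S k
    using that
  proof (induction S arbitrary: k rule: finite_induct)
    case empty
    then show ?case by (simp add: P_def hol_at_const)
  next
    case (insert g S)
    have 1: "hol_at V e (\<lambda>y. (-1) * F (act g y) * poly.coeff (P S y) k)"
      using insert Fg by (intro hol_at_mult hol_at_const) auto
    have 2: "hol_at V e (\<lambda>y. case k of 0 \<Rightarrow> 0 | Suc j \<Rightarrow> poly.coeff (P S y) j)"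
      using insert by (cases k) (auto intro: hol_at_const)
    have "poly.coeff (P (insert g S) y) k =
        (-1) * F (act g y) * poly.coeff (P S y) k + (case k of 0 \<Rightarrow> 0 | Suc j \<Rightarrow> poly.coeff (P S y) j)" for y
      using insert.hyps
      by (simp add: P_def mult_pCons_left Polynomial.coeff_pCons split: nat.split)
    then show ?case using hol_at_add[OF 1 2] by simp
  qed
  then have c_hol: "hol_at V e (c k)" for k
    using finite_group by (simp add: c_def[abs_def])
  have c_inv: "c k (act g y) = c k y" if "g \<in> carrier G" "y \<in> carrier V" for k g y
  proof -
    have "P (carrier G) (act g y) = (\<Prod>h\<in>carrier G. [:- F (act (h \<otimes>\<^bsub>G\<^esub> g) y), 1:])"
      unfolding P_def using that by (intro prod.cong) (simp_all add: act_mult_G)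
    also have "\<dots> = P (carrier G) y"
      unfolding P_def
    proof (rule prod.reindex_bij_witness[of _ "\<lambda>h. h \<otimes>\<^bsub>G\<^esub> inv\<^bsub>G\<^esub> g" "\<lambda>h. h \<otimes>\<^bsub>G\<^esub> g"])
    qed (use that group_G in \<open>simp_all add: group.is_monoid monoid.m_assoc group.l_inv group.r_inv\<close>)
    finally show ?thesis by (simp add: c_def)
  qed
  have c_one: "c k e = 0" if "k < n" for k
  proof -
    have "P (carrier G) e = (\<Prod>g\<in>carrier G. [:0, 1:])"
      unfolding P_def using F1 by (intro prod.cong) simp_all
    then have "P (carrier G) e = Polynomial.monom 1 n" by (simp add: n_def monom_altdef)
    then show ?thesis using that by (simp add: c_def)
  qed
  have c_in: "germ V e (c k) \<in> J" if "k < n" for k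
  proof (rule coinv_ideal_gen)
    show "germ_value V e (germ V e (c k)) = 0"
      using c_hol c_one[OF that] by (simp add: germ_value_germ)
    have "act_germ V G act g e (germ V e (c k)) = germ V e (c k)" if g: "g \<in> carrier G" for g
    proof -
      have "act_germ V G act g e (germ V e (c k)) = germ V e (\<lambda>y. c k (act (inv\<^bsub>G\<^esub> g) y))"
        using act_germ_germ[OF g, of "e" "c k"] g by simp
      also have "\<dots> = germ V e (c k)"
        by (rule germ_eqI) (use g in \<open>simp_all add: c_inv\<close>)
      finally show ?thesis .
    qed
    then show "germ V e (c k) \<in> inv_germs V G act (carrier G) e"
      using c_hol by (simp add: inv_germs_def hol_germsI)
  qed
  have F_pow: "hol_at V e (\<lambda>y. - (F y ^ k))" for k
  proof (induction k)
    case 0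
    then show ?case by (simp add: hol_at_const)
  next
    case (Suc k)
    have "hol_at V e F" using F by (auto simp: hol_at_def)
    then show ?case using hol_at_mult[OF _ Suc] by simp
  qed
  have "germ V e (\<lambda>y. \<Sum>k<m. - (F y ^ k) * c k y) \<in> J" if "m \<le> n" for m
    using that
  proof (induction m)
    case 0
    then show ?case using coinv_ideal_zero by (simp add: germ_zero)
  next
    case (Suc m)
    have "germ V e (\<lambda>y. - (F y ^ m)) \<otimes>\<^bsub>\<M> e\<^esub> germ V e (c m) \<in> J"
      using Suc.prems by (intro coinv_ideal_mult c_in hol_germsI F_pow) auto
    then have 1: "germ V e (\<lambda>y. - (F y ^ m) * c m y) \<in> J"
      by (simp add: germ_mult)
    have 2: "germ V e (\<lambda>y. \<Sum>k<m. - (F y ^ k) * c k y) \<in> J"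
      using Suc by simp
    show ?case using coinv_ideal_add[OF 2 1] by (simp add: germ_add)
  qed
  then have "germ V e (\<lambda>y. \<Sum>k<n. - (F y ^ k) * c k y) \<in> J" by simp
  moreover have "germ V e (\<lambda>y. \<Sum>k<n. - (F y ^ k) * c k y) = germ V e (\<lambda>y. F y ^ n)"
  proof (rule germ_eqI)
    fix y assume y: "y \<in> carrier V"
    have deg: "degree (P (carrier G) y) = n"
      unfolding P_def by (subst degree_prod_sum_eq) (simp_all add: n_def)
    have lead: "c n y = 1"
      using Polynomial.lead_coeff_prod[of "\<lambda>g. [:- F (act g y), 1:]" "carrier G"]
      by (simp add: c_def P_def[symmetric] deg)
    have "poly (P (carrier G) y) (F y) = (\<Prod>g\<in>carrier G. F y - F (act g y))"
      unfolding P_def by (simp add: poly_prod)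
    also have "\<dots> = 0"
      using finite_group y by (intro prod_zero bexI[of _ "\<one>\<^bsub>G\<^esub>"]) simp_all
    finally have "(\<Sum>k\<le>n. c k y * F y ^ k) = 0"
      by (simp add: poly_altdef deg c_def)
    then have "(\<Sum>k<n. c k y * F y ^ k) + F y ^ n = 0"
      by (simp add: lead lessThan_Suc_atMost[symmetric])
    then show "(\<Sum>k<n. - (F y ^ k) * c k y) = F y ^ n"
      by (simp add: sum_negf mult.commute add_eq_0_iff)
  qed simp
  ultimately show ?thesis by (simp add: n_def)
qed

end

section \<open>Moving germs to the identity\<close>

context finite_holomorphic_action
begin

text \<open>
  The translation \<open>push \<xi>\<close> is \<open>\<phi>\<^sub>\<xi>\<close> on germs at the identity, and \<open>pull \<xi>\<close> is its inverse.
\<close>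

definition pull :: "'v \<Rightarrow> 'v germ \<Rightarrow> 'v germ"
  where "pull \<xi> = trans_germ V (inv\<^bsub>V\<^esub> \<xi>) e"

definition push :: "'v \<Rightarrow> 'v germ \<Rightarrow> 'v germ"
  where "push \<xi> = trans_germ V \<xi> \<xi>"

lemma pull_hom:
  assumes "\<xi> \<in> carrier V"
  shows pull_in: "a \<in> carrier (\<M> \<xi>) \<Longrightarrow> pull \<xi> a \<in> carrier (\<M> e)"
    and pull_hol: "a \<in> carrier (\<O> \<xi>) \<Longrightarrow> pull \<xi> a \<in> carrier (\<O> e)"
    and pull_value: "a \<in> carrier (\<O> \<xi>) \<Longrightarrow> germ_value V e (pull \<xi> a) = germ_value V \<xi> a"
    and pull_add: "a \<in> carrier (\<M> \<xi>) \<Longrightarrow> b \<in> carrier (\<M> \<xi>) \<Longrightarrow>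
      pull \<xi> (a \<oplus>\<^bsub>\<M> \<xi>\<^esub> b) = pull \<xi> a \<oplus>\<^bsub>\<M> e\<^esub> pull \<xi> b"
    and pull_mult: "a \<in> carrier (\<M> \<xi>) \<Longrightarrow> b \<in> carrier (\<M> \<xi>) \<Longrightarrow>
      pull \<xi> (a \<otimes>\<^bsub>\<M> \<xi>\<^esub> b) = pull \<xi> a \<otimes>\<^bsub>\<M> e\<^esub> pull \<xi> b"
    and pull_zero: "pull \<xi> \<zero>\<^bsub>\<M> \<xi>\<^esub> = \<zero>\<^bsub>\<M> e\<^esub>"
    and pull_germ: "pull \<xi> (germ V \<xi> f) = germ V e (\<lambda>x. f (\<xi> \<otimes>\<^bsub>V\<^esub> x))"
  using assms trans_germ_in[of "inv\<^bsub>V\<^esub> \<xi>" "e" a] trans_germ_hol[of "inv\<^bsub>V\<^esub> \<xi>" "e" a]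
    trans_germ_add[of "inv\<^bsub>V\<^esub> \<xi>" "e" a b] trans_germ_mult[of "inv\<^bsub>V\<^esub> \<xi>" "e" a b]
    trans_germ_zero[of "inv\<^bsub>V\<^esub> \<xi>" "e"] trans_germ_germ[of "inv\<^bsub>V\<^esub> \<xi>" "e" f]
  by (simp_all add: pull_def)

lemma push_hom:
  assumes "\<xi> \<in> carrier V"
  shows push_in: "a \<in> carrier (\<M> e) \<Longrightarrow> push \<xi> a \<in> carrier (\<M> \<xi>)"
    and push_hol: "a \<in> carrier (\<O> e) \<Longrightarrow> push \<xi> a \<in> carrier (\<O> \<xi>)"
    and push_add: "a \<in> carrier (\<M> e) \<Longrightarrow> b \<in> carrier (\<M> e) \<Longrightarrow>
      push \<xi> (a \<oplus>\<^bsub>\<M> e\<^esub> b) = push \<xi> a \<oplus>\<^bsub>\<M> \<xi>\<^esub> push \<xi> b"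
    and push_mult: "a \<in> carrier (\<M> e) \<Longrightarrow> b \<in> carrier (\<M> e) \<Longrightarrow>
      push \<xi> (a \<otimes>\<^bsub>\<M> e\<^esub> b) = push \<xi> a \<otimes>\<^bsub>\<M> \<xi>\<^esub> push \<xi> b"
    and push_zero: "push \<xi> \<zero>\<^bsub>\<M> e\<^esub> = \<zero>\<^bsub>\<M> \<xi>\<^esub>"
    and push_germ: "push \<xi> (germ V e f) = germ V \<xi> (\<lambda>x. f (inv\<^bsub>V\<^esub> \<xi> \<otimes>\<^bsub>V\<^esub> x))"
  using assms trans_germ_in[of \<xi> \<xi> a] trans_germ_hol[of \<xi> \<xi> a]
    trans_germ_add[of \<xi> \<xi> a b] trans_germ_mult[of \<xi> \<xi> a b]
    trans_germ_zero[of \<xi> \<xi>] trans_germ_germ[of \<xi> \<xi> f]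
  by (simp_all add: push_def)

lemma pull_push:
  assumes "\<xi> \<in> carrier V" "a \<in> carrier (\<M> e)"
  shows "pull \<xi> (push \<xi> a) = a"
  using trans_germ_trans_germ[of "inv\<^bsub>V\<^esub> \<xi>" \<xi> "e" a] trans_germ_one[of "e" a] assms
  by (simp add: pull_def push_def)

lemma push_pull:
  assumes "\<xi> \<in> carrier V" "a \<in> carrier (\<M> \<xi>)"
  shows "push \<xi> (pull \<xi> a) = a"
  using trans_germ_trans_germ[of \<xi> "inv\<^bsub>V\<^esub> \<xi>" \<xi> a] trans_germ_one[of \<xi> a] assms
  by (simp add: pull_def push_def)

lemma trans_germ_push:
  assumes "\<xi> \<in> carrier V" "y \<in> carrier V" "p \<in> carrier (\<M> e)"
  shows "trans_germ V \<xi> y (push (inv\<^bsub>V\<^esub> \<xi> \<otimes>\<^bsub>V\<^esub> y) p) = push y p"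
proof -
  have "inv\<^bsub>V\<^esub> (inv\<^bsub>V\<^esub> \<xi> \<otimes>\<^bsub>V\<^esub> y) \<otimes>\<^bsub>V\<^esub> (inv\<^bsub>V\<^esub> \<xi> \<otimes>\<^bsub>V\<^esub> y) = e" "\<xi> \<otimes>\<^bsub>V\<^esub> (inv\<^bsub>V\<^esub> \<xi> \<otimes>\<^bsub>V\<^esub> y) = y"
    using assms by (simp, simp add: m_assoc[symmetric])
  then show ?thesis
    using trans_germ_trans_germ[of \<xi> "inv\<^bsub>V\<^esub> \<xi> \<otimes>\<^bsub>V\<^esub> y" y p] assms by (simp add: push_def)
qed

lemma act_germ_push:
  assumes "g \<in> carrier G" "y \<in> carrier V" "p \<in> carrier (\<M> e)"
  shows "act_germ V G act g y (push (act (inv\<^bsub>G\<^esub> g) y) p) = push y (act_germ V G act g e p)"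
  using act_germ_trans_germ[of g "act (inv\<^bsub>G\<^esub> g) y" y p] assms
  by (simp add: push_def)

lemma act_germ_pull:
  assumes "g \<in> carrier G" "y \<in> carrier V" "a \<in> carrier (\<M> (act (inv\<^bsub>G\<^esub> g) y))"
  shows "act_germ V G act g e (pull (act (inv\<^bsub>G\<^esub> g) y) a) = pull y (act_germ V G act g y a)"
  using act_germ_trans_germ[of g "inv\<^bsub>V\<^esub> (act (inv\<^bsub>G\<^esub> g) y)" "e" a] assms
  by (simp add: pull_def act_inv_V)

text \<open>The translate to \<open>\<xi>\<close> of the ideal generated by the invariant germs that vanish at the identity.\<close>

definition coinv_at :: "'v \<Rightarrow> 'v germ set"
  where "coinv_at \<xi> = {a \<in> carrier (\<O> \<xi>). pull \<xi> a \<in> J}"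

lemma coinv_at_closed:
  assumes "\<xi> \<in> carrier V"
  shows coinv_at_add: "a \<in> coinv_at \<xi> \<Longrightarrow> b \<in> coinv_at \<xi> \<Longrightarrow> a \<oplus>\<^bsub>\<M> \<xi>\<^esub> b \<in> coinv_at \<xi>"
    and coinv_at_mult: "a \<in> coinv_at \<xi> \<Longrightarrow> b \<in> carrier (\<O> \<xi>) \<Longrightarrow> b \<otimes>\<^bsub>\<M> \<xi>\<^esub> a \<in> coinv_at \<xi>"
    and coinv_at_zero: "\<zero>\<^bsub>\<M> \<xi>\<^esub> \<in> coinv_at \<xi>"
    and coinv_at_value: "a \<in> coinv_at \<xi> \<Longrightarrow> germ_value V \<xi> a = 0"
    and coinv_at_push: "p \<in> J \<Longrightarrow> push \<xi> p \<in> coinv_at \<xi>"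
proof -
  show "germ_value V \<xi> a = 0" if "a \<in> coinv_at \<xi>"
    using that pull_value[OF assms, of a] coinv_ideal_value by (simp add: coinv_at_def)
qed (simp_all add: coinv_at_def assms hol_germs_laws pull_hom coinv_ideal_closed hol_in_mero
    push_hol pull_push)

lemma coinv_at_hol: "a \<in> coinv_at \<xi> \<Longrightarrow> a \<in> carrier (\<O> \<xi>)"
  by (simp add: coinv_at_def)

lemma coinv_at_uminus:
  assumes \<xi>: "\<xi> \<in> carrier V" and a: "a \<in> coinv_at \<xi>"
  shows "\<ominus>\<^bsub>\<M> \<xi>\<^esub> a \<in> coinv_at \<xi>"
proof -
  interpret M: cring "\<M> \<xi>" using cring_mero_germs[OF \<xi>] .
  have am: "a \<in> carrier (\<M> \<xi>)" using a by (simp add: coinv_at_def hol_in_mero)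
  have "\<one>\<^bsub>\<M> \<xi>\<^esub> \<in> carrier (\<O> \<xi>)" using \<xi> by (simp add: germ_one hol_germsI hol_at_const)
  then have "(\<ominus>\<^bsub>\<M> \<xi>\<^esub> \<one>\<^bsub>\<M> \<xi>\<^esub>) \<otimes>\<^bsub>\<M> \<xi>\<^esub> a \<in> coinv_at \<xi>"
    by (intro coinv_at_mult[OF \<xi> a] hol_uminus_in[OF \<xi>])
  then show ?thesis using M.l_minus[of "\<one>\<^bsub>\<M> \<xi>\<^esub>" a] am by simp
qed

lemma coinv_at_act:
  assumes g: "g \<in> carrier G" and y: "y \<in> carrier V" and a: "a \<in> coinv_at (act (inv\<^bsub>G\<^esub> g) y)"
  shows "act_germ V G act g y a \<in> coinv_at y"
  using assms act_germ_hol(1)[OF g y, of a] act_germ_pull[OF g y, of a]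
    act_coinv_ideal[OF g, of "pull (act (inv\<^bsub>G\<^esub> g) y) a"]
  by (simp add: coinv_at_def hol_in_mero)

lemma stabilizerD: "g \<in> stabilizer G act \<xi> \<Longrightarrow> g \<in> carrier G \<and> act g \<xi> = \<xi>"
  by (simp add: stabilizer_def)

lemma act_inv_stabilizer:
  assumes "g \<in> stabilizer G act \<xi>" "\<xi> \<in> carrier V"
  shows "act (inv\<^bsub>G\<^esub> g) \<xi> = \<xi>"
  using act_inv_act[of g \<xi>] stabilizerD[OF assms(1)] assms(2) by simp

text \<open>
  An element that fixes \<open>\<xi>\<close> commutes with \<open>\<phi>\<^sub>\<xi>\<close>, so invariance under the stabilizer may be tested at
  \<open>\<xi>\<close> or after translation to the identity.
\<close>

lemma fibre_kernel_eq:
  assumes \<xi>: "\<xi> \<in> carrier V"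
  shows "fibre_kernel V G act \<xi> = coinv_at \<xi> \<inter> inv_germs V G act (stabilizer G act \<xi>) \<xi>"
proof (intro equalityI subsetI)
  fix a assume "a \<in> fibre_kernel V G act \<xi>"
  then obtain b where b: "b \<in> inv_germs V G act (stabilizer G act \<xi>) e" "b \<in> J" "a = push \<xi> b"
    by (auto simp: fibre_kernel_def push_def)
  have "act_germ V G act g \<xi> a = a" if g: "g \<in> stabilizer G act \<xi>" for g
    using act_germ_push[of g \<xi> b] b g \<xi> stabilizerD[OF g] act_inv_stabilizer[OF g \<xi>]
    by (simp add: inv_germs_def hol_in_mero)
  then show "a \<in> coinv_at \<xi> \<inter> inv_germs V G act (stabilizer G act \<xi>) \<xi>"
    using b \<xi> by (simp add: coinv_at_push inv_germs_def push_hol)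
next
  fix a assume a: "a \<in> coinv_at \<xi> \<inter> inv_germs V G act (stabilizer G act \<xi>) \<xi>"
  have ah: "a \<in> carrier (\<O> \<xi>)" using a by (simp add: coinv_at_def)
  have "act_germ V G act g e (pull \<xi> a) = pull \<xi> a" if g: "g \<in> stabilizer G act \<xi>" for g
    using act_germ_pull[of g \<xi> a] a g \<xi> stabilizerD[OF g] act_inv_stabilizer[OF g \<xi>] ah
    by (simp add: inv_germs_def hol_in_mero)
  then have "pull \<xi> a \<in> inv_germs V G act (stabilizer G act \<xi>) e \<inter> J"
    using a ah \<xi> by (simp add: coinv_at_def inv_germs_def pull_hol)
  moreover have "a = push \<xi> (pull \<xi> a)" using ah \<xi> by (simp add: push_pull hol_in_mero)
  ultimately show "a \<in> fibre_kernel V G act \<xi>"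
    unfolding fibre_kernel_def push_def by blast
qed


section \<open>Averaging over the group\<close>

text \<open>
  The germ \<open>p\<close> is carried to every point by left translation, in contrast to multiplication by the
  germs of one function.
\<close>

definition twist :: "'v germ \<Rightarrow> ('v \<Rightarrow> 'v germ) \<Rightarrow> 'v \<Rightarrow> 'v germ"
  where "twist p s = (\<lambda>y\<in>carrier V. s y \<otimes>\<^bsub>\<M> y\<^esub> push y p)"

lemma twist_in:
  "p \<in> carrier (\<M> e) \<Longrightarrow> s \<in> germ_families \<Longrightarrow> twist p s \<in> germ_families"
  by (simp add: twist_def restrict_PiE_iff mero_mult_in push_in family_apply_in)

text \<open>The reason is that on germs at the identity \<open>\<phi>\<^sub>\<xi> \<phi>\<^bsub>\<xi>\<^sup>-\<^sup>1 y\<^esub> = \<phi>\<^sub>y\<close>.\<close>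

lemma skew_apply_twist:
  assumes a: "a \<in> carrier (skew_ring V)" and s: "s \<in> germ_families" and p: "p \<in> carrier (\<M> e)"
  shows "skew_apply V a (twist p s) = twist p (skew_apply V a s)"
proof (rule family_eqI)
  fix y assume y: "y \<in> carrier V"
  interpret M: cring "\<M> y" using cring_mero_germs[OF y] .
  let ?c = "\<lambda>s \<xi>. a \<xi> y \<otimes>\<^bsub>\<M> y\<^esub> trans_germ V \<xi> y (s (inv\<^bsub>V\<^esub> \<xi> \<otimes>\<^bsub>V\<^esub> y))"
  have eq: "?c (twist p s) \<xi> = ?c s \<xi> \<otimes>\<^bsub>\<M> y\<^esub> push y p" if \<xi>: "\<xi> \<in> carrier V" for \<xi>
    using \<xi> y p s skewD(4)[OF a \<xi> y]
    by (simp add: twist_def trans_germ_mult family_apply_in push_in trans_germ_push M.m_assoc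
        trans_germ_in)
  have "skew_apply V a (twist p s) y = finsum (\<M> y) (\<lambda>\<xi>. ?c s \<xi> \<otimes>\<^bsub>\<M> y\<^esub> push y p) (skew_supp V a)"
    unfolding skew_apply_def restrict_apply'[OF y]
    by (rule M.finsum_cong') (use trans_term_in(2)[OF a s _ y] y p in
        \<open>simp_all add: eq skew_supp_in push_in\<close>)
  also have "\<dots> = finsum (\<M> y) (?c s) (skew_supp V a) \<otimes>\<^bsub>\<M> y\<^esub> push y p"
    by (rule M.finsum_ldistr[symmetric]) (use trans_term_in(2)[OF a s _ y] y p skewD(2)[OF a] in
        \<open>simp_all add: skew_supp_in push_in\<close>)
  finally show "skew_apply V a (twist p s) y = twist p (skew_apply V a s) y"
    by (simp add: twist_def y skew_apply_def)
qed (intro skew_apply_in twist_in a s p)+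

definition average :: "('v \<Rightarrow> 'v germ) \<Rightarrow> 'v \<Rightarrow> 'v germ"
  where "average u = (\<lambda>x\<in>carrier V.
    finsum (\<M> x) (\<lambda>g. act_germ V G act g x (u (act (inv\<^bsub>G\<^esub> g) x))) (carrier G))"

lemma average_term_in:
  "u \<in> germ_families \<Longrightarrow> g \<in> carrier G \<Longrightarrow> x \<in> carrier V \<Longrightarrow>
    act_germ V G act g x (u (act (inv\<^bsub>G\<^esub> g) x)) \<in> carrier (\<M> x)"
  by (simp add: act_germ_in family_apply_in)

lemma average_in:
  assumes "u \<in> germ_families"
  shows "average u \<in> germ_families"
proof -
  have "finsum (\<M> x) (\<lambda>g. act_germ V G act g x (u (act (inv\<^bsub>G\<^esub> g) x))) (carrier G) \<in> carrier (\<M> x)"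
    if x: "x \<in> carrier V" for x
  proof -
    interpret M: cring "\<M> x" using cring_mero_germs[OF x] .
    show ?thesis by (rule M.finsum_closed) (use average_term_in[OF assms _ x] in simp)
  qed
  then show ?thesis by (simp add: average_def restrict_PiE_iff)
qed

lemma average_add:
  assumes u: "u \<in> germ_families" and w: "w \<in> germ_families"
  shows "average (u \<uplus> w) = average u \<uplus> average w"
proof (rule family_eqI)
  fix x assume x: "x \<in> carrier V"
  interpret M: cring "\<M> x" using cring_mero_germs[OF x] .
  have "average (u \<uplus> w) x = finsum (\<M> x)
      (\<lambda>g. act_germ V G act g x (u (act (inv\<^bsub>G\<^esub> g) x)) \<oplus>\<^bsub>\<M> x\<^esub>
        act_germ V G act g x (w (act (inv\<^bsub>G\<^esub> g) x))) (carrier G)"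
    unfolding average_def restrict_apply'[OF x]
    by (rule M.finsum_cong') (use x u w in
        \<open>simp_all add: family_add_apply act_germ_add family_apply_in act_germ_in\<close>)
  also have "\<dots> = average u x \<oplus>\<^bsub>\<M> x\<^esub> average w x"
    unfolding average_def restrict_apply'[OF x]
    by (rule M.finsum_addf) (use average_term_in[OF u _ x] average_term_in[OF w _ x] in simp_all)
  finally show "average (u \<uplus> w) x = (average u \<uplus> average w) x"
    by (simp add: family_add_apply x)
qed (intro average_in family_add_in u w)+

text \<open>
  The translates of an invariant germ \<open>p\<close> are permuted by the group: \<open>g \<phi>\<^sub>x(p) = \<phi>\<^bsub>g x\<^esub>(p)\<close>.
\<close>

lemma average_twist:
  assumes u: "u \<in> germ_families" and p: "p \<in> inv_germs V G act (carrier G) e"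
  shows "average (twist p u) = twist p (average u)"
proof (rule family_eqI)
  have pm: "p \<in> carrier (\<M> e)" using p by (simp add: inv_germs_def hol_in_mero)
  show "average (twist p u) \<in> germ_families" "twist p (average u) \<in> germ_families"
    by (intro average_in twist_in u pm)+
  fix x assume x: "x \<in> carrier V"
  interpret M: cring "\<M> x" using cring_mero_germs[OF x] .
  have eq: "act_germ V G act g x (twist p u (act (inv\<^bsub>G\<^esub> g) x)) =
      act_germ V G act g x (u (act (inv\<^bsub>G\<^esub> g) x)) \<otimes>\<^bsub>\<M> x\<^esub> push x p" if g: "g \<in> carrier G" for g
  proof -
    have "act_germ V G act g e p = p" using p g by (simp add: inv_germs_def)
    then show ?thesis
      using g x u pm by (simp add: twist_def act_germ_mult family_apply_in push_in act_germ_push)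
  qed
  have "average (twist p u) x = finsum (\<M> x)
      (\<lambda>g. act_germ V G act g x (u (act (inv\<^bsub>G\<^esub> g) x)) \<otimes>\<^bsub>\<M> x\<^esub> push x p) (carrier G)"
    unfolding average_def restrict_apply'[OF x]
    by (rule M.finsum_cong') (use average_term_in[OF u _ x] x pm in \<open>simp_all add: eq push_in\<close>)
  also have "\<dots> = average u x \<otimes>\<^bsub>\<M> x\<^esub> push x p"
    unfolding average_def restrict_apply'[OF x]
    by (rule M.finsum_ldistr[symmetric])
      (use average_term_in[OF u _ x] x pm finite_group in \<open>simp_all add: push_in\<close>)
  finally show "average (twist p u) x = twist p (average u) x"
    by (simp add: twist_def x)
qed

lemma average_invariant:
  assumes u: "u \<in> germ_families" and h: "h \<in> carrier G" and y: "y \<in> carrier V"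
  shows "act_germ V G act h y (average u (act (inv\<^bsub>G\<^esub> h) y)) = average u y"
proof -
  interpret M: cring "\<M> y" using cring_mero_germs[OF y] .
  have y': "act (inv\<^bsub>G\<^esub> h) y \<in> carrier V" using h y by simp
  let ?t = "\<lambda>g. act_germ V G act g y (u (act (inv\<^bsub>G\<^esub> g) y))"
  have "act_germ V G act h y (average u (act (inv\<^bsub>G\<^esub> h) y)) = finsum (\<M> y)
     (\<lambda>g. act_germ V G act h y (act_germ V G act g (act (inv\<^bsub>G\<^esub> h) y)
        (u (act (inv\<^bsub>G\<^esub> g) (act (inv\<^bsub>G\<^esub> h) y))))) (carrier G)"
    unfolding average_def restrict_apply'[OF y']
    by (rule act_germ_finsum[OF h y]) (rule average_term_in[OF u _ y'])
  also have "\<dots> = finsum (\<M> y) (\<lambda>g. ?t (h \<otimes>\<^bsub>G\<^esub> g)) (carrier G)"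
  proof (rule M.finsum_cong')
    fix g assume g: "g \<in> carrier G"
    show "act_germ V G act h y (act_germ V G act g (act (inv\<^bsub>G\<^esub> h) y)
        (u (act (inv\<^bsub>G\<^esub> g) (act (inv\<^bsub>G\<^esub> h) y)))) = ?t (h \<otimes>\<^bsub>G\<^esub> g)"
      using act_germ_act_germ[OF h g y, of "u (act (inv\<^bsub>G\<^esub> g) (act (inv\<^bsub>G\<^esub> h) y))"] g h y u
      by (simp add: family_apply_in act_inv_mult_G)
  qed (use average_term_in[OF u _ y] h in simp_all)
  also have "\<dots> = finsum (\<M> y) ?t ((\<lambda>g. h \<otimes>\<^bsub>G\<^esub> g) ` carrier G)"
    by (rule M.finsum_reindex[symmetric])
      (use average_term_in[OF u _ y] h group.inj_on_cmult[OF group_G] in \<open>auto simp: Pi_def\<close>)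
  also have "(\<lambda>g. h \<otimes>\<^bsub>G\<^esub> g) ` carrier G = carrier G"
    using group.surj_const_mult[OF group_G h] .
  finally show ?thesis by (simp add: average_def y)
qed

lemma finsum_const_germ:
  assumes x: "x \<in> carrier V" and a: "a \<in> carrier (\<M> x)" and "finite F"
  shows "finsum (\<M> x) (\<lambda>_. a) F = a \<otimes>\<^bsub>\<M> x\<^esub> germ V x (\<lambda>_. of_nat (card F))"
proof -
  interpret M: cring "\<M> x" using cring_mero_germs[OF x] .
  obtain f where f: "a = germ V x f" "mero_at V x f" using a by (rule mero_germsE)
  show ?thesis
    using \<open>finite F\<close>
  proof (induction F rule: finite_induct)
    case empty
    then show ?case using x by (simp add: f germ_mult germ_zero)
  next
    case (insert i F)
    have "finsum (\<M> x) (\<lambda>_. a) (insert i F) = a \<oplus>\<^bsub>\<M> x\<^esub> finsum (\<M> x) (\<lambda>_. a) F"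
      using insert.hyps a by (intro M.finsum_insert) auto
    then show ?case using insert x by (simp add: f germ_mult germ_add algebra_simps)
  qed
qed

lemma push_const: "y \<in> carrier V \<Longrightarrow> push y (germ V e (\<lambda>_. c)) = germ V y (\<lambda>_. c)"
  by (simp add: push_germ)

lemma average_of_invariant:
  assumes s: "s \<in> germ_families"
    and inv: "\<And>g y. g \<in> carrier G \<Longrightarrow> y \<in> carrier V \<Longrightarrow>
      act_germ V G act g y (s (act (inv\<^bsub>G\<^esub> g) y)) = s y"
  shows "average s = twist (germ V e (\<lambda>_. of_nat (card (carrier G)))) s"
proof (rule family_eqI)
  fix x assume x: "x \<in> carrier V"
  interpret M: cring "\<M> x" using cring_mero_germs[OF x] .
  have sx: "s x \<in> carrier (\<M> x)" using s x by (rule family_apply_in)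
  have "average s x = finsum (\<M> x) (\<lambda>_. s x) (carrier G)"
    unfolding average_def restrict_apply'[OF x]
    by (rule M.finsum_cong') (use inv x sx in simp_all)
  then show "average s x = twist (germ V e (\<lambda>_. of_nat (card (carrier G)))) s x"
    using finsum_const_germ[OF x sx finite_group] x by (simp add: twist_def push_const)
qed (intro average_in twist_in s mero_germsI mero_at_const one_closed)+

lemma hol_finsum:
  assumes x: "x \<in> carrier V" and "finite F" "\<And>i. i \<in> F \<Longrightarrow> m i \<in> carrier (\<O> x)"
  shows "finsum (\<M> x) m F \<in> carrier (\<O> x)"
proof -
  interpret M: cring "\<M> x" using cring_mero_germs[OF x] .
  show ?thesis
    using assms(2,3)
    by (induction F rule: finite_induct)
      (simp_all add: hol_zero_in hol_add_in x Pi_def hol_in_mero)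
qed

end

section \<open>Algebras preserving the invariant sums of holomorphic germs\<close>

text \<open>In the application \<open>X\<close> is a coset and \<open>K\<close> its stabilizer.\<close>

locale preserving_algebra = finite_holomorphic_action K V act
  for K :: "('g, 'k) monoid_scheme" and V :: "('v, 'n::finite) lie_data"
    and act :: "'g \<Rightarrow> 'v \<Rightarrow> 'v" +
  fixes X :: "'v set" and A :: "('v \<Rightarrow> 'v \<Rightarrow> 'v germ) set"
  assumes X_subset: "X \<subseteq> carrier V"
    and X_stable: "g \<in> carrier K \<Longrightarrow> x \<in> X \<Longrightarrow> act g x \<in> X"
    and A_skew: "A \<subseteq> carrier (skew_ring V)"
    and A_mult: "a \<in> A \<Longrightarrow> b \<in> A \<Longrightarrow> a \<otimes>\<^bsub>skew_ring V\<^esub> b \<in> A"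
    and H0_subset: "H0 V K act \<subseteq> A"
    and A_preserves: "a \<in> A \<Longrightarrow> s \<in> inv_germ_sums V K act X \<Longrightarrow>
      skew_apply V a s \<in> inv_germ_sums V K act X"
begin

abbreviation S where "S \<equiv> inv_germ_sums V K act X"

text \<open>
  The sums before invariance is imposed; averaging maps them to \<open>S\<close>.
\<close>

definition hol_sums :: "('v \<Rightarrow> 'v germ) set"
  where "hol_sums = {u \<in> germ_families. (\<forall>x\<in>X. u x \<in> carrier (\<O> x)) \<and>
    (\<forall>x\<in>carrier V - X. u x = \<zero>\<^bsub>\<M> x\<^esub>) \<and> finite {x \<in> X. u x \<noteq> \<zero>\<^bsub>\<M> x\<^esub>}}"

lemma X_in: "x \<in> X \<Longrightarrow> x \<in> carrier V"
  using X_subset by blast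

lemma A_in: "a \<in> A \<Longrightarrow> a \<in> carrier (skew_ring V)"
  using A_skew by blast

lemma hol_sumsD:
  assumes "u \<in> hol_sums"
  shows "u \<in> germ_families" "x \<in> X \<Longrightarrow> u x \<in> carrier (\<O> x)"
    "x \<in> carrier V \<Longrightarrow> x \<notin> X \<Longrightarrow> u x = \<zero>\<^bsub>\<M> x\<^esub>" "finite {x \<in> X. u x \<noteq> \<zero>\<^bsub>\<M> x\<^esub>}"
  using assms by (simp_all add: hol_sums_def)

lemma S_iff:
  "s \<in> S \<longleftrightarrow> s \<in> hol_sums \<and> (\<forall>g\<in>carrier K. \<forall>y\<in>carrier V.
    act_germ V K act g y (s (act (inv\<^bsub>K\<^esub> g) y)) = s y)"
proof -
  have inv: "act_section V K act g s = s \<longleftrightarrow>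
      (\<forall>y\<in>carrier V. act_germ V K act g y (s (act (inv\<^bsub>K\<^esub> g) y)) = s y)"
    if "s \<in> germ_families" "g \<in> carrier K" for g
  proof
    assume *: "act_section V K act g s = s"
    show "\<forall>y\<in>carrier V. act_germ V K act g y (s (act (inv\<^bsub>K\<^esub> g) y)) = s y"
    proof
      fix y assume y: "y \<in> carrier V"
      show "act_germ V K act g y (s (act (inv\<^bsub>K\<^esub> g) y)) = s y"
        using fun_cong[OF *, of y] y by (simp add: act_section_def)
    qed
  next
    assume *: "\<forall>y\<in>carrier V. act_germ V K act g y (s (act (inv\<^bsub>K\<^esub> g) y)) = s y"
    show "act_section V K act g s = s"
      by (rule family_eqI)
        (use that * in \<open>simp_all add: act_section_def restrict_PiE_iff family_apply_in\<close>)
  qed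
  have "{x \<in> carrier V. s x \<noteq> \<zero>\<^bsub>\<M> x\<^esub>} = {x \<in> X. s x \<noteq> \<zero>\<^bsub>\<M> x\<^esub>}"
    if "\<forall>x\<in>carrier V - X. s x = \<zero>\<^bsub>\<M> x\<^esub>"
    using that X_subset by blast
  then show ?thesis
    using inv unfolding inv_germ_sums_def germ_sums_def hol_sums_def by auto
qed

lemma S_hol_sums: "s \<in> S \<Longrightarrow> s \<in> hol_sums"
  by (simp add: S_iff)

lemma S_family: "s \<in> S \<Longrightarrow> s \<in> germ_families"
  by (simp add: S_iff hol_sumsD)

lemma S_hol: "s \<in> S \<Longrightarrow> x \<in> X \<Longrightarrow> s x \<in> carrier (\<O> x)"
  by (simp add: S_iff hol_sumsD)

lemma S_act:
  "s \<in> S \<Longrightarrow> g \<in> carrier K \<Longrightarrow> y \<in> carrier V \<Longrightarrow> act_germ V K act g y (s (act (inv\<^bsub>K\<^esub> g) y)) = s y"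
  by (simp add: S_iff)

lemma hol_sums_add:
  assumes u: "u \<in> hol_sums" and w: "w \<in> hol_sums"
  shows "u \<uplus> w \<in> hol_sums"
proof -
  have "{x \<in> X. (u \<uplus> w) x \<noteq> \<zero>\<^bsub>\<M> x\<^esub>} \<subseteq>
      {x \<in> X. u x \<noteq> \<zero>\<^bsub>\<M> x\<^esub>} \<union> {x \<in> X. w x \<noteq> \<zero>\<^bsub>\<M> x\<^esub>}"
    using mero_zero_add X_in u by (auto simp: family_add_apply hol_in_mero hol_zero_in)
  then have "finite {x \<in> X. (u \<uplus> w) x \<noteq> \<zero>\<^bsub>\<M> x\<^esub>}"
    using hol_sumsD(4)[OF u] hol_sumsD(4)[OF w] finite_subset by blast
  moreover have "u \<uplus> w \<in> germ_families"
    by (intro family_add_in hol_sumsD(1) u w)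
  ultimately show ?thesis
    using hol_sumsD(2,3)[OF u] hol_sumsD(2,3)[OF w] X_in
    by (simp add: hol_sums_def family_add_apply hol_add_in mero_zero_add hol_in_mero hol_zero_in)
qed

lemma S_add: 
  assumes s: "s \<in> S" and t: "t \<in> S"
  shows "s \<uplus> t \<in> S"
  using s t hol_sums_add[of s t]
  by (simp add: S_iff family_add_apply act_germ_add family_apply_in hol_sumsD(1))

lemma family_zero_in: "\<zero>\<^bsub>mero_ring V\<^esub> \<in> germ_families"
  by (rule mero_sectionsD(1)[OF section_zero_in])

lemma S_zero: "\<zero>\<^bsub>mero_ring V\<^esub> \<in> S"
proof -
  have "act_germ V K act g y (\<zero>\<^bsub>mero_ring V\<^esub> (act (inv\<^bsub>K\<^esub> g) y)) = \<zero>\<^bsub>mero_ring V\<^esub> y"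
    if "g \<in> carrier K" "y \<in> carrier V" for g y
    using that by (simp add: section_zero_apply act_germ_zero)
  moreover have "{x \<in> X. \<zero>\<^bsub>mero_ring V\<^esub> x \<noteq> \<zero>\<^bsub>\<M> x\<^esub>} = {}"
    using X_in by (auto simp: section_zero_apply)
  then have "finite {x \<in> X. \<zero>\<^bsub>mero_ring V\<^esub> x \<noteq> \<zero>\<^bsub>\<M> x\<^esub>}" by (simp only: finite.emptyI)
  ultimately show ?thesis
    using X_in family_zero_in by (simp add: S_iff hol_sums_def section_zero_apply hol_zero_in)
qed

lemma average_in_S:
  assumes u: "u \<in> hol_sums"
  shows "average u \<in> S"
proof -
  note uf = hol_sumsD(1)[OF u]
  have zero: "average u x = \<zero>\<^bsub>\<M> x\<^esub>"
    if x: "x \<in> carrier V" and z: "\<And>g. g \<in> carrier K \<Longrightarrow>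
        u (act (inv\<^bsub>K\<^esub> g) x) = \<zero>\<^bsub>\<M> (act (inv\<^bsub>K\<^esub> g) x)\<^esub>" for x
  proof -
    interpret M: cring "\<M> x" using cring_mero_germs[OF x] .
    have "average u x = finsum (\<M> x) (\<lambda>_. \<zero>\<^bsub>\<M> x\<^esub>) (carrier K)"
      unfolding average_def restrict_apply'[OF x]
      by (rule M.finsum_cong') (use x in \<open>simp_all add: z act_germ_zero\<close>)
    then show ?thesis by simp
  qed
  have "{x \<in> X. average u x \<noteq> \<zero>\<^bsub>\<M> x\<^esub>} \<subseteq> (\<Union>g\<in>carrier K. act g ` {x \<in> X. u x \<noteq> \<zero>\<^bsub>\<M> x\<^esub>})"
  proof
    fix x assume x: "x \<in> {x \<in> X. average u x \<noteq> \<zero>\<^bsub>\<M> x\<^esub>}"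
    then have xV: "x \<in> carrier V" using X_in by simp
    then obtain g where g: "g \<in> carrier K" "u (act (inv\<^bsub>K\<^esub> g) x) \<noteq> \<zero>\<^bsub>\<M> (act (inv\<^bsub>K\<^esub> g) x)\<^esub>"
      using zero x by blast
    moreover have "x = act g (act (inv\<^bsub>K\<^esub> g) x)" using g xV by simp
    moreover have "act (inv\<^bsub>K\<^esub> g) x \<in> X" using X_stable g x by simp
    ultimately show "x \<in> (\<Union>g\<in>carrier K. act g ` {x \<in> X. u x \<noteq> \<zero>\<^bsub>\<M> x\<^esub>})" by blast
  qed
  then have fin: "finite {x \<in> X. average u x \<noteq> \<zero>\<^bsub>\<M> x\<^esub>}"
    by (rule finite_subset) (use finite_group hol_sumsD(4)[OF u] in simp)
  have hol: "average u x \<in> carrier (\<O> x)" if x: "x \<in> X" for x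
    unfolding average_def restrict_apply'[OF X_in[OF x]]
    by (rule hol_finsum)
      (use x X_in X_stable finite_group hol_sumsD(2)[OF u] act_germ_hol(1) in simp_all)
  have "average u x = \<zero>\<^bsub>\<M> x\<^esub>" if x: "x \<in> carrier V" "x \<notin> X" for x
  proof (rule zero[OF x(1)])
    fix g assume g: "g \<in> carrier K"
    have "act (inv\<^bsub>K\<^esub> g) x \<notin> X"
      using X_stable[OF g, of "act (inv\<^bsub>K\<^esub> g) x"] g x by auto
    then show "u (act (inv\<^bsub>K\<^esub> g) x) = \<zero>\<^bsub>\<M> (act (inv\<^bsub>K\<^esub> g) x)\<^esub>"
      using hol_sumsD(3)[OF u] g x by simp
  qed
  then show ?thesis
    using fin hol average_in[OF uf] average_invariant[OF uf] by (simp add: S_iff hol_sums_def)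
qed

lemma twist_in_S:
  assumes s: "s \<in> S" and p: "p \<in> inv_germs V K act (carrier K) e"
  shows "twist p s \<in> S"
proof -
  have ph: "p \<in> carrier (\<O> e)" using p by (simp add: inv_germs_def)
  then have pm: "p \<in> carrier (\<M> e)" by (rule hol_in_mero)
  have z: "twist p s x = \<zero>\<^bsub>\<M> x\<^esub>" if "x \<in> carrier V" "s x = \<zero>\<^bsub>\<M> x\<^esub>" for x
  proof -
    interpret M: cring "\<M> x" using cring_mero_germs[OF that(1)] .
    show ?thesis using that pm by (simp add: twist_def push_in)
  qed
  have "{x \<in> X. twist p s x \<noteq> \<zero>\<^bsub>\<M> x\<^esub>} \<subseteq> {x \<in> X. s x \<noteq> \<zero>\<^bsub>\<M> x\<^esub>}"
    using z X_in by auto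
  then have fin: "finite {x \<in> X. twist p s x \<noteq> \<zero>\<^bsub>\<M> x\<^esub>}"
    using finite_subset hol_sumsD(4)[OF S_hol_sums[OF s]] by blast
  have hol: "twist p s x \<in> carrier (\<O> x)" if "x \<in> X" for x
    using that X_in S_hol[OF s] ph by (simp add: twist_def hol_mult_in push_hol)
  have zX: "twist p s x = \<zero>\<^bsub>\<M> x\<^esub>" if "x \<in> carrier V" "x \<notin> X" for x
    using z hol_sumsD(3)[OF S_hol_sums[OF s]] that by simp
  have inv: "act_germ V K act g y (twist p s (act (inv\<^bsub>K\<^esub> g) y)) = twist p s y"
    if "g \<in> carrier K" "y \<in> carrier V" for g y
  proof -
    have "act_germ V K act g e p = p" using p that by (simp add: inv_germs_def)
    then show ?thesis
      using that pm S_act[OF s that] S_family[OF s]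
      by (simp add: twist_def act_germ_mult family_apply_in push_in act_germ_push)
  qed
  show ?thesis
    using fin hol zX inv twist_in[OF pm S_family[OF s]] by (simp add: S_iff hol_sums_def)
qed

lemma const_invariant: "germ V e (\<lambda>_. c) \<in> inv_germs V K act (carrier K) e"
proof -
  have "act_germ V K act g e (germ V e (\<lambda>_. c)) = germ V e (\<lambda>_. c)" if "g \<in> carrier K" for g
    using act_germ_germ[OF that, of "e" "\<lambda>_. c"] that by simp
  then show ?thesis by (simp add: inv_germs_def hol_germsI hol_at_const)
qed


subsection \<open>The kernel of the quotient map is stable\<close>

text \<open>
  An element of the kernel at \<open>\<xi>\<close> is a combination \<open>\<Sum>\<^sub>k b\<^sub>k \<phi>\<^sub>\<xi>(p\<^sub>k)\<close> with invariant \<open>p\<^sub>k\<close> vanishing at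
  the identity, but the coefficients \<open>b\<^sub>k\<close> are not invariant under the stabilizer, so that the algebra
  cannot be applied to them. Averaging repairs this: the averages of the coefficients are invariant
  sums, and twisting by \<open>p\<^sub>k\<close> commutes both with averaging and with the algebra.
\<close>

definition avg_stable :: "('v \<Rightarrow> 'v germ) set"
  where "avg_stable = {u \<in> hol_sums. \<forall>a\<in>A. \<forall>\<eta>\<in>X. skew_apply V a (average u) \<eta> \<in> coinv_at \<eta>}"

definition delta :: "'v \<Rightarrow> 'v germ \<Rightarrow> 'v \<Rightarrow> 'v germ"
  where "delta \<xi> b = (\<lambda>x\<in>carrier V. if x = \<xi> then b else \<zero>\<^bsub>\<M> x\<^esub>)"

lemma delta_in:
  assumes \<xi>: "\<xi> \<in> X" and b: "b \<in> carrier (\<O> \<xi>)"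
  shows "delta \<xi> b \<in> hol_sums"
proof -
  have "{x \<in> X. delta \<xi> b x \<noteq> \<zero>\<^bsub>\<M> x\<^esub>} \<subseteq> {\<xi>}"
    using X_in by (auto simp: delta_def)
  then have "finite {x \<in> X. delta \<xi> b x \<noteq> \<zero>\<^bsub>\<M> x\<^esub>}" using finite_subset by blast
  moreover have "delta \<xi> b \<in> germ_families"
    using b by (simp add: delta_def restrict_PiE_iff hol_in_mero hol_zero_in)
  ultimately show ?thesis
    using \<xi> b X_in by (auto simp: hol_sums_def delta_def hol_zero_in)
qed

lemma avg_stable_add:
  assumes "u \<in> avg_stable" "w \<in> avg_stable"
  shows "u \<uplus> w \<in> avg_stable"
proof -
  have uw: "u \<in> hol_sums" "w \<in> hol_sums" using assms by (simp_all add: avg_stable_def)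
  have "skew_apply V a (average (u \<uplus> w)) \<eta> \<in> coinv_at \<eta>"
    if a: "a \<in> A" and \<eta>: "\<eta> \<in> X" for a \<eta>
    using assms that uw[THEN hol_sumsD(1)] X_in
    by (simp add: average_add skew_apply_add A_in average_in family_add_apply coinv_at_add
        avg_stable_def)
  then show ?thesis using uw hol_sums_add by (simp add: avg_stable_def)
qed

lemma avg_stable_zero: "\<zero>\<^bsub>mero_ring V\<^esub> \<in> avg_stable"
proof -
  let ?z = "germ V e (\<lambda>_. 0)"
  have zm: "?z \<in> carrier (\<M> e)" by (simp add: mero_germsI mero_at_const)
  have tz: "twist ?z s = \<zero>\<^bsub>mero_ring V\<^esub>" if "s \<in> germ_families" for s
  proof (rule family_eqI)
    fix x assume x: "x \<in> carrier V"
    interpret M: cring "\<M> x" using cring_mero_germs[OF x] .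
    show "twist ?z s x = \<zero>\<^bsub>mero_ring V\<^esub> x"
      using x that by (simp add: twist_def push_const germ_zero[symmetric] section_zero_apply
          family_apply_in push_zero)
  qed (use that zm in \<open>simp_all add: twist_in family_zero_in\<close>)
  have "skew_apply V a (average \<zero>\<^bsub>mero_ring V\<^esub>) \<eta> \<in> coinv_at \<eta>"
    if a: "a \<in> A" and \<eta>: "\<eta> \<in> X" for a \<eta>
  proof -
    have "skew_apply V a (average (twist ?z \<zero>\<^bsub>mero_ring V\<^esub>)) =
        twist ?z (skew_apply V a (average \<zero>\<^bsub>mero_ring V\<^esub>))"
      using a by (simp add: average_twist const_invariant family_zero_in skew_apply_twist A_in
          average_in zm)
    also have "\<dots> = \<zero>\<^bsub>mero_ring V\<^esub>"
      using a by (intro tz skew_apply_in average_in A_in family_zero_in)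
    finally show ?thesis
      using \<eta> X_in by (simp add: tz family_zero_in section_zero_apply coinv_at_zero)
  qed
  then show ?thesis using S_hol_sums[OF S_zero] by (simp add: avg_stable_def)
qed

lemma delta_avg_stable:
  assumes \<xi>: "\<xi> \<in> X" and "j \<in> J" and "b \<in> carrier (\<O> e)"
  shows "delta \<xi> (push \<xi> (b \<otimes>\<^bsub>\<M> e\<^esub> j)) \<in> avg_stable"
  using assms(2,3)
proof (induction arbitrary: b rule: coinv_ideal_induct)
  case (gen p)
  have \<xi>V: "\<xi> \<in> carrier V" using \<xi> X_in by simp
  have ph: "p \<in> carrier (\<O> e)" using gen(1) by (simp add: inv_germs_def)
  then have pm: "p \<in> carrier (\<M> e)" by (rule hol_in_mero)
  have pJ: "p \<in> J" using gen(1,2) by (rule coinv_ideal_gen)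
  have bm: "b \<in> carrier (\<M> e)" using gen(3) by (rule hol_in_mero)
  let ?d = "delta \<xi> (push \<xi> b)"
  have d: "?d \<in> hol_sums" using \<xi> \<xi>V gen(3) by (intro delta_in push_hol)
  note df = hol_sumsD(1)[OF d]
  have bp: "b \<otimes>\<^bsub>\<M> e\<^esub> p \<in> carrier (\<O> e)" using gen(3) ph by (simp add: hol_mult_in)
  have dbp: "delta \<xi> (push \<xi> (b \<otimes>\<^bsub>\<M> e\<^esub> p)) \<in> hol_sums"
    using \<xi> \<xi>V bp by (intro delta_in push_hol)
  have eq: "delta \<xi> (push \<xi> (b \<otimes>\<^bsub>\<M> e\<^esub> p)) = twist p ?d"
  proof (rule family_eqI)
    fix x assume x: "x \<in> carrier V"
    interpret M: cring "\<M> x" using cring_mero_germs[OF x] .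
    show "delta \<xi> (push \<xi> (b \<otimes>\<^bsub>\<M> e\<^esub> p)) x = twist p ?d x"
      using x pm bm by (cases "x = \<xi>") (simp_all add: delta_def twist_def push_mult push_in)
  qed (use dbp df pm in \<open>simp_all add: hol_sumsD(1) twist_in\<close>)
  have "skew_apply V a (average (twist p ?d)) \<eta> \<in> coinv_at \<eta>" if a: "a \<in> A" and \<eta>: "\<eta> \<in> X" for a \<eta>
  proof -
    have \<eta>V: "\<eta> \<in> carrier V" using \<eta> X_in by simp
    interpret M: cring "\<M> \<eta>" using cring_mero_germs[OF \<eta>V] .
    have w: "skew_apply V a (average ?d) \<in> S" using A_preserves[OF a average_in_S[OF d]] .
    have "skew_apply V a (average (twist p ?d)) = twist p (skew_apply V a (average ?d))"
      using a by (simp add: average_twist[OF df gen(1)] skew_apply_twist A_in average_in[OF df] pm)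
    moreover have "skew_apply V a (average ?d) \<eta> \<otimes>\<^bsub>\<M> \<eta>\<^esub> push \<eta> p \<in> coinv_at \<eta>"
      using \<eta>V pJ S_hol[OF w \<eta>] by (intro coinv_at_mult coinv_at_push)
    ultimately show ?thesis using \<eta>V by (simp add: twist_def)
  qed
  then show ?case using dbp by (simp add: avg_stable_def eq)
next
  case zero
  have \<xi>V: "\<xi> \<in> carrier V" using \<xi> X_in by simp
  interpret M: cring "\<M> e" using cring_mero_germs[OF one_closed] .
  have "delta \<xi> (push \<xi> (b \<otimes>\<^bsub>\<M> e\<^esub> \<zero>\<^bsub>\<M> e\<^esub>)) = \<zero>\<^bsub>mero_ring V\<^esub>"
    using zero \<xi>V
    by (simp add: delta_def mero_ring_def hol_in_mero push_zero fun_eq_iff restrict_def)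
  then show ?case by (simp add: avg_stable_zero)
next
  case (add a a')
  have \<xi>V: "\<xi> \<in> carrier V" using \<xi> X_in by simp
  interpret M: cring "\<M> e" using cring_mero_germs[OF one_closed] .
  have m: "a \<in> carrier (\<M> e)" "a' \<in> carrier (\<M> e)" "b \<in> carrier (\<M> e)"
    using add by (simp_all add: hol_in_mero)
  have eq: "delta \<xi> (push \<xi> (b \<otimes>\<^bsub>\<M> e\<^esub> (a \<oplus>\<^bsub>\<M> e\<^esub> a'))) =
      delta \<xi> (push \<xi> (b \<otimes>\<^bsub>\<M> e\<^esub> a)) \<uplus> delta \<xi> (push \<xi> (b \<otimes>\<^bsub>\<M> e\<^esub> a'))" (is "?l = ?r")
  proof
    fix x
    show "?l x = ?r x"
    proof (cases "x \<in> carrier V")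
      case True
      interpret Mx: cring "\<M> x" using cring_mero_germs[OF True] .
      show ?thesis
        using True m
        by (cases "x = \<xi>") (simp_all add: delta_def family_add_apply M.r_distr push_add)
    qed (simp add: delta_def mero_ring_def)
  qed
  show ?case unfolding eq using add by (intro avg_stable_add)
next
  case (mult a c)
  interpret M: cring "\<M> e" using cring_mero_germs[OF one_closed] .
  have "b \<otimes>\<^bsub>\<M> e\<^esub> (c \<otimes>\<^bsub>\<M> e\<^esub> a) = b \<otimes>\<^bsub>\<M> e\<^esub> c \<otimes>\<^bsub>\<M> e\<^esub> a"
    using mult by (simp add: M.m_assoc hol_in_mero)
  then show ?case using mult by (simp add: hol_mult_in)
qed

lemma avg_stable_if_coinv:
  assumes "u \<in> hol_sums" "\<And>\<xi>. \<xi> \<in> X \<Longrightarrow> u \<xi> \<in> coinv_at \<xi>"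
  shows "u \<in> avg_stable"
proof -
  have "\<forall>u\<in>hol_sums. {x \<in> X. u x \<noteq> \<zero>\<^bsub>\<M> x\<^esub>} \<subseteq> F \<longrightarrow> (\<forall>\<xi>\<in>X. u \<xi> \<in> coinv_at \<xi>) \<longrightarrow> u \<in> avg_stable"
    if "finite F" "F \<subseteq> X" for F
    using that
  proof (induction F rule: finite_induct)
    case empty
    show ?case
    proof (intro ballI impI)
      fix u assume u: "u \<in> hol_sums" "{x \<in> X. u x \<noteq> \<zero>\<^bsub>\<M> x\<^esub>} \<subseteq> {}"
      have "u x = \<zero>\<^bsub>\<M> x\<^esub>" if "x \<in> carrier V" for x
        using u hol_sumsD(3)[OF u(1) that] by (cases "x \<in> X") auto
      then have "u = \<zero>\<^bsub>mero_ring V\<^esub>"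
        using hol_sumsD(1)[OF u(1)] by (intro family_eqI) (simp_all add: section_zero_apply family_zero_in)
      then show "u \<in> avg_stable" using avg_stable_zero by simp
    qed
  next
    case (insert \<xi> F)
    show ?case
    proof (intro ballI impI)
      fix u assume u: "u \<in> hol_sums" "{x \<in> X. u x \<noteq> \<zero>\<^bsub>\<M> x\<^esub>} \<subseteq> insert \<xi> F"
        and c: "\<forall>\<xi>\<in>X. u \<xi> \<in> coinv_at \<xi>"
      have \<xi>: "\<xi> \<in> X" using insert.prems by simp
      then have \<xi>V: "\<xi> \<in> carrier V" by (rule X_in)
      note uf = hol_sumsD(1)[OF u(1)]
      define w where "w = (\<lambda>x\<in>carrier V. if x = \<xi> then \<zero>\<^bsub>\<M> x\<^esub> else u x)"
      have w_supp: "{x \<in> X. w x \<noteq> \<zero>\<^bsub>\<M> x\<^esub>} \<subseteq> F"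
        using u(2) X_in by (auto simp: w_def)
      have w: "w \<in> hol_sums"
        unfolding hol_sums_def
      proof (intro CollectI conjI ballI)
        show "w \<in> germ_families"
          using uf by (simp add: w_def restrict_PiE_iff family_apply_in hol_zero_in hol_in_mero)
        show "finite {x \<in> X. w x \<noteq> \<zero>\<^bsub>\<M> x\<^esub>}"
          using w_supp insert.hyps(1) by (rule finite_subset)
        show "w x \<in> carrier (\<O> x)" if "x \<in> X" for x
          using that \<xi>V X_in hol_sumsD(2)[OF u(1)] by (simp add: w_def hol_zero_in)
        show "w x = \<zero>\<^bsub>\<M> x\<^esub>" if "x \<in> carrier V - X" for x
          using that hol_sumsD(3)[OF u(1)] by (simp add: w_def)
      qed
      have wc: "\<forall>x\<in>X. w x \<in> coinv_at x"
        using c X_in by (simp add: w_def coinv_at_zero)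
      have wT: "w \<in> avg_stable"
        using insert.IH insert.prems w w_supp wc by simp
      interpret M1: cring "\<M> e" using cring_mero_germs[OF one_closed] .
      have u\<xi>: "u \<xi> \<in> coinv_at \<xi>" using c \<xi> by simp
      have u\<xi>m: "u \<xi> \<in> carrier (\<M> \<xi>)" using u\<xi> by (simp add: coinv_at_def hol_in_mero)
      have "delta \<xi> (push \<xi> (\<one>\<^bsub>\<M> e\<^esub> \<otimes>\<^bsub>\<M> e\<^esub> pull \<xi> (u \<xi>))) \<in> avg_stable"
        using u\<xi> by (intro delta_avg_stable \<xi>)
          (simp_all add: coinv_at_def germ_one hol_germsI hol_at_const)
      then have dT: "delta \<xi> (u \<xi>) \<in> avg_stable"
        using u\<xi>m \<xi>V by (simp add: pull_in push_pull)
      have "u = delta \<xi> (u \<xi>) \<uplus> w" (is "_ = ?r")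
      proof (rule family_eqI)
        show "?r \<in> germ_families"
          using dT w by (intro family_add_in hol_sumsD(1)) (simp_all add: avg_stable_def)
        fix x assume x: "x \<in> carrier V"
        interpret Mx: cring "\<M> x" using cring_mero_germs[OF x] .
        show "u x = ?r x"
          using x uf u\<xi>m Mx.r_zero[of "u x"]
          by (cases "x = \<xi>") (simp_all add: family_add_apply delta_def w_def family_apply_in)
      qed (rule uf)
      then show "u \<in> avg_stable" using avg_stable_add[OF dT wT] by simp
    qed
  qed
  from this[OF hol_sumsD(4)[OF assms(1)]] assms show ?thesis by blast
qed

lemma coinv_at_divide:
  assumes \<eta>: "\<eta> \<in> carrier V" and a: "a \<in> carrier (\<O> \<eta>)" and c: "c \<noteq> 0"
    and ac: "a \<otimes>\<^bsub>\<M> \<eta>\<^esub> germ V \<eta> (\<lambda>_. c) \<in> coinv_at \<eta>"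
  shows "a \<in> coinv_at \<eta>"
proof -
  obtain f where f: "a = germ V \<eta> f" using a by (rule hol_germsE)
  have "germ V \<eta> (\<lambda>_. 1 / c) \<otimes>\<^bsub>\<M> \<eta>\<^esub> (a \<otimes>\<^bsub>\<M> \<eta>\<^esub> germ V \<eta> (\<lambda>_. c)) \<in> coinv_at \<eta>"
    by (intro coinv_at_mult[OF \<eta> ac] hol_germsI hol_at_const \<eta>)
  then show ?thesis using \<eta> c by (simp add: f germ_mult)
qed

lemma kernel_stable:
  assumes s: "s \<in> S" and c: "\<And>\<xi>. \<xi> \<in> X \<Longrightarrow> s \<xi> \<in> coinv_at \<xi>" and a: "a \<in> A" and \<eta>: "\<eta> \<in> X"
  shows "skew_apply V a s \<eta> \<in> coinv_at \<eta>"
proof (rule coinv_at_divide)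
  let ?n = "of_nat (card (carrier K)) :: complex"
  show \<eta>V: "\<eta> \<in> carrier V" using \<eta> by (rule X_in)
  show "skew_apply V a s \<eta> \<in> carrier (\<O> \<eta>)" using A_preserves[OF a s] \<eta> by (rule S_hol)
  show "?n \<noteq> 0" using card_G_pos by simp
  have "s \<in> avg_stable" using avg_stable_if_coinv[OF S_hol_sums[OF s] c] .
  then have "skew_apply V a (average s) \<eta> \<in> coinv_at \<eta>" using a \<eta> by (simp add: avg_stable_def)
  moreover have "average s = twist (germ V e (\<lambda>_. ?n)) s"
    by (rule average_of_invariant[OF S_family[OF s] S_act[OF s]])
  moreover have "skew_apply V a (twist (germ V e (\<lambda>_. ?n)) s) =
      twist (germ V e (\<lambda>_. ?n)) (skew_apply V a s)"
    by (intro skew_apply_twist A_in a S_family s mero_germsI mero_at_const one_closed)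
  ultimately have "twist (germ V e (\<lambda>_. ?n)) (skew_apply V a s) \<eta> \<in> coinv_at \<eta>" by simp
  then show "skew_apply V a s \<eta> \<otimes>\<^bsub>\<M> \<eta>\<^esub> germ V \<eta> (\<lambda>_. ?n) \<in> coinv_at \<eta>"
    using \<eta>V by (simp add: twist_def push_const)
qed

end

section \<open>The quotient module\<close>

context finite_holomorphic_action
begin

abbreviation I where "I \<xi> \<equiv> inv_germs V G act (stabilizer G act \<xi>) \<xi>"
abbreviation ker where "ker \<equiv> fibre_kernel V G act"

lemma I_act: "a \<in> I \<xi> \<Longrightarrow> g \<in> stabilizer G act \<xi> \<Longrightarrow> act_germ V G act g \<xi> a = a"
  by (simp add: inv_germs_def)

lemma I_mero: "a \<in> I \<xi> \<Longrightarrow> a \<in> carrier (\<M> \<xi>)"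
  by (simp add: inv_germs_def hol_in_mero)

lemma subring_I:
  assumes \<xi>: "\<xi> \<in> carrier V"
  shows "subring (I \<xi>) (\<M> \<xi>)"
proof -
  interpret M: cring "\<M> \<xi>" using cring_mero_germs[OF \<xi>] .
  note E = subringE[OF subring_hol_germs[OF \<xi>]]
  have act: "act_germ V G act g \<xi> (a \<oplus>\<^bsub>\<M> \<xi>\<^esub> b) = act_germ V G act g \<xi> a \<oplus>\<^bsub>\<M> \<xi>\<^esub> act_germ V G act g \<xi> b"
    "act_germ V G act g \<xi> (a \<otimes>\<^bsub>\<M> \<xi>\<^esub> b) = act_germ V G act g \<xi> a \<otimes>\<^bsub>\<M> \<xi>\<^esub> act_germ V G act g \<xi> b"
    "act_germ V G act g \<xi> (\<ominus>\<^bsub>\<M> \<xi>\<^esub> a) = \<ominus>\<^bsub>\<M> \<xi>\<^esub> act_germ V G act g \<xi> a"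
    if "g \<in> stabilizer G act \<xi>" "a \<in> carrier (\<M> \<xi>)" "b \<in> carrier (\<M> \<xi>)" for g a b
    using that \<xi> act_inv_stabilizer[OF that(1) \<xi>] stabilizerD[OF that(1)]
      act_germ_add[of g \<xi> a b] act_germ_mult[of g \<xi> a b] act_germ_uminus[of g \<xi> a] by simp_all
  show ?thesis
  proof (rule M.subringI)
    show "I \<xi> \<subseteq> carrier (\<M> \<xi>)" using I_mero by blast
    show "\<one>\<^bsub>\<M> \<xi>\<^esub> \<in> I \<xi>"
    proof -
      have "act_germ V G act g \<xi> (germ V \<xi> (\<lambda>_. 1)) = germ V \<xi> (\<lambda>_. 1)"
        if "g \<in> stabilizer G act \<xi>" for g
        using that \<xi> act_inv_stabilizer[OF that \<xi>] stabilizerD[OF that]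
          act_germ_germ[of g \<xi> "\<lambda>_. 1"] by simp
      then show ?thesis using E(3) by (simp add: inv_germs_def germ_one)
    qed
    show "\<ominus>\<^bsub>\<M> \<xi>\<^esub> a \<in> I \<xi>" if "a \<in> I \<xi>" for a
      using that E(5) act(3)[of _ a a] by (simp add: inv_germs_def hol_in_mero)
    show "a \<otimes>\<^bsub>\<M> \<xi>\<^esub> b \<in> I \<xi>" "a \<oplus>\<^bsub>\<M> \<xi>\<^esub> b \<in> I \<xi>" if "a \<in> I \<xi>" "b \<in> I \<xi>" for a b
      using that E(6,7) act(1,2) by (simp_all add: inv_germs_def hol_in_mero)
  qed
qed

definition inv_ring :: "'v \<Rightarrow> 'v germ ring"
  where "inv_ring \<xi> = (\<M> \<xi>)\<lparr>carrier := I \<xi>\<rparr>"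

lemma inv_ring_simps [simp]:
  "carrier (inv_ring \<xi>) = I \<xi>" "a \<oplus>\<^bsub>inv_ring \<xi>\<^esub> b = a \<oplus>\<^bsub>\<M> \<xi>\<^esub> b" "\<zero>\<^bsub>inv_ring \<xi>\<^esub> = \<zero>\<^bsub>\<M> \<xi>\<^esub>"
  by (simp_all add: inv_ring_def)

lemma cring_inv_ring:
  assumes \<xi>: "\<xi> \<in> carrier V"
  shows "cring (inv_ring \<xi>)"
proof -
  interpret M: cring "\<M> \<xi>" using cring_mero_germs[OF \<xi>] .
  show ?thesis
    using M.subcring_iff[of "I \<xi>"] M.subcringI'[OF subring_I[OF \<xi>]] subringE(1)[OF subring_I[OF \<xi>]]
    by (simp add: inv_ring_def)
qed

lemma fibre_eq: "fibre V G act \<xi> = inv_ring \<xi> A_Mod ker \<xi>"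
  by (simp add: fibre_def inv_ring_def hol_germs_def)

lemma coset_inv_ring: "ker \<xi> +>\<^bsub>inv_ring \<xi>\<^esub> a = ker \<xi> +>\<^bsub>\<M> \<xi>\<^esub> a"
  by (simp add: a_r_coset_def r_coset_def inv_ring_def)

lemma ker_I: "\<xi> \<in> carrier V \<Longrightarrow> c \<in> ker \<xi> \<Longrightarrow> c \<in> I \<xi>"
  and ker_coinv: "\<xi> \<in> carrier V \<Longrightarrow> c \<in> ker \<xi> \<Longrightarrow> c \<in> coinv_at \<xi>"
  and kerI: "\<xi> \<in> carrier V \<Longrightarrow> c \<in> I \<xi> \<Longrightarrow> c \<in> coinv_at \<xi> \<Longrightarrow> c \<in> ker \<xi>"
  by (simp_all add: fibre_kernel_eq)

lemma abelian_subgroup_ker: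
  assumes \<xi>: "\<xi> \<in> carrier V"
  shows "abelian_subgroup (ker \<xi>) (inv_ring \<xi>)"
proof (rule abelian_subgroupI3)
  interpret R: cring "inv_ring \<xi>" using cring_inv_ring[OF \<xi>] .
  interpret M: cring "\<M> \<xi>" using cring_mero_germs[OF \<xi>] .
  show "abelian_group (inv_ring \<xi>)" by (rule R.abelian_group_axioms)
  note E = subringE[OF subring_I[OF \<xi>]]
  have inv: "inv\<^bsub>add_monoid (inv_ring \<xi>)\<^esub> a = \<ominus>\<^bsub>\<M> \<xi>\<^esub> a" if "a \<in> I \<xi>" for a
  proof -
    have "\<ominus>\<^bsub>inv_ring \<xi>\<^esub> a = \<ominus>\<^bsub>\<M> \<xi>\<^esub> a"
      by (rule R.minus_equality) (use that E(5) I_mero in \<open>simp_all add: M.l_neg\<close>)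
    then show ?thesis by (simp add: a_inv_def)
  qed
  show "additive_subgroup (ker \<xi>) (inv_ring \<xi>)"
  proof (rule additive_subgroup.intro, rule group.subgroupI[OF R.a_group])
    show "ker \<xi> \<subseteq> carrier (add_monoid (inv_ring \<xi>))" using ker_I[OF \<xi>] by auto
    show "ker \<xi> \<noteq> {}"
      using kerI[OF \<xi> E(2) coinv_at_zero[OF \<xi>]] by blast
    show "inv\<^bsub>add_monoid (inv_ring \<xi>)\<^esub> a \<in> ker \<xi>" if "a \<in> ker \<xi>" for a
      unfolding inv[OF ker_I[OF \<xi> that]]
      by (rule kerI[OF \<xi> E(5)[OF ker_I[OF \<xi> that]] coinv_at_uminus[OF \<xi> ker_coinv[OF \<xi> that]]])
    show "a \<otimes>\<^bsub>add_monoid (inv_ring \<xi>)\<^esub> b \<in> ker \<xi>" if "a \<in> ker \<xi>" "b \<in> ker \<xi>" for a b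
    proof -
      have "a \<oplus>\<^bsub>\<M> \<xi>\<^esub> b \<in> ker \<xi>"
        by (rule kerI[OF \<xi> E(7)[OF ker_I[OF \<xi> that(1)] ker_I[OF \<xi> that(2)]]
            coinv_at_add[OF \<xi> ker_coinv[OF \<xi> that(1)] ker_coinv[OF \<xi> that(2)]]])
      then show ?thesis by simp
    qed
  qed
qed

lemma fibre_facts:
  assumes \<xi>: "\<xi> \<in> carrier V"
  shows coset_in_fibre: "a \<in> I \<xi> \<Longrightarrow> ker \<xi> +>\<^bsub>\<M> \<xi>\<^esub> a \<in> carrier (fibre V G act \<xi>)"
    and fibreE: "T \<in> carrier (fibre V G act \<xi>) \<Longrightarrow> \<exists>a\<in>I \<xi>. T = ker \<xi> +>\<^bsub>\<M> \<xi>\<^esub> a"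
    and fibre_mult: "a \<in> I \<xi> \<Longrightarrow> b \<in> I \<xi> \<Longrightarrow>
      (ker \<xi> +>\<^bsub>\<M> \<xi>\<^esub> a) \<otimes>\<^bsub>fibre V G act \<xi>\<^esub> (ker \<xi> +>\<^bsub>\<M> \<xi>\<^esub> b) = ker \<xi> +>\<^bsub>\<M> \<xi>\<^esub> (a \<oplus>\<^bsub>\<M> \<xi>\<^esub> b)"
    and fibre_one: "\<one>\<^bsub>fibre V G act \<xi>\<^esub> = ker \<xi> +>\<^bsub>\<M> \<xi>\<^esub> \<zero>\<^bsub>\<M> \<xi>\<^esub>"
    and coset_eq_iff: "a \<in> I \<xi> \<Longrightarrow> b \<in> I \<xi> \<Longrightarrow>
      ker \<xi> +>\<^bsub>\<M> \<xi>\<^esub> a = ker \<xi> +>\<^bsub>\<M> \<xi>\<^esub> b \<longleftrightarrow> a \<ominus>\<^bsub>\<M> \<xi>\<^esub> b \<in> coinv_at \<xi>"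
proof -
  interpret abelian_subgroup "ker \<xi>" "inv_ring \<xi>" using abelian_subgroup_ker[OF \<xi>] .
  interpret M: cring "\<M> \<xi>" using cring_mero_germs[OF \<xi>] .
  note E = subringE[OF subring_I[OF \<xi>]]
  have carr: "carrier (fibre V G act \<xi>) = a_rcosets\<^bsub>inv_ring \<xi>\<^esub> (ker \<xi>)"
    by (simp add: fibre_eq A_FactGroup_def')
  show "a \<in> I \<xi> \<Longrightarrow> ker \<xi> +>\<^bsub>\<M> \<xi>\<^esub> a \<in> carrier (fibre V G act \<xi>)"
    unfolding carr coset_inv_ring[symmetric] using a_subset by (intro a_rcosetsI) auto
  show "T \<in> carrier (fibre V G act \<xi>) \<Longrightarrow> \<exists>a\<in>I \<xi>. T = ker \<xi> +>\<^bsub>\<M> \<xi>\<^esub> a"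
    unfolding carr by (auto simp: A_RCOSETS_defs a_r_coset_defs inv_ring_def)
  show "a \<in> I \<xi> \<Longrightarrow> b \<in> I \<xi> \<Longrightarrow>
      (ker \<xi> +>\<^bsub>\<M> \<xi>\<^esub> a) \<otimes>\<^bsub>fibre V G act \<xi>\<^esub> (ker \<xi> +>\<^bsub>\<M> \<xi>\<^esub> b) = ker \<xi> +>\<^bsub>\<M> \<xi>\<^esub> (a \<oplus>\<^bsub>\<M> \<xi>\<^esub> b)"
    using a_rcos_sum[of a b] by (simp add: fibre_eq coset_inv_ring)
  have "ker \<xi> +>\<^bsub>inv_ring \<xi>\<^esub> \<zero>\<^bsub>\<M> \<xi>\<^esub> = ker \<xi>"
    using a_rcos_const[of "\<zero>\<^bsub>\<M> \<xi>\<^esub>"] kerI[OF \<xi> E(2) coinv_at_zero[OF \<xi>]] by blast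
  then show "\<one>\<^bsub>fibre V G act \<xi>\<^esub> = ker \<xi> +>\<^bsub>\<M> \<xi>\<^esub> \<zero>\<^bsub>\<M> \<xi>\<^esub>"
    by (simp add: fibre_eq A_FactGroup_def' coset_inv_ring)
  assume a: "a \<in> I \<xi>" and b: "b \<in> I \<xi>"
  have am: "a \<in> carrier (\<M> \<xi>)" "b \<in> carrier (\<M> \<xi>)" using a b I_mero by auto
  have "ker \<xi> +>\<^bsub>inv_ring \<xi>\<^esub> a = ker \<xi> +>\<^bsub>inv_ring \<xi>\<^esub> b \<longleftrightarrow> a \<in> ker \<xi> +>\<^bsub>inv_ring \<xi>\<^esub> b"
    using a_rcos_self[of a] a_repr_independence'[of a b] a b by (metis inv_ring_simps(1))
  also have "\<dots> \<longleftrightarrow> (\<exists>c\<in>ker \<xi>. a = c \<oplus>\<^bsub>\<M> \<xi>\<^esub> b)"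
    by (auto simp: a_r_coset_def r_coset_def inv_ring_def)
  also have "\<dots> \<longleftrightarrow> a \<ominus>\<^bsub>\<M> \<xi>\<^esub> b \<in> coinv_at \<xi>"
  proof
    assume "\<exists>c\<in>ker \<xi>. a = c \<oplus>\<^bsub>\<M> \<xi>\<^esub> b"
    then obtain c where c: "c \<in> ker \<xi>" "a = c \<oplus>\<^bsub>\<M> \<xi>\<^esub> b" by blast
    have cm: "c \<in> carrier (\<M> \<xi>)" using ker_I[OF \<xi> c(1)] by (rule I_mero)
    have "a \<ominus>\<^bsub>\<M> \<xi>\<^esub> b = c" using am cm c(2) by (simp add: M.minus_eq M.a_assoc M.r_neg)
    then show "a \<ominus>\<^bsub>\<M> \<xi>\<^esub> b \<in> coinv_at \<xi>" using ker_coinv[OF \<xi> c(1)] by simp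
  next
    assume d: "a \<ominus>\<^bsub>\<M> \<xi>\<^esub> b \<in> coinv_at \<xi>"
    have "a \<ominus>\<^bsub>\<M> \<xi>\<^esub> b \<in> I \<xi>" using E(5,7) a b by (simp add: M.minus_eq)
    moreover have "a = (a \<ominus>\<^bsub>\<M> \<xi>\<^esub> b) \<oplus>\<^bsub>\<M> \<xi>\<^esub> b"
      using am by (simp add: M.minus_eq M.a_assoc M.l_neg)
    ultimately show "\<exists>c\<in>ker \<xi>. a = c \<oplus>\<^bsub>\<M> \<xi>\<^esub> b" using kerI[OF \<xi> _ d] by blast
  qed
  finally show "ker \<xi> +>\<^bsub>\<M> \<xi>\<^esub> a = ker \<xi> +>\<^bsub>\<M> \<xi>\<^esub> b \<longleftrightarrow> a \<ominus>\<^bsub>\<M> \<xi>\<^esub> b \<in> coinv_at \<xi>"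
    by (simp add: coset_inv_ring)
qed

lemma stabilizer_conj:
  assumes g: "g \<in> carrier G" and \<xi>: "\<xi> \<in> carrier V" and h: "h \<in> stabilizer G act (act g \<xi>)"
  shows "inv\<^bsub>G\<^esub> g \<otimes>\<^bsub>G\<^esub> h \<otimes>\<^bsub>G\<^esub> g \<in> stabilizer G act \<xi>"
proof -
  have "h \<in> carrier G" "act h (act g \<xi>) = act g \<xi>" using stabilizerD[OF h] by simp_all
  then show ?thesis using g \<xi> by (simp add: stabilizer_def act_mult_G)
qed

lemma act_germ_I:
  assumes g: "g \<in> carrier G" and \<xi>: "\<xi> \<in> carrier V" and a: "a \<in> I \<xi>"
  shows "act_germ V G act g (act g \<xi>) a \<in> I (act g \<xi>)"
proof -
  let ?\<eta> = "act g \<xi>"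
  have \<eta>: "?\<eta> \<in> carrier V" using g \<xi> by simp
  have ah: "a \<in> carrier (\<O> \<xi>)" using a by (simp add: inv_germs_def)
  have "act_germ V G act h ?\<eta> (act_germ V G act g ?\<eta> a) = act_germ V G act g ?\<eta> a"
    if h: "h \<in> stabilizer G act ?\<eta>" for h
  proof -
    define k where "k = inv\<^bsub>G\<^esub> g \<otimes>\<^bsub>G\<^esub> h \<otimes>\<^bsub>G\<^esub> g"
    have hG: "h \<in> carrier G" using stabilizerD[OF h] by simp
    have k: "k \<in> stabilizer G act \<xi>" unfolding k_def by (rule stabilizer_conj[OF g \<xi> h])
    have kG: "k \<in> carrier G" using stabilizerD[OF k] by simp
    have hg: "h \<otimes>\<^bsub>G\<^esub> g = g \<otimes>\<^bsub>G\<^esub> k"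
    proof -
      interpret G: group G by (rule group_G)
      show ?thesis using g hG by (simp add: k_def G.m_assoc[symmetric])
    qed
    have "act_germ V G act h ?\<eta> (act_germ V G act g ?\<eta> a) = act_germ V G act (h \<otimes>\<^bsub>G\<^esub> g) ?\<eta> a"
      using act_germ_act_germ[OF hG g \<eta>, of a] act_inv_stabilizer[OF h \<eta>] g \<xi> ah
      by (simp add: hol_in_mero)
    also have "\<dots> = act_germ V G act g ?\<eta> (act_germ V G act k \<xi> a)"
      using act_germ_act_germ[OF g kG \<eta>, of a] act_inv_stabilizer[OF k \<xi>] g \<xi> ah
      by (simp add: hg hol_in_mero)
    finally show ?thesis using I_act[OF a k] by simp
  qed
  then show ?thesis
    using act_germ_hol(1)[OF g \<eta>, of a] g \<xi> ah by (simp add: inv_germs_def)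
qed

lemma act_germ_ker:
  assumes g: "g \<in> carrier G" and \<xi>: "\<xi> \<in> carrier V" and a: "a \<in> ker \<xi>"
  shows "act_germ V G act g (act g \<xi>) a \<in> ker (act g \<xi>)"
proof (rule kerI)
  show "act_germ V G act g (act g \<xi>) a \<in> coinv_at (act g \<xi>)"
    by (rule coinv_at_act[OF g]) (use g \<xi> ker_coinv[OF \<xi> a] in simp_all)
qed (use g \<xi> act_germ_I[OF g \<xi> ker_I[OF \<xi> a]] in simp_all)

text \<open>
  This is the equivariance of the classes of an invariant sum.
\<close>

lemma act_germ_coset:
  assumes g: "g \<in> carrier G" and \<xi>: "\<xi> \<in> carrier V" and a: "a \<in> I \<xi>"
  shows "act_germ V G act g (act g \<xi>) ` (ker \<xi> +>\<^bsub>\<M> \<xi>\<^esub> a) =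
    ker (act g \<xi>) +>\<^bsub>\<M> (act g \<xi>)\<^esub> act_germ V G act g (act g \<xi>) a"
proof -
  let ?\<eta> = "act g \<xi>"
  have \<eta>: "?\<eta> \<in> carrier V" using g \<xi> by simp
  have coset: "ker x +>\<^bsub>\<M> x\<^esub> b = (\<lambda>c. c \<oplus>\<^bsub>\<M> x\<^esub> b) ` ker x" for x b
    by (auto simp: a_r_coset_def r_coset_def)
  have "act_germ V G act g ?\<eta> ` ker \<xi> = ker ?\<eta>"
  proof (intro equalityI subsetI)
    fix c assume c: "c \<in> ker ?\<eta>"
    have "act_germ V G act (inv\<^bsub>G\<^esub> g) \<xi> c \<in> ker \<xi>"
      using act_germ_ker[of "inv\<^bsub>G\<^esub> g" ?\<eta> c] g \<xi> c by simp
    moreover have "act_germ V G act g ?\<eta> (act_germ V G act (inv\<^bsub>G\<^esub> g) \<xi> c) = c"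
      using act_germ_act_germ[of g "inv\<^bsub>G\<^esub> g" ?\<eta> c] g \<xi> I_mero[OF ker_I[OF \<eta> c]]
        act_germ_one[OF \<eta>] group.r_inv[OF group_G g] by simp
    ultimately show "c \<in> act_germ V G act g ?\<eta> ` ker \<xi>" by force
  qed (use act_germ_ker[OF g \<xi>] in blast)
  moreover have "act_germ V G act g ?\<eta> (c \<oplus>\<^bsub>\<M> \<xi>\<^esub> a) =
      act_germ V G act g ?\<eta> c \<oplus>\<^bsub>\<M> ?\<eta>\<^esub> act_germ V G act g ?\<eta> a" if "c \<in> ker \<xi>" for c
    using act_germ_add[OF g \<eta>, of c a] g \<xi> I_mero[OF a] I_mero[OF ker_I[OF \<xi> that]] by simp
  then have "act_germ V G act g ?\<eta> ` ((\<lambda>c. c \<oplus>\<^bsub>\<M> \<xi>\<^esub> a) ` ker \<xi>) =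
      (\<lambda>c. c \<oplus>\<^bsub>\<M> ?\<eta>\<^esub> act_germ V G act g ?\<eta> a) ` (act_germ V G act g ?\<eta> ` ker \<xi>)"
    unfolding image_image by (rule image_cong[OF refl])
  ultimately show ?thesis unfolding coset by simp
qed

end

context preserving_algebra
begin

abbreviation M where "M \<equiv> quot_module V K act X"
abbreviation cls where "cls \<equiv> quot_class V K act X"

lemma cls_apply: "\<xi> \<in> X \<Longrightarrow> cls s \<xi> = ker \<xi> +>\<^bsub>\<M> \<xi>\<^esub> s \<xi>"
  by (simp add: quot_class_def)

lemma S_I: "s \<in> S \<Longrightarrow> \<xi> \<in> X \<Longrightarrow> s \<xi> \<in> I \<xi>"
  unfolding inv_germs_def
proof (intro CollectI conjI ballI)
  fix g assume s: "s \<in> S" and \<xi>: "\<xi> \<in> X" and g: "g \<in> stabilizer K act \<xi>"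
  show "act_germ V K act g \<xi> (s \<xi>) = s \<xi>"
    using S_act[OF s, of g \<xi>] act_inv_stabilizer[OF g X_in[OF \<xi>]] stabilizerD[OF g] X_in[OF \<xi>]
    by simp
qed (rule S_hol)

lemma S_act_at:
  "s \<in> S \<Longrightarrow> g \<in> carrier K \<Longrightarrow> \<xi> \<in> X \<Longrightarrow> act_germ V K act g (act g \<xi>) (s \<xi>) = s (act g \<xi>)"
  using S_act[of s g "act g \<xi>"] by (simp add: X_in)

lemma cls_eq_iff:
  assumes "s \<in> S" "t \<in> S"
  shows "cls s = cls t \<longleftrightarrow> (\<forall>\<xi>\<in>X. s \<xi> \<ominus>\<^bsub>\<M> \<xi>\<^esub> t \<xi> \<in> coinv_at \<xi>)"
proof -
  have "cls s = cls t \<longleftrightarrow> (\<forall>\<xi>\<in>X. cls s \<xi> = cls t \<xi>)"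
    by (auto simp: quot_class_def fun_eq_iff restrict_def)
  also have "\<dots> \<longleftrightarrow> (\<forall>\<xi>\<in>X. s \<xi> \<ominus>\<^bsub>\<M> \<xi>\<^esub> t \<xi> \<in> coinv_at \<xi>)"
    using S_I[OF assms(1)] S_I[OF assms(2)] by (simp add: cls_apply coset_eq_iff X_in)
  finally show ?thesis .
qed

lemma cls_in:
  assumes s: "s \<in> S"
  shows "cls s \<in> carrier M"
proof -
  have "{\<xi> \<in> X. cls s \<xi> \<noteq> \<one>\<^bsub>fibre V K act \<xi>\<^esub>} \<subseteq> {\<xi> \<in> X. s \<xi> \<noteq> \<zero>\<^bsub>\<M> \<xi>\<^esub>}"
    by (auto simp: cls_apply fibre_one X_in)
  then have "finite {\<xi> \<in> X. cls s \<xi> \<noteq> \<one>\<^bsub>fibre V K act \<xi>\<^esub>}"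
    using finite_subset hol_sumsD(4)[OF S_hol_sums[OF s]] by blast
  moreover have "cls s (act g \<xi>) = act_germ V K act g (act g \<xi>) ` cls s \<xi>"
    if "g \<in> carrier K" "\<xi> \<in> X" for g \<xi>
    using that X_stable act_germ_coset[OF that(1) X_in[OF that(2)] S_I[OF s that(2)]] s
    by (simp add: cls_apply S_act_at)
  moreover have "cls s \<in> (\<Pi>\<^sub>E \<xi>\<in>X. carrier (fibre V K act \<xi>))"
    using S_I[OF s] by (simp add: quot_class_def restrict_PiE_iff coset_in_fibre X_in)
  ultimately show ?thesis by (simp add: quot_module_def)
qed

lemma minus_one_const:
  assumes "\<xi> \<in> carrier V" "a \<in> carrier (\<M> \<xi>)"
  shows "a \<otimes>\<^bsub>\<M> \<xi>\<^esub> germ V \<xi> (\<lambda>_. -1) = \<ominus>\<^bsub>\<M> \<xi>\<^esub> a"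
proof -
  obtain f where "a = germ V \<xi> f" "mero_at V \<xi> f" using assms(2) by (rule mero_germsE)
  then show ?thesis using assms(1) by (simp add: germ_mult germ_uminus)
qed

definition scale :: "complex \<Rightarrow> ('v \<Rightarrow> 'v germ) \<Rightarrow> 'v \<Rightarrow> 'v germ"
  where "scale c = twist (germ V e (\<lambda>_. c))"

lemma scale_apply: "y \<in> carrier V \<Longrightarrow> scale c s y = s y \<otimes>\<^bsub>\<M> y\<^esub> germ V y (\<lambda>_. c)"
  by (simp add: scale_def twist_def push_const)

lemma scale_in_S: "s \<in> S \<Longrightarrow> scale c s \<in> S"
  unfolding scale_def by (intro twist_in_S const_invariant)

lemma skew_apply_scale:
  "a \<in> carrier (skew_ring V) \<Longrightarrow> s \<in> germ_families \<Longrightarrow> skew_apply V a (scale c s) = scale c (skew_apply V a s)"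
  unfolding scale_def by (intro skew_apply_twist mero_germsI mero_at_const one_closed)

lemma scale_minus_one_add:
  assumes s: "s \<in> S"
  shows "scale (-1) s \<uplus> s = \<zero>\<^bsub>mero_ring V\<^esub>"
proof (rule family_eqI)
  fix y assume y: "y \<in> carrier V"
  interpret M: cring "\<M> y" using cring_mero_germs[OF y] .
  show "(scale (-1) s \<uplus> s) y = \<zero>\<^bsub>mero_ring V\<^esub> y"
    using y S_family[OF s] by (simp add: family_add_apply scale_apply minus_one_const family_apply_in
        section_zero_apply M.l_neg)
qed (use s in \<open>simp_all add: family_add_in S_family scale_in_S family_zero_in\<close>)

definition diff :: "('v \<Rightarrow> 'v germ) \<Rightarrow> ('v \<Rightarrow> 'v germ) \<Rightarrow> 'v \<Rightarrow> 'v germ"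
  where "diff s t = s \<uplus> scale (-1) t"

lemma diff_in_S: "s \<in> S \<Longrightarrow> t \<in> S \<Longrightarrow> diff s t \<in> S"
  unfolding diff_def by (intro S_add scale_in_S)

lemma diff_apply:
  assumes "t \<in> germ_families" "y \<in> carrier V"
  shows "diff s t y = s y \<ominus>\<^bsub>\<M> y\<^esub> t y"
proof -
  interpret M: cring "\<M> y" using cring_mero_germs[OF assms(2)] .
  show ?thesis
    using assms by (simp add: diff_def family_add_apply scale_apply minus_one_const family_apply_in
        M.minus_eq)
qed

lemma cls_eq_iff_diff:
  "s \<in> S \<Longrightarrow> t \<in> S \<Longrightarrow> cls s = cls t \<longleftrightarrow> (\<forall>\<xi>\<in>X. diff s t \<xi> \<in> coinv_at \<xi>)"
  by (simp add: cls_eq_iff diff_apply S_family X_in)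

text \<open>
  By \<open>kernel_stable\<close> the induced action does not depend on representatives.
\<close>

lemma skew_apply_cls_cong:
  assumes "s \<in> S" "t \<in> S" "cls s = cls t" "a \<in> A"
  shows "cls (skew_apply V a s) = cls (skew_apply V a t)"
proof -
  have "skew_apply V a (diff s t) = diff (skew_apply V a s) (skew_apply V a t)"
    using assms unfolding diff_def
    by (simp add: skew_apply_add skew_apply_scale A_in S_family scale_in_S)
  moreover have "\<forall>\<eta>\<in>X. skew_apply V a (diff s t) \<eta> \<in> coinv_at \<eta>"
    using kernel_stable[OF diff_in_S[OF assms(1,2)] _ assms(4)] cls_eq_iff_diff[OF assms(1,2)] assms(3)
    by blast
  ultimately show ?thesis
    using assms A_preserves by (simp add: cls_eq_iff_diff)
qed

text \<open>
  Lifting an invariant family of classes: averaging arbitrary representatives gives invariant ones,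
  and each of the averaged terms lies in the given class already.
\<close>

lemma cls_surj:
  assumes t: "t \<in> carrier M"
  shows "\<exists>s\<in>S. cls s = t"
proof -
  have t_fibre: "t \<in> (\<Pi>\<^sub>E \<xi>\<in>X. carrier (fibre V K act \<xi>))"
    and t_fin: "finite {\<xi> \<in> X. t \<xi> \<noteq> \<one>\<^bsub>fibre V K act \<xi>\<^esub>}"
    and t_act: "\<And>g \<xi>. g \<in> carrier K \<Longrightarrow> \<xi> \<in> X \<Longrightarrow> t (act g \<xi>) = act_germ V K act g (act g \<xi>) ` t \<xi>"
    using t by (simp_all add: quot_module_def)
  have "\<exists>a\<in>I \<xi>. t \<xi> = ker \<xi> +>\<^bsub>\<M> \<xi>\<^esub> a \<and> (t \<xi> = \<one>\<^bsub>fibre V K act \<xi>\<^esub> \<longrightarrow> a = \<zero>\<^bsub>\<M> \<xi>\<^esub>)" if "\<xi> \<in> X" for \<xi>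
  proof (cases "t \<xi> = \<one>\<^bsub>fibre V K act \<xi>\<^esub>")
    case True
    then show ?thesis
      using that fibre_one[OF X_in[OF that]] subringE(2)[OF subring_I[OF X_in[OF that]]] by auto
  next
    case False
    then show ?thesis using fibreE[OF X_in[OF that]] PiE_mem[OF t_fibre that] by blast
  qed
  then obtain r where r: "\<And>\<xi>. \<xi> \<in> X \<Longrightarrow> r \<xi> \<in> I \<xi>" "\<And>\<xi>. \<xi> \<in> X \<Longrightarrow> t \<xi> = ker \<xi> +>\<^bsub>\<M> \<xi>\<^esub> r \<xi>"
    "\<And>\<xi>. \<xi> \<in> X \<Longrightarrow> t \<xi> = \<one>\<^bsub>fibre V K act \<xi>\<^esub> \<Longrightarrow> r \<xi> = \<zero>\<^bsub>\<M> \<xi>\<^esub>"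
    by metis
  define u where "u = (\<lambda>x\<in>carrier V. if x \<in> X then r x else \<zero>\<^bsub>\<M> x\<^esub>)"
  have u_X: "u \<xi> = r \<xi>" if "\<xi> \<in> X" for \<xi> using that X_in by (simp add: u_def)
  have u: "u \<in> hol_sums"
    unfolding hol_sums_def
  proof (intro CollectI conjI ballI)
    show "u \<in> germ_families"
      using r(1) I_mero by (auto simp: u_def restrict_PiE_iff hol_zero_in hol_in_mero)
    show "u x \<in> carrier (\<O> x)" if "x \<in> X" for x
      using that r(1)[OF that] by (simp add: u_X inv_germs_def)
    show "u x = \<zero>\<^bsub>\<M> x\<^esub>" if "x \<in> carrier V - X" for x
      using that by (simp add: u_def)
    show "finite {x \<in> X. u x \<noteq> \<zero>\<^bsub>\<M> x\<^esub>}"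
      by (rule finite_subset[OF _ t_fin]) (use r(3) u_X in auto)
  qed
  let ?n = "of_nat (card (carrier K)) :: complex"
  define s where "s = scale (1 / ?n) (average u)"
  have s: "s \<in> S" unfolding s_def by (intro scale_in_S average_in_S u)
  have "cls s \<xi> = t \<xi>" if \<xi>: "\<xi> \<in> X" for \<xi>
  proof -
    have \<xi>V: "\<xi> \<in> carrier V" using \<xi> by (rule X_in)
    interpret M: cring "\<M> \<xi>" using cring_mero_germs[OF \<xi>V] .
    define x where "x g = act_germ V K act g \<xi> (u (act (inv\<^bsub>K\<^esub> g) \<xi>))" for g
    have x: "x g \<in> I \<xi> \<and> x g \<ominus>\<^bsub>\<M> \<xi>\<^esub> r \<xi> \<in> coinv_at \<xi>" if g: "g \<in> carrier K" for g
    proof -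
      let ?\<zeta> = "act (inv\<^bsub>K\<^esub> g) \<xi>"
      have \<zeta>: "?\<zeta> \<in> X" using X_stable g \<xi> by simp
      then have \<zeta>V: "?\<zeta> \<in> carrier V" by (rule X_in)
      have xg: "x g = act_germ V K act g \<xi> (r ?\<zeta>)" by (simp add: x_def u_X \<zeta>)
      have xI: "x g \<in> I \<xi>"
        using act_germ_I[OF g \<zeta>V r(1)[OF \<zeta>]] g \<xi>V by (simp add: xg)
      have "ker \<xi> +>\<^bsub>\<M> \<xi>\<^esub> x g = ker \<xi> +>\<^bsub>\<M> \<xi>\<^esub> r \<xi>"
        using act_germ_coset[OF g \<zeta>V r(1)[OF \<zeta>]] t_act[OF g \<zeta>] g \<xi>V r(2)[OF \<xi>] r(2)[OF \<zeta>]
        by (simp add: xg)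
      then show ?thesis using xI coset_eq_iff[OF \<xi>V xI r(1)[OF \<xi>]] by simp
    qed
    have rm: "r \<xi> \<in> carrier (\<M> \<xi>)" using r(1)[OF \<xi>] by (rule I_mero)
    have xm: "x g \<in> carrier (\<M> \<xi>)" if "g \<in> carrier K" for g using x[OF that] I_mero by blast
    have "finsum (\<M> \<xi>) x F \<ominus>\<^bsub>\<M> \<xi>\<^esub> finsum (\<M> \<xi>) (\<lambda>_. r \<xi>) F \<in> coinv_at \<xi>"
      if "finite F" "F \<subseteq> carrier K" for F
      using that
    proof (induction F rule: finite_induct)
      case empty
      then show ?case by (simp add: M.minus_eq coinv_at_zero \<xi>V)
    next
      case (insert g F)
      have F: "x \<in> F \<rightarrow> carrier (\<M> \<xi>)" using insert.prems xm by auto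
      let ?x = "finsum (\<M> \<xi>) x F" and ?r = "finsum (\<M> \<xi>) (\<lambda>_. r \<xi>) F"
      have m: "?x \<in> carrier (\<M> \<xi>)" "?r \<in> carrier (\<M> \<xi>)" "x g \<in> carrier (\<M> \<xi>)"
        using F rm xm insert.prems by (auto intro: M.finsum_closed)
      have "finsum (\<M> \<xi>) x (insert g F) = x g \<oplus>\<^bsub>\<M> \<xi>\<^esub> ?x"
        "finsum (\<M> \<xi>) (\<lambda>_. r \<xi>) (insert g F) = r \<xi> \<oplus>\<^bsub>\<M> \<xi>\<^esub> ?r"
        using insert.hyps F m rm by (intro M.finsum_insert; auto)+
      moreover have "x g \<oplus>\<^bsub>\<M> \<xi>\<^esub> ?x \<ominus>\<^bsub>\<M> \<xi>\<^esub> (r \<xi> \<oplus>\<^bsub>\<M> \<xi>\<^esub> ?r) =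
          (x g \<ominus>\<^bsub>\<M> \<xi>\<^esub> r \<xi>) \<oplus>\<^bsub>\<M> \<xi>\<^esub> (?x \<ominus>\<^bsub>\<M> \<xi>\<^esub> ?r)"
        using m rm by (simp add: M.minus_eq M.minus_add M.a_ac)
      ultimately show ?case
        using insert x[of g] by (simp add: coinv_at_add \<xi>V)
    qed
    from this[OF finite_group subset_refl]
    have "average u \<xi> \<ominus>\<^bsub>\<M> \<xi>\<^esub> (r \<xi> \<otimes>\<^bsub>\<M> \<xi>\<^esub> germ V \<xi> (\<lambda>_. ?n)) \<in> coinv_at \<xi>"
      using finsum_const_germ[OF \<xi>V rm finite_group] \<xi>V by (simp add: average_def x_def[abs_def])
    then have "(s \<xi> \<ominus>\<^bsub>\<M> \<xi>\<^esub> r \<xi>) \<otimes>\<^bsub>\<M> \<xi>\<^esub> germ V \<xi> (\<lambda>_. ?n) \<in> coinv_at \<xi>"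
    proof -
      have av: "average u \<xi> \<in> carrier (\<M> \<xi>)"
        using average_in[OF hol_sumsD(1)[OF u]] \<xi>V by (rule family_apply_in)
      obtain f where f: "average u \<xi> = germ V \<xi> f" "mero_at V \<xi> f" using av by (rule mero_germsE)
      obtain h where h: "r \<xi> = germ V \<xi> h" "mero_at V \<xi> h" using rm by (rule mero_germsE)
      have n: "?n \<noteq> 0" using card_G_pos by simp
      have "mero_at V \<xi> (\<lambda>y. h y * ?n)" using h(2) \<xi>V by (intro mero_at_mult mero_at_const)
      then have "average u \<xi> \<ominus>\<^bsub>\<M> \<xi>\<^esub> (r \<xi> \<otimes>\<^bsub>\<M> \<xi>\<^esub> germ V \<xi> (\<lambda>_. ?n)) =
          (s \<xi> \<ominus>\<^bsub>\<M> \<xi>\<^esub> r \<xi>) \<otimes>\<^bsub>\<M> \<xi>\<^esub> germ V \<xi> (\<lambda>_. ?n)"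
        using n \<xi>V by (simp add: s_def scale_apply f h germ_mult germ_add germ_uminus M.minus_eq
            distrib_right left_diff_distrib)
      then show "(s \<xi> \<ominus>\<^bsub>\<M> \<xi>\<^esub> r \<xi>) \<otimes>\<^bsub>\<M> \<xi>\<^esub> germ V \<xi> (\<lambda>_. ?n) \<in> coinv_at \<xi>"
        if "average u \<xi> \<ominus>\<^bsub>\<M> \<xi>\<^esub> (r \<xi> \<otimes>\<^bsub>\<M> \<xi>\<^esub> germ V \<xi> (\<lambda>_. ?n)) \<in> coinv_at \<xi>"
        using that by simp
    qed
    then have "s \<xi> \<ominus>\<^bsub>\<M> \<xi>\<^esub> r \<xi> \<in> coinv_at \<xi>"
    proof (rule coinv_at_divide[OF \<xi>V, rotated 2])
      show "s \<xi> \<ominus>\<^bsub>\<M> \<xi>\<^esub> r \<xi> \<in> carrier (\<O> \<xi>)"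
        using S_hol[OF s \<xi>] r(1)[OF \<xi>] \<xi>V
        by (simp add: M.minus_eq hol_add_in hol_uminus_in inv_germs_def)
      show "?n \<noteq> 0" using card_G_pos by simp
    qed
    then show ?thesis
      using coset_eq_iff[OF \<xi>V S_I[OF s \<xi>] r(1)[OF \<xi>]] r(2)[OF \<xi>] \<xi> by (simp add: cls_apply)
  qed
  moreover have "cls s \<in> extensional X" by (simp add: quot_class_def)
  moreover have "t \<in> extensional X" using t_fibre by (simp add: PiE_def)
  ultimately have "cls s = t" by (intro extensionalityI)
  then show ?thesis using s by blast
qed

lemma cls_mult:
  assumes "s \<in> S" "t \<in> S"
  shows "cls s \<otimes>\<^bsub>M\<^esub> cls t = cls (s \<uplus> t)"
  using S_I[OF assms(1)] S_I[OF assms(2)]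
  by (simp add: quot_module_def quot_class_def fibre_mult family_add_apply X_in cong: restrict_cong)

lemma cls_zero: "\<one>\<^bsub>M\<^esub> = cls \<zero>\<^bsub>mero_ring V\<^esub>"
  by (simp add: quot_module_def quot_class_def fibre_one section_zero_apply X_in cong: restrict_cong)

lemma quot_act_cls:
  assumes "a \<in> A" "s \<in> S"
  shows "quot_act V K act X a (cls s) = cls (skew_apply V a s)"
proof -
  let ?t = "inv_into S cls (cls s)"
  have "cls s \<in> cls ` S" using assms(2) by blast
  then have "?t \<in> S" "cls ?t = cls s" by (rule inv_into_into, rule f_inv_into_f)
  then show ?thesis
    using skew_apply_cls_cong[of ?t s a] assms by (simp add: quot_act_def)
qed

lemma group_M: "group M"
proof (rule groupI)
  interpret R: abelian_monoid "mero_ring V" by (rule abelian_monoid_mero_ring)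
  show "\<one>\<^bsub>M\<^esub> \<in> carrier M" by (simp add: cls_zero cls_in S_zero)
  fix x assume "x \<in> carrier M"
  then obtain s where s: "s \<in> S" "x = cls s" using cls_surj by blast
  have sf: "s \<in> germ_families" using s(1) by (rule S_family)
  have "\<zero>\<^bsub>mero_ring V\<^esub> \<uplus> s = s"
    by (rule family_eqI)
      (use sf in \<open>simp_all add: family_add_in family_zero_in family_add_apply section_zero_apply
        mero_zero_add family_apply_in\<close>)
  then show "\<one>\<^bsub>M\<^esub> \<otimes>\<^bsub>M\<^esub> x = x" by (simp add: s cls_zero cls_mult S_zero)
  show "\<exists>y\<in>carrier M. y \<otimes>\<^bsub>M\<^esub> x = \<one>\<^bsub>M\<^esub>"
    using s by (intro bexI[of _ "cls (scale (-1) s)"])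
      (simp_all add: cls_mult scale_in_S scale_minus_one_add cls_zero cls_in)
  fix y assume "y \<in> carrier M"
  then obtain t where t: "t \<in> S" "y = cls t" using cls_surj by blast
  show "x \<otimes>\<^bsub>M\<^esub> y \<in> carrier M" using s t by (simp add: cls_mult cls_in S_add)
  fix z assume "z \<in> carrier M"
  then obtain w where w: "w \<in> S" "z = cls w" using cls_surj by blast
  have "s \<uplus> t \<uplus> w = s \<uplus> (t \<uplus> w)"
    by (rule family_eqI) (use s t w in \<open>simp_all add: family_add_in S_family family_add_apply
        mero_add_assoc family_apply_in mero_add_in\<close>)
  then show "x \<otimes>\<^bsub>M\<^esub> y \<otimes>\<^bsub>M\<^esub> z = x \<otimes>\<^bsub>M\<^esub> (y \<otimes>\<^bsub>M\<^esub> z)"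
    using s t w by (simp add: cls_mult S_add)
qed

end

section \<open>Invariant holomorphic functions acting on the quotient module\<close>

context preserving_algebra
begin

abbreviation Inv where "Inv \<equiv> invariant_hol_funs V K act"
abbreviation orbs where "orbs \<equiv> orbits K X act"
abbreviation part where "part \<equiv> orbit_part V K act X"
abbreviation submodule where "submodule \<equiv> submodule_of V K act X"

lemma InvI:
  "hol_on V f (carrier V) \<Longrightarrow> (\<And>g x. g \<in> carrier K \<Longrightarrow> x \<in> carrier V \<Longrightarrow> f (act (inv\<^bsub>K\<^esub> g) x) = f x) \<Longrightarrow>
    f \<in> Inv"
  by (simp add: invariant_hol_funs_def)

lemma Inv_hol: "f \<in> Inv \<Longrightarrow> hol_on V f (carrier V)"
  by (simp add: invariant_hol_funs_def)

lemma Inv_hol_at: "f \<in> Inv \<Longrightarrow> x \<in> carrier V \<Longrightarrow> hol_at V x f"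
  unfolding hol_at_def by (intro exI[of _ "carrier V"] conjI Inv_hol)

lemma Inv_act_inv: "f \<in> Inv \<Longrightarrow> g \<in> carrier K \<Longrightarrow> x \<in> carrier V \<Longrightarrow> f (act (inv\<^bsub>K\<^esub> g) x) = f x"
  by (simp add: invariant_hol_funs_def)

lemma Inv_act:
  assumes "f \<in> Inv" "g \<in> carrier K" "x \<in> carrier V"
  shows "f (act g x) = f x"
  using Inv_act_inv[OF assms(1) inv_G_closed[OF assms(2)] assms(3)] assms(2) by simp

lemma Inv_const: "(\<lambda>_. c) \<in> Inv"
  by (rule InvI) (simp_all add: hol_on_const openin_carrier)

lemma Inv_add: "f \<in> Inv \<Longrightarrow> h \<in> Inv \<Longrightarrow> (\<lambda>x. f x + h x) \<in> Inv"
  by (rule InvI) (simp_all add: hol_on_add Inv_hol Inv_act_inv[of f] Inv_act_inv[of h])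

lemma Inv_mult: "f \<in> Inv \<Longrightarrow> h \<in> Inv \<Longrightarrow> (\<lambda>x. f x * h x) \<in> Inv"
  by (rule InvI) (simp_all add: hol_on_mult Inv_hol Inv_act_inv[of f] Inv_act_inv[of h])

lemma Inv_minus: "f \<in> Inv \<Longrightarrow> h \<in> Inv \<Longrightarrow> (\<lambda>x. f x - h x) \<in> Inv"
  using Inv_add[of f "\<lambda>x. (-1) * h x"] Inv_mult[OF Inv_const[of "-1"], of h] by simp

lemma Inv_power: "f \<in> Inv \<Longrightarrow> (\<lambda>x. f x ^ k) \<in> Inv"
  by (induction k) (simp_all add: Inv_const Inv_mult)

lemma Inv_sum: "(\<And>i. i \<in> F \<Longrightarrow> f i \<in> Inv) \<Longrightarrow> (\<lambda>x. \<Sum>i\<in>F. f i x) \<in> Inv"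
  by (induction F rule: infinite_finite_induct) (simp_all add: Inv_const Inv_add)

lemma Inv_prod: "(\<And>i. i \<in> F \<Longrightarrow> f i \<in> Inv) \<Longrightarrow> (\<lambda>x. \<Prod>i\<in>F. f i x) \<in> Inv"
  by (induction F rule: infinite_finite_induct) (simp_all add: Inv_const Inv_mult)

definition emb :: "('v \<Rightarrow> complex) \<Rightarrow> 'v \<Rightarrow> 'v \<Rightarrow> 'v germ"
  where "emb f = skew_monom V (fun_section V f) e"

definition fmul :: "('v \<Rightarrow> complex) \<Rightarrow> ('v \<Rightarrow> 'v germ) \<Rightarrow> 'v \<Rightarrow> 'v germ"
  where "fmul f s = skew_apply V (emb f) s"

lemma emb_H0: "f \<in> Inv \<Longrightarrow> emb f \<in> H0 V K act"
  by (simp add: H0_def emb_def)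

lemma emb_A: "f \<in> Inv \<Longrightarrow> emb f \<in> A"
  using emb_H0 H0_subset by blast

lemma fmul_apply:
  assumes f: "f \<in> Inv" and s: "s \<in> germ_families" and y: "y \<in> carrier V"
  shows "fmul f s y = germ V y f \<otimes>\<^bsub>\<M> y\<^esub> s y"
  using skew_apply_monom[OF fun_section_in[OF Inv_hol[OF f]] one_closed s y] s y
  by (simp add: fmul_def emb_def fun_section_def trans_germ_one family_apply_in)

lemma fmul_in_S: "f \<in> Inv \<Longrightarrow> s \<in> S \<Longrightarrow> fmul f s \<in> S"
  unfolding fmul_def by (intro A_preserves emb_A)

lemma fmul_cls_cong:
  "f \<in> Inv \<Longrightarrow> s \<in> S \<Longrightarrow> t \<in> S \<Longrightarrow> cls s = cls t \<Longrightarrow> cls (fmul f s) = cls (fmul f t)"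
  unfolding fmul_def by (intro skew_apply_cls_cong emb_A)

lemma fmul_fmul:
  assumes "f \<in> Inv" "h \<in> Inv" "s \<in> S"
  shows "fmul f (fmul h s) = fmul (\<lambda>x. f x * h x) s"
proof (rule family_eqI)
  fix y assume y: "y \<in> carrier V"
  interpret M: cring "\<M> y" using cring_mero_germs[OF y] .
  have "germ V y f \<in> carrier (\<M> y)" "germ V y h \<in> carrier (\<M> y)"
    using assms y by (simp_all add: mero_germsI hol_at_imp_mero_at Inv_hol_at)
  then show "fmul f (fmul h s) y = fmul (\<lambda>x. f x * h x) s y"
    using assms y by (simp add: fmul_apply S_family fmul_in_S Inv_mult germ_mult[symmetric]
        M.m_assoc family_apply_in)
qed (use assms in \<open>simp_all add: S_family fmul_in_S Inv_mult\<close>)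

lemma fmul_add:
  assumes "f \<in> Inv" "h \<in> Inv" "s \<in> S"
  shows "fmul f s \<uplus> fmul h s = fmul (\<lambda>x. f x + h x) s"
proof (rule family_eqI)
  fix y assume y: "y \<in> carrier V"
  interpret M: cring "\<M> y" using cring_mero_germs[OF y] .
  have "germ V y f \<in> carrier (\<M> y)" "germ V y h \<in> carrier (\<M> y)"
    using assms y by (simp_all add: mero_germsI hol_at_imp_mero_at Inv_hol_at)
  then show "(fmul f s \<uplus> fmul h s) y = fmul (\<lambda>x. f x + h x) s y"
    using assms y by (simp add: fmul_apply S_family Inv_add germ_add[symmetric]
        M.l_distr family_apply_in family_add_apply)
qed (use assms in \<open>simp_all add: S_family fmul_in_S Inv_add S_add\<close>)

lemma fmul_one:
  assumes "s \<in> S"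
  shows "fmul (\<lambda>_. 1) s = s"
proof (rule family_eqI)
  fix y assume y: "y \<in> carrier V"
  interpret M: cring "\<M> y" using cring_mero_germs[OF y] .
  show "fmul (\<lambda>_. 1) s y = s y"
    using assms y by (simp add: fmul_apply S_family Inv_const germ_one[symmetric] family_apply_in)
qed (use assms in \<open>simp_all add: S_family fmul_in_S Inv_const\<close>)

lemma fmul_value:
  assumes "f \<in> Inv" "s \<in> S" "\<xi> \<in> X"
  shows "germ_value V \<xi> (fmul f s \<xi>) = f \<xi> * germ_value V \<xi> (s \<xi>)"
  using assms by (simp add: fmul_apply S_family X_in germ_value_mult S_hol germ_value_germ
      Inv_hol_at hol_germsI)

text \<open>
  After translation from \<open>\<xi>\<close> to the identity this is \<open>power_card_in_coinv_ideal\<close>, which has to admit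
  arbitrary functions because the translate of \<open>f\<close> is in general not invariant.
\<close>

lemma power_kills_fibre:
  assumes f: "f \<in> Inv" and \<xi>: "\<xi> \<in> X" and f0: "f \<xi> = 0" and b: "b \<in> carrier (\<O> \<xi>)"
  shows "germ V \<xi> (\<lambda>y. f y ^ card (carrier K)) \<otimes>\<^bsub>\<M> \<xi>\<^esub> b \<in> coinv_at \<xi>"
proof -
  let ?n = "card (carrier K)"
  have \<xi>V: "\<xi> \<in> carrier V" using \<xi> by (rule X_in)
  interpret M: cring "\<M> \<xi>" using cring_mero_germs[OF \<xi>V] .
  have "{x \<in> carrier V. \<xi> \<otimes>\<^bsub>V\<^esub> x \<in> carrier V} = carrier V" using \<xi>V by auto
  then have "hol_on V (\<lambda>x. f (\<xi> \<otimes>\<^bsub>V\<^esub> x)) (carrier V)"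
    using hol_on_comp[OF Inv_hol[OF f] holomorphic_left_translation[OF \<xi>V]] by simp
  then have "germ V e (\<lambda>x. f (\<xi> \<otimes>\<^bsub>V\<^esub> x) ^ ?n) \<in> J"
    by (rule power_card_in_coinv_ideal) (use \<xi>V f0 in simp)
  moreover have h: "germ V \<xi> (\<lambda>y. f y ^ ?n) \<in> carrier (\<O> \<xi>)"
    by (intro hol_germsI Inv_hol_at Inv_power f \<xi>V)
  ultimately have "germ V \<xi> (\<lambda>y. f y ^ ?n) \<in> coinv_at \<xi>"
    using \<xi>V by (simp add: coinv_at_def pull_germ)
  then have "b \<otimes>\<^bsub>\<M> \<xi>\<^esub> germ V \<xi> (\<lambda>y. f y ^ ?n) \<in> coinv_at \<xi>"
    using b by (intro coinv_at_mult \<xi>V)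
  then show ?thesis using b h by (simp add: M.m_comm hol_in_mero)
qed


section \<open>Orbits\<close>

lemma orbitE:
  assumes "B \<in> orbs"
  obtains x where "x \<in> X" "B = (\<lambda>g. act g x) ` carrier K"
  using assms by (auto simp: orbits_def orbit_def)

lemma orbit_subset: "B \<in> orbs \<Longrightarrow> B \<subseteq> X"
  by (erule orbitE) (auto simp: X_stable)

lemma orbit_in: "B \<in> orbs \<Longrightarrow> x \<in> B \<Longrightarrow> x \<in> X"
  using orbit_subset by blast

lemma orbit_finite: "B \<in> orbs \<Longrightarrow> finite B"
  by (erule orbitE) (simp add: finite_group)

lemma orbit_nonempty: "B \<in> orbs \<Longrightarrow> \<exists>x. x \<in> B"
  by (erule orbitE) (use one_G_closed in blast)

lemma orbit_stable:
  assumes B: "B \<in> orbs" and g: "g \<in> carrier K" and y: "y \<in> carrier V"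
  shows "act (inv\<^bsub>K\<^esub> g) y \<in> B \<longleftrightarrow> y \<in> B"
proof -
  obtain x where x: "x \<in> X" "B = (\<lambda>g. act g x) ` carrier K" using B by (rule orbitE)
  have *: "act h z \<in> B" if "h \<in> carrier K" "z \<in> B" for h z
    using that x X_in by (auto simp: act_mult_G[symmetric])
  show ?thesis
    using *[of "inv\<^bsub>K\<^esub> g" y] *[of g "act (inv\<^bsub>K\<^esub> g) y"] g y by auto
qed

lemma orbit_transitive:
  assumes B: "B \<in> orbs" and y: "y \<in> B" and z: "z \<in> B"
  shows "\<exists>g\<in>carrier K. z = act g y"
proof -
  obtain x where x: "x \<in> X" "B = (\<lambda>g. act g x) ` carrier K" using B by (rule orbitE)
  obtain g h where "g \<in> carrier K" "y = act g x" "h \<in> carrier K" "z = act h x"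
    using x y z by blast
  then show ?thesis
    using x X_in by (intro bexI[of _ "h \<otimes>\<^bsub>K\<^esub> inv\<^bsub>K\<^esub> g"]) (simp_all add: act_mult_G)
qed

lemma orbit_of:
  assumes "\<xi> \<in> X"
  shows "orbit K act \<xi> \<in> orbs" "\<xi> \<in> orbit K act \<xi>"
proof -
  show "orbit K act \<xi> \<in> orbs" using assms by (auto simp: orbits_def)
  have "\<xi> = act \<one>\<^bsub>K\<^esub> \<xi>" using assms X_in by simp
  then show "\<xi> \<in> orbit K act \<xi>" unfolding orbit_def using one_G_closed by blast
qed

lemma Inv_orbit: "f \<in> Inv \<Longrightarrow> B \<in> orbs \<Longrightarrow> y \<in> B \<Longrightarrow> z \<in> B \<Longrightarrow> f y = f z"
  using orbit_transitive[of B y z] Inv_act[of f _ y] X_in[of y] orbit_in[of B y] by auto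

definition on :: "'v set \<Rightarrow> ('v \<Rightarrow> 'v germ) \<Rightarrow> 'v \<Rightarrow> 'v germ"
  where "on B F = (\<lambda>x\<in>carrier V. if x \<in> B then F x else \<zero>\<^bsub>\<M> x\<^esub>)"

lemma on_apply:
  "x \<in> carrier V \<Longrightarrow> x \<in> B \<Longrightarrow> on B F x = F x"
  "x \<in> carrier V \<Longrightarrow> x \<notin> B \<Longrightarrow> on B F x = \<zero>\<^bsub>\<M> x\<^esub>"
  by (simp_all add: on_def)

lemma on_in_S:
  assumes B: "B \<in> orbs" and F: "\<And>x. x \<in> B \<Longrightarrow> F x \<in> carrier (\<O> x)"
    and inv: "\<And>g x. g \<in> carrier K \<Longrightarrow> x \<in> B \<Longrightarrow> act_germ V K act g x (F (act (inv\<^bsub>K\<^esub> g) x)) = F x"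
  shows "on B F \<in> S"
proof -
  have BV: "x \<in> carrier V" if "x \<in> B" for x using that orbit_in[OF B] X_in by blast
  have hol: "on B F x \<in> carrier (\<O> x)" if "x \<in> carrier V" for x
    using that F by (cases "x \<in> B") (simp_all add: on_apply hol_zero_in)
  have "{x \<in> X. on B F x \<noteq> \<zero>\<^bsub>\<M> x\<^esub>} \<subseteq> B" using X_in by (auto simp: on_def)
  then have "finite {x \<in> X. on B F x \<noteq> \<zero>\<^bsub>\<M> x\<^esub>}" using orbit_finite[OF B] finite_subset by blast
  moreover have "on B F \<in> germ_families"
    using hol hol_in_mero by (auto simp: on_def PiE_iff)
  moreover have "on B F x = \<zero>\<^bsub>\<M> x\<^esub>" if "x \<in> carrier V - X" for x
    using that orbit_in[OF B] by (intro on_apply(2)) auto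
  ultimately have "on B F \<in> hol_sums" using hol X_in by (simp add: hol_sums_def)
  moreover have "act_germ V K act g y (on B F (act (inv\<^bsub>K\<^esub> g) y)) = on B F y"
    if g: "g \<in> carrier K" and y: "y \<in> carrier V" for g y
  proof (cases "y \<in> B")
    case True
    then show ?thesis using g y orbit_stable[OF B g y] inv by (simp add: on_apply)
  next
    case False
    then show ?thesis
      using g y orbit_stable[OF B g y] act_germ_zero[OF g y] by (simp add: on_apply)
  qed
  ultimately show ?thesis by (simp add: S_iff)
qed

lemma on_S: "B \<in> orbs \<Longrightarrow> s \<in> S \<Longrightarrow> on B s \<in> S"
  by (rule on_in_S) (simp_all add: S_hol orbit_in S_act X_in)

abbreviation const_on where "const_on B c \<equiv> on B (\<lambda>x. germ V x (\<lambda>_. c))"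

lemma act_germ_const:
  "g \<in> carrier K \<Longrightarrow> x \<in> carrier V \<Longrightarrow>
    act_germ V K act g x (germ V (act (inv\<^bsub>K\<^esub> g) x) (\<lambda>_. c)) = germ V x (\<lambda>_. c)"
  by (simp add: act_germ_germ)

lemma const_on_S: "B \<in> orbs \<Longrightarrow> const_on B c \<in> S"
  by (rule on_in_S) (simp_all add: hol_germsI hol_at_const orbit_in X_in act_germ_const)

lemma const_class_eq: "const_class V K act X B c = cls (const_on B c)"
  by (simp add: const_class_def on_def)

lemma const_on_value: "B \<in> orbs \<Longrightarrow> \<xi> \<in> B \<Longrightarrow> germ_value V \<xi> (const_on B c \<xi>) = c"
  by (simp add: on_apply orbit_in X_in germ_value_germ hol_at_const)

lemma cls_in_part:
  assumes "s \<in> S" "\<And>x. x \<in> X \<Longrightarrow> x \<notin> B \<Longrightarrow> s x = \<zero>\<^bsub>\<M> x\<^esub>"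
  shows "cls s \<in> part B"
  using assms by (simp add: orbit_part_def cls_in cls_apply fibre_one X_in)

lemma cls_on_in_part: "B \<in> orbs \<Longrightarrow> on B F \<in> S \<Longrightarrow> cls (on B F) \<in> part B"
  by (rule cls_in_part) (simp_all add: on_apply X_in)

text \<open>
  Germs in the kernel have value zero, so values are defined on classes.
\<close>

lemma cls_value:
  assumes "s \<in> S" "t \<in> S" "cls s = cls t" "\<xi> \<in> X"
  shows "germ_value V \<xi> (s \<xi>) = germ_value V \<xi> (t \<xi>)"
proof -
  have \<xi>V: "\<xi> \<in> carrier V" using assms(4) by (rule X_in)
  interpret M: cring "\<M> \<xi>" using cring_mero_germs[OF \<xi>V] .
  have h: "s \<xi> \<in> carrier (\<O> \<xi>)" "t \<xi> \<in> carrier (\<O> \<xi>)" using assms by (simp_all add: S_hol)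
  have d: "s \<xi> \<ominus>\<^bsub>\<M> \<xi>\<^esub> t \<xi> \<in> coinv_at \<xi>" using assms cls_eq_iff by blast
  have "s \<xi> = (s \<xi> \<ominus>\<^bsub>\<M> \<xi>\<^esub> t \<xi>) \<oplus>\<^bsub>\<M> \<xi>\<^esub> t \<xi>"
    using h by (simp add: M.minus_eq M.a_assoc M.l_neg hol_in_mero)
  then have "germ_value V \<xi> (s \<xi>) = germ_value V \<xi> (s \<xi> \<ominus>\<^bsub>\<M> \<xi>\<^esub> t \<xi>) + germ_value V \<xi> (t \<xi>)"
    using germ_value_add[OF \<xi>V coinv_at_hol[OF d] h(2)] by simp
  then show ?thesis using coinv_at_value[OF \<xi>V d] by simp
qed


section \<open>Submodules\<close>

lemma submodule_subset: "submodule A' N \<Longrightarrow> N \<subseteq> carrier M"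
  unfolding submodule_of_def using subgroup.subset by blast

lemma submodule_act:
  "submodule A' N \<Longrightarrow> A' \<subseteq> A \<Longrightarrow> a \<in> A' \<Longrightarrow> s \<in> S \<Longrightarrow> cls s \<in> N \<Longrightarrow> cls (skew_apply V a s) \<in> N"
  using quot_act_cls unfolding submodule_of_def by fastforce

lemma submodule_add:
  "submodule A' N \<Longrightarrow> s \<in> S \<Longrightarrow> t \<in> S \<Longrightarrow> cls s \<in> N \<Longrightarrow> cls t \<in> N \<Longrightarrow> cls (s \<uplus> t) \<in> N"
  unfolding submodule_of_def using cls_mult subgroup.m_closed by metis

lemma submodule_fmul:
  "submodule A N \<Longrightarrow> f \<in> Inv \<Longrightarrow> s \<in> S \<Longrightarrow> cls s \<in> N \<Longrightarrow> cls (fmul f s) \<in> N"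
  using submodule_act[of A N "emb f" s] emb_A[of f] by (simp add: fmul_def)

lemma submodule_H0: "submodule A N \<Longrightarrow> submodule (H0 V K act) N"
  unfolding submodule_of_def using H0_subset by blast

lemma inv_cls: "s \<in> S \<Longrightarrow> inv\<^bsub>M\<^esub> cls s = cls (scale (-1) s)"
proof (rule group.inv_equality[OF group_M])
  assume s: "s \<in> S"
  then show "cls (scale (-1) s) \<otimes>\<^bsub>M\<^esub> cls s = \<one>\<^bsub>M\<^esub>"
    by (simp add: cls_mult scale_in_S scale_minus_one_add cls_zero)
qed (simp_all add: cls_in scale_in_S)

lemma scale_fmul:
  assumes "f \<in> Inv" "s \<in> S"
  shows "scale c (fmul f s) = fmul (\<lambda>x. c * f x) s"
proof (rule family_eqI)
  fix y assume y: "y \<in> carrier V"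
  interpret M: cring "\<M> y" using cring_mero_germs[OF y] .
  have m: "germ V y f \<in> carrier (\<M> y)" "germ V y (\<lambda>_. c) \<in> carrier (\<M> y)" "s y \<in> carrier (\<M> y)"
    using assms y
    by (simp_all add: mero_germsI hol_at_imp_mero_at Inv_hol_at mero_at_const family_apply_in S_family)
  have "fmul (\<lambda>x. c * f x) s y = (germ V y (\<lambda>_. c) \<otimes>\<^bsub>\<M> y\<^esub> germ V y f) \<otimes>\<^bsub>\<M> y\<^esub> s y"
    using assms y by (simp add: fmul_apply S_family Inv_mult Inv_const germ_mult)
  then show "scale c (fmul f s) y = fmul (\<lambda>x. c * f x) s y"
    using assms y m by (simp add: scale_apply fmul_apply S_family M.m_ac)
qed (use assms in \<open>simp_all add: S_family fmul_in_S Inv_mult Inv_const scale_in_S\<close>)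

text \<open>
  For a constant section \<open>s\<close> this presents the part over an orbit as a quotient of the ring of
  invariant functions.
\<close>

lemma submodule_H0_cyclic:
  assumes s: "s \<in> S"
  shows "submodule (H0 V K act) ((\<lambda>f. cls (fmul f s)) ` Inv)"
  unfolding submodule_of_def
proof (intro conjI ballI)
  show "subgroup ((\<lambda>f. cls (fmul f s)) ` Inv) M"
  proof (rule group.subgroupI[OF group_M])
    show "(\<lambda>f. cls (fmul f s)) ` Inv \<subseteq> carrier M" using s by (auto intro: cls_in fmul_in_S)
    show "(\<lambda>f. cls (fmul f s)) ` Inv \<noteq> {}" using Inv_const by blast
    show "inv\<^bsub>M\<^esub> t \<in> (\<lambda>f. cls (fmul f s)) ` Inv" if t: "t \<in> (\<lambda>f. cls (fmul f s)) ` Inv" for t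
    proof -
      obtain f where f: "f \<in> Inv" "t = cls (fmul f s)" using t by blast
      have "inv\<^bsub>M\<^esub> t = cls (fmul (\<lambda>x. (-1) * f x) s)"
        unfolding f(2) inv_cls[OF fmul_in_S[OF f(1) s]] scale_fmul[OF f(1) s] ..
      then show ?thesis using Inv_mult[OF Inv_const f(1)] by blast
    qed
    show "t \<otimes>\<^bsub>M\<^esub> u \<in> (\<lambda>f. cls (fmul f s)) ` Inv"
      if t: "t \<in> (\<lambda>f. cls (fmul f s)) ` Inv" and u: "u \<in> (\<lambda>f. cls (fmul f s)) ` Inv" for t u
    proof -
      obtain f where f: "f \<in> Inv" "t = cls (fmul f s)" using t by blast
      obtain h where h: "h \<in> Inv" "u = cls (fmul h s)" using u by blast
      have "t \<otimes>\<^bsub>M\<^esub> u = cls (fmul (\<lambda>x. f x + h x) s)"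
        using f h s by (simp add: cls_mult fmul_in_S fmul_add)
      then show ?thesis using Inv_add[OF f(1) h(1)] by blast
    qed
  qed
  fix a t assume "a \<in> H0 V K act" and t: "t \<in> (\<lambda>f. cls (fmul f s)) ` Inv"
  then obtain h where h: "h \<in> Inv" "a = emb h" by (auto simp: H0_def emb_def)
  obtain f where f: "f \<in> Inv" "t = cls (fmul f s)" using t by blast
  have "quot_act V K act X a t = cls (fmul h (fmul f s))"
    using f h s by (simp add: quot_act_cls emb_A fmul_in_S fmul_def[symmetric])
  also have "\<dots> = cls (fmul (\<lambda>x. h x * f x) s)"
    using f h s by (simp add: fmul_fmul)
  finally show "quot_act V K act X a t \<in> (\<lambda>f. cls (fmul f s)) ` Inv"
    using Inv_mult[OF h(1) f(1)] by blast
qed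

lemma submodule_carrier: "submodule A (carrier M)"
  unfolding submodule_of_def
proof (intro conjI ballI)
  show "subgroup (carrier M) M" using group.subgroup_self[OF group_M] .
  fix a t assume "a \<in> A" "t \<in> carrier M"
  then obtain s where "s \<in> S" "t = cls s" using cls_surj by blast
  then show "quot_act V K act X a t \<in> carrier M"
    using \<open>a \<in> A\<close> by (simp add: quot_act_cls cls_in A_preserves)
qed

text \<open>
  The module is the sum of its orbit parts: splitting off the component on one orbit makes the support
  smaller.
\<close>

lemma submodule_eq_carrier:
  assumes N: "submodule A N" and parts: "\<And>B. B \<in> orbs \<Longrightarrow> part B \<subseteq> N"
  shows "N = carrier M"
proof -
  have "cls s \<in> N" if "s \<in> S" for s
    using that
  proof (induction "card {x \<in> X. s x \<noteq> \<zero>\<^bsub>\<M> x\<^esub>}" arbitrary: s rule: less_induct)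
    case less
    note s = less.prems
    show ?case
    proof (cases "{x \<in> X. s x \<noteq> \<zero>\<^bsub>\<M> x\<^esub>} = {}")
      case True
      have "s = \<zero>\<^bsub>mero_ring V\<^esub>"
      proof (rule family_eqI)
        fix x assume x: "x \<in> carrier V"
        show "s x = \<zero>\<^bsub>mero_ring V\<^esub> x"
          using True x hol_sumsD(3)[OF S_hol_sums[OF s] x]
          by (cases "x \<in> X") (auto simp: section_zero_apply)
      qed (use s in \<open>simp_all add: S_family family_zero_in\<close>)
      then show ?thesis
        using N subgroup.one_closed unfolding submodule_of_def by (metis cls_zero)
    next
      case False
      then obtain \<xi> where \<xi>: "\<xi> \<in> X" "s \<xi> \<noteq> \<zero>\<^bsub>\<M> \<xi>\<^esub>" by blast
      define B where "B = orbit K act \<xi>"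
      have B: "B \<in> orbs" "\<xi> \<in> B" using orbit_of[OF \<xi>(1)] by (simp_all add: B_def)
      let ?t = "diff s (on B s)"
      have onB: "on B s \<in> S" using B(1) s by (rule on_S)
      have t: "?t \<in> S" using s onB by (rule diff_in_S)
      have tB: "?t x = \<zero>\<^bsub>\<M> x\<^esub>" if "x \<in> X" "x \<in> B \<or> s x = \<zero>\<^bsub>\<M> x\<^esub>" for x
      proof -
        have x: "x \<in> carrier V" using that X_in by simp
        interpret M: cring "\<M> x" using cring_mero_germs[OF x] .
        show ?thesis
          using that x S_family[OF s] S_family[OF onB]
          by (cases "x \<in> B") (simp_all add: diff_apply on_apply family_apply_in M.minus_eq M.r_neg)
      qed
      have "{x \<in> X. ?t x \<noteq> \<zero>\<^bsub>\<M> x\<^esub>} \<subset> {x \<in> X. s x \<noteq> \<zero>\<^bsub>\<M> x\<^esub>}"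
        using tB \<xi> B(2) by blast
      then have "card {x \<in> X. ?t x \<noteq> \<zero>\<^bsub>\<M> x\<^esub>} < card {x \<in> X. s x \<noteq> \<zero>\<^bsub>\<M> x\<^esub>}"
        using hol_sumsD(4)[OF S_hol_sums[OF s]] by (intro psubset_card_mono)
      then have "cls ?t \<in> N" using less.hyps t by blast
      moreover have "cls (on B s) \<in> N"
        using parts[OF B(1)] cls_on_in_part[OF B(1) onB] by blast
      ultimately have "cls (?t \<uplus> on B s) \<in> N"
        using submodule_add[OF N t onB] by blast
      moreover have "?t \<uplus> on B s = s"
      proof (rule family_eqI)
        fix x assume x: "x \<in> carrier V"
        interpret M: cring "\<M> x" using cring_mero_germs[OF x] .
        show "(?t \<uplus> on B s) x = s x"
          using x S_family[OF s] S_family[OF onB]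
          by (simp add: family_add_apply diff_apply family_apply_in M.minus_eq M.a_assoc M.l_neg)
      qed (use s t onB in \<open>simp_all add: S_family family_add_in\<close>)
      ultimately show ?thesis by simp
    qed
  qed
  then show ?thesis using submodule_subset[OF N] cls_surj by blast
qed

end

lemma ex1_maximal_in_if_greatest:
  assumes "N \<in> \<S>" "\<And>N'. N' \<in> \<S> \<Longrightarrow> N' \<subseteq> N"
  shows "\<exists>!N. maximal_in \<S> N"
proof (rule ex1I)
  show "maximal_in \<S> N"
    using assms unfolding maximal_in_def by (blast dest: subset_antisym)
  show "N' = N" if "maximal_in \<S> N'" for N'
    using that assms unfolding maximal_in_def by metis
qed

section \<open>Maximal submodules\<close>

locale separating_algebra = preserving_algebra K V act X A
  for K :: "('g, 'k) monoid_scheme" and V :: "('v, 'n::finite) lie_data"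
    and act :: "'g \<Rightarrow> 'v \<Rightarrow> 'v" and X :: "'v set" and A :: "('v \<Rightarrow> 'v \<Rightarrow> 'v germ) set" +
  assumes separates: "B \<in> orbits K X act \<Longrightarrow> C \<in> orbits K X act \<Longrightarrow> B \<noteq> C \<Longrightarrow> x \<in> B \<Longrightarrow> y \<in> C \<Longrightarrow>
      \<exists>f\<in>invariant_hol_funs V K act. f x \<noteq> f y"
    and const_generated: "B \<in> orbits K X act \<Longrightarrow> \<exists>c. c \<noteq> 0 \<and>
      orbit_part V K act X B = submodule_gen V K act X (H0 V K act) {const_class V K act X B c}"
begin

text \<open>
  The cyclic generator \<open>c\<close> of an orbit part is recovered from any \<open>s\<close> with non-zero value on the
  orbit. A product \<open>p\<close> of \<open>n\<close>-th powers, with \<open>n\<close> the order of the group, kills the finitely many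
  other orbits in the support of \<open>s\<close>, so that \<open>p s = p f c\<close> for some invariant \<open>f\<close>. After
  normalisation \<open>w = p f\<close> has the value \<open>1\<close> on the orbit, hence \<open>(1 - w)\<^sup>n\<close> kills \<open>c\<close>, and
  \<open>1 - (1 - w)\<^sup>n\<close> is a multiple of \<open>w\<close>.
\<close>

lemma part_subset_if_value:
  assumes N: "submodule A N" and s: "s \<in> S" and sN: "cls s \<in> N"
    and B: "B \<in> orbs" and \<xi>: "\<xi> \<in> B" and val: "germ_value V \<xi> (s \<xi>) \<noteq> 0"
  shows "part B \<subseteq> N"
proof -
  define n where "n = card (carrier K)"
  obtain c where c: "c \<noteq> 0"
    "part B = submodule_gen V K act X (H0 V K act) {cls (const_on B c)}"
    using const_generated[OF B] by (auto simp: const_class_eq)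
  let ?c = "const_on B c"
  have cS: "?c \<in> S" using B by (rule const_on_S)
  have \<xi>X: "\<xi> \<in> X" using orbit_in[OF B \<xi>] .
  have onB: "on B s \<in> S" using B s by (rule on_S)
  have "part B \<subseteq> (\<lambda>f. cls (fmul f ?c)) ` Inv"
    unfolding c(2) submodule_gen_def
    using submodule_H0_cyclic[OF cS] Inv_const[of 1] fmul_one[OF cS]
    by (intro Inter_lower CollectI conjI) (simp_all add: image_iff, metis)
  then obtain f where f: "f \<in> Inv" "cls (on B s) = cls (fmul f ?c)"
    using cls_on_in_part[OF B onB] by blast
  have "germ_value V \<xi> (on B s \<xi>) = f \<xi> * c"
    using cls_value[OF onB fmul_in_S[OF f(1) cS] f(2) \<xi>X] fmul_value[OF f(1) cS \<xi>X]
      const_on_value[OF B \<xi>] by simp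
  then have f\<xi>: "f \<xi> \<noteq> 0" using val \<xi> X_in[OF \<xi>X] by (auto simp: on_apply)
  \<comment> \<open>separation gives, for each of these points, an invariant function with value \<open>0\<close> there and \<open>1\<close> on \<open>B\<close>\<close>
  define T where "T = {\<eta> \<in> X. s \<eta> \<noteq> \<zero>\<^bsub>\<M> \<eta>\<^esub>} - B"
  have T_fin: "finite T" using hol_sumsD(4)[OF S_hol_sums[OF s]] by (simp add: T_def)
  have "\<exists>k\<in>Inv. k \<eta> = 0 \<and> k \<xi> = 1" if \<eta>: "\<eta> \<in> T" for \<eta>
  proof -
    have \<eta>X: "\<eta> \<in> X" and \<eta>B: "\<eta> \<notin> B" using \<eta> by (auto simp: T_def)
    obtain k where k: "k \<in> Inv" "k \<xi> \<noteq> k \<eta>"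
      using separates[OF B orbit_of(1)[OF \<eta>X] _ \<xi> orbit_of(2)[OF \<eta>X]] orbit_of(2)[OF \<eta>X] \<eta>B by blast
    have "(\<lambda>x. (1 / (k \<xi> - k \<eta>)) * (k x - k \<eta>)) \<in> Inv"
      by (intro Inv_mult Inv_minus Inv_const k(1))
    then show ?thesis using k(2) by (intro bexI) auto
  qed
  then obtain k where k: "\<And>\<eta>. \<eta> \<in> T \<Longrightarrow> k \<eta> \<in> Inv" "\<And>\<eta>. \<eta> \<in> T \<Longrightarrow> k \<eta> \<eta> = 0"
    "\<And>\<eta>. \<eta> \<in> T \<Longrightarrow> k \<eta> \<xi> = 1"
    by metis
  define p where "p = (\<lambda>x. \<Prod>\<eta>\<in>T. k \<eta> x ^ n)"
  have p: "p \<in> Inv" unfolding p_def by (intro Inv_prod Inv_power k(1))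
  have p\<xi>: "p \<xi> = 1" unfolding p_def using k(3) by simp
  have "cls (fmul p s) = cls (fmul p (on B s))"
  proof (subst cls_eq_iff[OF fmul_in_S[OF p s] fmul_in_S[OF p onB]], intro ballI)
    fix \<eta> assume \<eta>X: "\<eta> \<in> X"
    then have \<eta>V: "\<eta> \<in> carrier V" by (rule X_in)
    interpret M: cring "\<M> \<eta>" using cring_mero_germs[OF \<eta>V] .
    have pm: "germ V \<eta> p \<in> carrier (\<M> \<eta>)"
      using p \<eta>V by (simp add: mero_germsI hol_at_imp_mero_at Inv_hol_at)
    have sm: "s \<eta> \<in> carrier (\<M> \<eta>)" using S_family[OF s] \<eta>V by (rule family_apply_in)
    show "fmul p s \<eta> \<ominus>\<^bsub>\<M> \<eta>\<^esub> fmul p (on B s) \<eta> \<in> coinv_at \<eta>"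
    proof (cases "\<eta> \<in> B")
      case True
      then show ?thesis
        using \<eta>V p pm sm by (simp add: fmul_apply S_family s onB on_apply M.minus_eq M.r_neg coinv_at_zero)
    next
      case False
      have "germ V \<eta> p \<otimes>\<^bsub>\<M> \<eta>\<^esub> s \<eta> \<in> coinv_at \<eta>"
      \<comment> \<open>the factor \<open>k \<eta>\<close> of \<open>p\<close> is nilpotent on the fibre at \<open>\<eta>\<close>\<close>
      proof (cases "\<eta> \<in> T")
        case True
        let ?q = "\<lambda>x. \<Prod>\<zeta>\<in>T - {\<eta>}. k \<zeta> x ^ n"
        have q: "?q \<in> Inv" by (intro Inv_prod Inv_power k(1)) simp
        have "germ V \<eta> p = germ V \<eta> (\<lambda>y. k \<eta> y ^ n) \<otimes>\<^bsub>\<M> \<eta>\<^esub> germ V \<eta> ?q"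
          using True T_fin \<eta>V by (simp add: p_def germ_mult prod.remove)
        moreover have "germ V \<eta> (\<lambda>y. k \<eta> y ^ n) \<otimes>\<^bsub>\<M> \<eta>\<^esub> (germ V \<eta> ?q \<otimes>\<^bsub>\<M> \<eta>\<^esub> s \<eta>) \<in> coinv_at \<eta>"
          unfolding n_def using q \<eta>V S_hol[OF s \<eta>X]
          by (intro power_kills_fibre[OF k(1)[OF True] \<eta>X k(2)[OF True]] hol_mult_in hol_germsI Inv_hol_at)
            (simp_all add: n_def)
        moreover have "germ V \<eta> (\<lambda>y. k \<eta> y ^ n) \<in> carrier (\<M> \<eta>)" "germ V \<eta> ?q \<in> carrier (\<M> \<eta>)"
          using q Inv_power[OF k(1)[OF True]] \<eta>V
          by (simp_all add: mero_germsI hol_at_imp_mero_at Inv_hol_at)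
        ultimately show ?thesis using sm by (simp add: M.m_assoc)
      next
        case False
        then have "s \<eta> = \<zero>\<^bsub>\<M> \<eta>\<^esub>" using \<open>\<eta> \<notin> B\<close> \<eta>X by (simp add: T_def)
        then show ?thesis using pm \<eta>V by (simp add: coinv_at_zero)
      qed
      moreover have "germ V \<eta> p \<otimes>\<^bsub>\<M> \<eta>\<^esub> s \<eta> \<in> carrier (\<M> \<eta>)" using pm sm by simp
      ultimately show ?thesis
        using False \<eta>V p pm sm
        by (simp add: fmul_apply S_family s onB on_apply M.minus_eq)
    qed
  qed
  also have "\<dots> = cls (fmul p (fmul f ?c))"
    by (rule fmul_cls_cong[OF p onB fmul_in_S[OF f(1) cS] f(2)])
  finally have ps: "cls (fmul p s) = cls (fmul p (fmul f ?c))" .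
  define w where "w = (\<lambda>x. (1 / f \<xi>) * (p x * f x))"
  have w: "w \<in> Inv" unfolding w_def by (intro Inv_mult Inv_const p f(1))
  have w\<xi>: "w \<xi> = 1" using p\<xi> f\<xi> by (simp add: w_def)
  \<comment> \<open>\<open>v\<close> vanishes on \<open>B\<close>, and the geometric sum \<open>q\<close> inverts \<open>w = 1 - v\<close> up to \<open>v\<^sup>n\<close>\<close>
  define v where "v = (\<lambda>x. 1 - w x)"
  have v: "v \<in> Inv" unfolding v_def by (intro Inv_minus Inv_const w)
  define q where "q = (\<lambda>x. (1 / f \<xi>) * (\<Sum>i<n. v x ^ i))"
  have q: "q \<in> Inv" unfolding q_def by (intro Inv_mult Inv_sum Inv_power Inv_const v)
  have qpf: "q x * (p x * f x) = 1 - v x ^ n" for x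
  proof -
    have "1 - v x ^ n = w x * (\<Sum>i<n. v x ^ i)"
      using one_diff_power_eq[of "v x" n] by (simp add: v_def)
    then show ?thesis by (simp add: q_def w_def)
  qed
  have "cls (fmul q (fmul p s)) \<in> N"
    by (intro submodule_fmul[OF N] q fmul_in_S p s sN)
  also have "cls (fmul q (fmul p s)) = cls (fmul q (fmul p (fmul f ?c)))"
    by (rule fmul_cls_cong[OF q fmul_in_S[OF p s] _ ps]) (intro fmul_in_S p f(1) cS)
  also have "fmul q (fmul p (fmul f ?c)) = fmul (\<lambda>x. 1 - v x ^ n) ?c"
    using p f(1) q cS by (simp add: fmul_fmul Inv_mult fmul_in_S qpf)
  also have "cls (fmul (\<lambda>x. 1 - v x ^ n) ?c) = cls ?c"
  proof -
    have I: "(\<lambda>x. 1 - v x ^ n) \<in> Inv" by (intro Inv_minus Inv_const Inv_power v)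
    show ?thesis
    proof (subst cls_eq_iff[OF fmul_in_S[OF I cS] cS], intro ballI)
      fix \<eta> assume \<eta>X: "\<eta> \<in> X"
      then have \<eta>V: "\<eta> \<in> carrier V" by (rule X_in)
      interpret M: cring "\<M> \<eta>" using cring_mero_germs[OF \<eta>V] .
      have Im: "germ V \<eta> (\<lambda>x. 1 - v x ^ n) \<in> carrier (\<M> \<eta>)"
        using I \<eta>V by (simp add: mero_germsI hol_at_imp_mero_at Inv_hol_at)
      show "fmul (\<lambda>x. 1 - v x ^ n) ?c \<eta> \<ominus>\<^bsub>\<M> \<eta>\<^esub> ?c \<eta> \<in> coinv_at \<eta>"
      proof (cases "\<eta> \<in> B")
        case True
        have "v \<eta> = 0" using Inv_orbit[OF v B True \<xi>] w\<xi> by (simp add: v_def)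
        then have "germ V \<eta> (\<lambda>y. v y ^ card (carrier K)) \<otimes>\<^bsub>\<M> \<eta>\<^esub> germ V \<eta> (\<lambda>_. - c) \<in> coinv_at \<eta>"
          by (intro power_kills_fibre[OF v \<eta>X] hol_germsI hol_at_const \<eta>V)
        then show ?thesis
          using True \<eta>V I cS
          by (simp add: fmul_apply S_family on_apply germ_mult germ_add M.minus_eq germ_uminus
              mero_at_const n_def left_diff_distrib)
      next
        case False
        then show ?thesis
          using \<eta>V I cS Im by (simp add: fmul_apply S_family on_apply M.minus_eq coinv_at_zero)
      qed
    qed
  qed
  finally have cN: "cls ?c \<in> N" .
  then show ?thesis
    unfolding c(2) submodule_gen_def using submodule_H0[OF N] by (intro Inter_lower) simp
qed

lemma part_subset_iff:
  assumes N: "submodule A N" and B: "B \<in> orbs" and \<xi>: "\<xi> \<in> B"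
  shows "part B \<subseteq> N \<longleftrightarrow> (\<exists>s\<in>S. cls s \<in> N \<and> germ_value V \<xi> (s \<xi>) \<noteq> 0)"
proof
  assume "part B \<subseteq> N"
  then have "cls (const_on B 1) \<in> N"
    using cls_on_in_part[OF B const_on_S[OF B]] by blast
  then show "\<exists>s\<in>S. cls s \<in> N \<and> germ_value V \<xi> (s \<xi>) \<noteq> 0"
    using const_on_S[OF B] const_on_value[OF B \<xi>] by (intro bexI[of _ "const_on B 1"]) auto
qed (use part_subset_if_value[OF N _ _ B \<xi>] in blast)

text \<open>
  The submodules that do not contain the part of \<open>B\<close> are those on which the value at a point of
  \<open>B\<close> vanishes, and the elements whose whole orbit under the algebra has value zero form the
  largest such submodule.
\<close>

lemma ex1_maximal_not_containing_part:
  assumes B: "B \<in> orbs"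
  shows "\<exists>!N. maximal_in {N. submodule A N \<and> \<not> part B \<subseteq> N} N"
proof -
  obtain \<xi> where \<xi>: "\<xi> \<in> B" using orbit_nonempty[OF B] by blast
  have \<xi>X: "\<xi> \<in> X" using orbit_in[OF B \<xi>] .
  have \<xi>V: "\<xi> \<in> carrier V" using \<xi>X by (rule X_in)
  let ?v = "\<lambda>s. germ_value V \<xi> (s \<xi>)"
  \<comment> \<open>closed under the algebra because the algebra is closed under products\<close>
  define Z where "Z = {s \<in> S. \<forall>a\<in>A. ?v (skew_apply V a s) = 0}"
  have Z_val: "?v s = 0" if "s \<in> Z" for s
  proof -
    have "fmul (\<lambda>_. 1) s = s" using that by (simp add: Z_def fmul_one)
    then show ?thesis using that emb_A[OF Inv_const[of 1]] by (auto simp: Z_def fmul_def)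
  qed
  have sub: "submodule A (cls ` Z)"
    unfolding submodule_of_def
  proof (intro conjI ballI)
    show "subgroup (cls ` Z) M"
    proof (rule group.subgroupI[OF group_M])
      show "cls ` Z \<subseteq> carrier M" by (auto simp: Z_def cls_in)
      have "skew_apply V a \<zero>\<^bsub>mero_ring V\<^esub> \<xi> \<in> coinv_at \<xi>" if "a \<in> A" for a
        by (rule kernel_stable[OF S_zero _ that \<xi>X]) (simp add: section_zero_apply X_in coinv_at_zero)
      then have "\<zero>\<^bsub>mero_ring V\<^esub> \<in> Z"
        using S_zero \<xi>V by (simp add: Z_def coinv_at_value)
      then show "cls ` Z \<noteq> {}" by blast
      show "inv\<^bsub>M\<^esub> t \<in> cls ` Z" if t: "t \<in> cls ` Z" for t
      proof -
        obtain s where s: "s \<in> Z" "t = cls s" using t by blast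
        have sS: "s \<in> S" using s by (simp add: Z_def)
        have "?v (skew_apply V a (scale (-1) s)) = 0" if a: "a \<in> A" for a
        proof -
          have as: "skew_apply V a s \<in> S" using A_preserves a sS .
          have "?v (skew_apply V a s) = 0" using s a by (simp add: Z_def)
          then show ?thesis
            using as sS a \<xi>V by (simp add: skew_apply_scale A_in S_family scale_apply
                germ_value_mult S_hol \<xi>X hol_germsI hol_at_const)
        qed
        then have "scale (-1) s \<in> Z" using sS by (simp add: Z_def scale_in_S)
        then show ?thesis using sS by (simp add: s(2) inv_cls)
      qed
      show "t \<otimes>\<^bsub>M\<^esub> u \<in> cls ` Z" if t: "t \<in> cls ` Z" and u: "u \<in> cls ` Z" for t u
      proof -
        obtain s r where s: "s \<in> Z" "t = cls s" "r \<in> Z" "u = cls r" using t u by blast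
        have sS: "s \<in> S" "r \<in> S" using s by (simp_all add: Z_def)
        have "?v (skew_apply V a (s \<uplus> r)) = 0" if a: "a \<in> A" for a
        proof -
          have "?v (skew_apply V a s) = 0" "?v (skew_apply V a r) = 0" using s a by (simp_all add: Z_def)
          then show ?thesis
            using sS a \<xi>V by (simp add: skew_apply_add A_in S_family family_add_apply
                germ_value_add S_hol \<xi>X A_preserves)
        qed
        then have "s \<uplus> r \<in> Z" using sS by (simp add: Z_def S_add)
        then show ?thesis using sS by (simp add: s(2,4) cls_mult)
      qed
    qed
    fix b t assume b: "b \<in> A" and "t \<in> cls ` Z"
    then obtain s where s: "s \<in> Z" "t = cls s" by blast
    have sS: "s \<in> S" using s by (simp add: Z_def)
    have "?v (skew_apply V a (skew_apply V b s)) = 0" if a: "a \<in> A" for a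
    proof -
      have ab: "a \<otimes>\<^bsub>skew_ring V\<^esub> b \<in> A" using A_mult a b .
      have "skew_apply V a (skew_apply V b s) = skew_apply V (a \<otimes>\<^bsub>skew_ring V\<^esub> b) s"
        using a b ab sS by (simp add: skew_apply_mult A_in S_family)
      then show ?thesis using s ab by (simp add: Z_def)
    qed
    then have "skew_apply V b s \<in> Z" using sS b by (simp add: Z_def A_preserves)
    then show "quot_act V K act X b t \<in> cls ` Z" using sS b by (simp add: s(2) quot_act_cls)
  qed
  have "\<not> part B \<subseteq> cls ` Z"
  proof
    assume "part B \<subseteq> cls ` Z"
    then obtain r where r: "r \<in> S" "cls r \<in> cls ` Z" "?v r \<noteq> 0"
      using part_subset_iff[OF sub B \<xi>] by blast
    then obtain s where s: "s \<in> Z" "cls r = cls s" by blast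
    have "s \<in> S" using s(1) by (simp add: Z_def)
    then show False
      using cls_value[OF r(1) _ s(2) \<xi>X] r(3) Z_val[OF s(1)] by simp
  qed
  moreover have "N \<subseteq> cls ` Z" if N: "submodule A N" "\<not> part B \<subseteq> N" for N
  proof
    fix t assume t: "t \<in> N"
    then obtain s where s: "s \<in> S" "t = cls s" using cls_surj submodule_subset[OF N(1)] by blast
    have "?v (skew_apply V a s) = 0" if a: "a \<in> A" for a
    proof (rule ccontr)
      assume "?v (skew_apply V a s) \<noteq> 0"
      moreover have "cls (skew_apply V a s) \<in> N"
        using submodule_act[OF N(1) _ a s(1)] t s(2) by simp
      ultimately show False
        using N part_subset_iff[OF N(1) B \<xi>] A_preserves[OF a s(1)] by blast
    qed
    then show "t \<in> cls ` Z" using s by (simp add: Z_def)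
  qed
  ultimately show ?thesis
    using sub by (intro ex1_maximal_in_if_greatest[of "cls ` Z"]) auto
qed

end

section \<open>Arrows of the graph\<close>

lemma (in abelian_monoid) finsum_Times:
  assumes "finite A" "finite B" "\<And>i j. i \<in> A \<Longrightarrow> j \<in> B \<Longrightarrow> f (i, j) \<in> carrier G"
  shows "finsum G f (A \<times> B) = finsum G (\<lambda>i. finsum G (\<lambda>j. f (i, j)) B) A"
  using assms(1,3)
proof (induction A rule: finite_induct)
  case empty
  show ?case by simp
next
  case (insert a A)
  have "finsum G f (insert a A \<times> B) = finsum G f (Pair a ` B \<union> A \<times> B)"
    by (rule arg_cong[where f = "finsum G f"]) auto
  also have "\<dots> = finsum G f (Pair a ` B) \<oplus> finsum G f (A \<times> B)"
    using insert.hyps insert.prems assms(2) by (intro finsum_Un_disjoint) auto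
  also have "finsum G f (Pair a ` B) = finsum G (\<lambda>j. f (a, j)) B"
    using insert.prems by (intro finsum_reindex) (auto simp: inj_on_def)
  also have "finsum G f (A \<times> B) = finsum G (\<lambda>i. finsum G (\<lambda>j. f (i, j)) B) A"
    using insert by simp
  also have "finsum G (\<lambda>j. f (a, j)) B \<oplus> finsum G (\<lambda>i. finsum G (\<lambda>j. f (i, j)) B) A =
      finsum G (\<lambda>i. finsum G (\<lambda>j. f (i, j)) B) (insert a A)"
    using insert.hyps insert.prems by (intro finsum_insert[symmetric]) (auto intro!: finsum_closed)
  finally show ?case .
qed

lemma (in abelian_monoid) finsum_triple:
  assumes "finite A" "finite B" "finite C"
    and f: "\<And>i j k. i \<in> A \<Longrightarrow> j \<in> B \<Longrightarrow> k \<in> C \<Longrightarrow> f i j k \<in> carrier G"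
  shows "finsum G (\<lambda>k. finsum G (\<lambda>j. finsum G (\<lambda>i. f i j k) A) B) C =
    finsum G (\<lambda>(i, j, k). f i j k) (A \<times> B \<times> C)"
proof -
  have "finsum G (\<lambda>(i, j, k). f i j k) (A \<times> B \<times> C) =
      finsum G (\<lambda>i. finsum G (\<lambda>(j, k). f i j k) (B \<times> C)) A"
    using assms by (subst finsum_Times) auto
  also have "\<dots> = finsum G (\<lambda>i. finsum G (\<lambda>j. finsum G (\<lambda>k. f i j k) C) B) A"
    using assms by (intro finsum_cong') (auto intro!: finsum_closed simp: finsum_Times)
  also have "\<dots> = finsum G (\<lambda>i. finsum G (\<lambda>k. finsum G (\<lambda>j. f i j k) B) C) A"
    using assms by (intro finsum_cong' finsum_swap) (auto intro!: finsum_closed)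
  also have "\<dots> = finsum G (\<lambda>k. finsum G (\<lambda>i. finsum G (\<lambda>j. f i j k) B) A) C"
    using assms by (intro finsum_swap) (auto intro!: finsum_closed)
  also have "\<dots> = finsum G (\<lambda>k. finsum G (\<lambda>j. finsum G (\<lambda>i. f i j k) A) B) C"
    using assms by (intro finsum_cong' finsum_swap) (auto intro!: finsum_closed)
  finally show ?thesis by simp
qed

context finite_holomorphic_action
begin

lemma act_section_in:
  assumes "m \<in> mero_sections V" "g \<in> carrier G"
  shows "act_section V G act g m \<in> mero_sections V"
  using section_comp_in[OF assms(1) biholomorphic_act[OF inv_G_closed[OF assms(2)]]]
  by (simp add: act_section_def act_germ_def)

lemma act_skew_monom:
  assumes f: "f \<in> mero_sections V" and g: "g \<in> carrier G" and \<xi>: "\<xi> \<in> carrier V"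
  shows "act_skew V G act g (skew_monom V f \<xi>) = skew_monom V (act_section V G act g f) (act g \<xi>)"
proof -
  have zero: "act_section V G act g \<zero>\<^bsub>mero_ring V\<^esub> = \<zero>\<^bsub>mero_ring V\<^esub>"
    by (rule family_eqI)
      (use g in \<open>simp_all add: act_section_in section_zero_in mero_sectionsD(1) act_section_def
        section_zero_apply act_germ_zero act_germ_in restrict_PiE_iff hol_zero_in hol_in_mero\<close>)
  show ?thesis
    unfolding act_skew_def skew_monom_def
    by (rule restrict_ext) (use g \<xi> zero act_inv_eq_iff in auto)
qed

lemma skew_apply_finsum:
  assumes "\<And>i. i \<in> F \<Longrightarrow> a i \<in> carrier (skew_ring V)" and s: "s \<in> germ_families"
    and y: "y \<in> carrier V" and F: "finite F"
  shows "skew_apply V (finsum (skew_ring V) a F) s y = finsum (\<M> y) (\<lambda>i. skew_apply V (a i) s y) F"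
proof -
  interpret M: cring "\<M> y" using cring_mero_germs[OF y] .
  interpret R: abelian_monoid "skew_ring V" by (rule abelian_monoid_skew_ring)
  show ?thesis
    using F assms(1)
  proof (induction F rule: finite_induct)
    case empty
    have "skew_supp V \<zero>\<^bsub>skew_ring V\<^esub> = {}" by (auto simp: skew_supp_def skew_zero_apply)
    then show ?case using y by (simp add: skew_apply_def)
  next
    case (insert i F)
    have a: "a i \<in> carrier (skew_ring V)" "a \<in> F \<rightarrow> carrier (skew_ring V)" using insert.prems by auto
    then have "finsum (skew_ring V) a F \<in> carrier (skew_ring V)" by (intro R.finsum_closed)
    then have "skew_apply V (finsum (skew_ring V) a (insert i F)) s y =
        skew_apply V (a i) s y \<oplus>\<^bsub>\<M> y\<^esub> finsum (\<M> y) (\<lambda>i. skew_apply V (a i) s y) F"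
      using insert a y s by (simp add: R.finsum_insert skew_apply_add_left family_add_apply)
    also have "\<dots> = finsum (\<M> y) (\<lambda>i. skew_apply V (a i) s y) (insert i F)"
      using insert.hyps insert.prems y skew_apply_in[OF _ s]
      by (intro M.finsum_insert[symmetric]) (simp_all add: Pi_def family_apply_in)
    finally show ?case .
  qed
qed

end

context preserving_algebra
begin

lemma germ_const_in: "y \<in> carrier V \<Longrightarrow> germ V y (\<lambda>_. c) \<in> carrier (\<O> y)"
  by (simp add: hol_germsI hol_at_const)

text \<open>
  A multiple of the constant \<open>1\<close> on the orbit of \<open>\<xi>\<close>. Counting every group element \<open>g\<close> gives the points
  \<open>g \<cdot> \<xi>\<close> the multiplicity that they have in the index set \<open>\<Lambda>\<close> of the graph condition.
\<close>

abbreviation orbit_sum where "orbit_sum \<xi> \<equiv> average (delta \<xi> (germ V \<xi> (\<lambda>_. 1)))"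

lemma orbit_sum_S: "\<xi> \<in> X \<Longrightarrow> orbit_sum \<xi> \<in> S"
  by (intro average_in_S delta_in) (simp_all add: germ_const_in X_in)

lemma orbit_sum_apply:
  assumes \<xi>: "\<xi> \<in> X" and z: "z \<in> carrier V"
  shows "orbit_sum \<xi> z =
    finsum (\<M> z) (\<lambda>g. if act g \<xi> = z then \<one>\<^bsub>\<M> z\<^esub> else \<zero>\<^bsub>\<M> z\<^esub>) (carrier K)"
proof -
  interpret M: cring "\<M> z" using cring_mero_germs[OF z] .
  have "act_germ V K act g z (delta \<xi> (germ V \<xi> (\<lambda>_. 1)) (act (inv\<^bsub>K\<^esub> g) z)) =
      (if act g \<xi> = z then \<one>\<^bsub>\<M> z\<^esub> else \<zero>\<^bsub>\<M> z\<^esub>)" if g: "g \<in> carrier K" for g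
  proof (cases "act g \<xi> = z")
    case True
    then have "act (inv\<^bsub>K\<^esub> g) z = \<xi>" using g \<xi> X_in by auto
    then show ?thesis
      using True g z X_in[OF \<xi>] act_germ_const[OF g z, of 1] by (simp add: delta_def germ_one)
  next
    case False
    then have "act (inv\<^bsub>K\<^esub> g) z \<noteq> \<xi>" using g z by auto
    then show ?thesis using False g z by (simp add: delta_def act_germ_zero)
  qed
  then show ?thesis
    unfolding average_def restrict_apply'[OF z] by (intro M.finsum_cong') simp_all
qed

lemma skew_apply_monom_orbit_sum:
  assumes f: "f \<in> mero_sections V" and \<zeta>: "\<zeta> \<in> carrier V" and \<xi>: "\<xi> \<in> X" and \<eta>: "\<eta> \<in> carrier V"
  shows "skew_apply V (skew_monom V f \<zeta>) (orbit_sum \<xi>) \<eta> =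
    finsum (\<M> \<eta>) (\<lambda>g. if \<zeta> \<otimes>\<^bsub>V\<^esub> act g \<xi> = \<eta> then f \<eta> else \<zero>\<^bsub>\<M> \<eta>\<^esub>) (carrier K)"
proof -
  interpret M: cring "\<M> \<eta>" using cring_mero_germs[OF \<eta>] .
  have \<xi>V: "\<xi> \<in> carrier V" using \<xi> by (rule X_in)
  let ?z = "inv\<^bsub>V\<^esub> \<zeta> \<otimes>\<^bsub>V\<^esub> \<eta>"
  have z: "?z \<in> carrier V" using \<zeta> \<eta> by simp
  interpret Mz: cring "\<M> ?z" using cring_mero_germs[OF z] .
  have f\<eta>: "f \<eta> \<in> carrier (\<M> \<eta>)" using f \<eta> by (rule mero_sectionsD(2))
  have one: "trans_germ V \<zeta> \<eta> \<one>\<^bsub>\<M> ?z\<^esub> = \<one>\<^bsub>\<M> \<eta>\<^esub>"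
    using \<zeta> \<eta> by (simp add: germ_one trans_germ_germ)
  have eq: "act g \<xi> = ?z \<longleftrightarrow> \<zeta> \<otimes>\<^bsub>V\<^esub> act g \<xi> = \<eta>" if "g \<in> carrier K" for g
    using inv_solve_left[of "act g \<xi>" \<zeta> \<eta>] that \<xi>V \<zeta> \<eta> by auto
  have "trans_germ V \<zeta> \<eta> (orbit_sum \<xi> ?z) = finsum (\<M> \<eta>)
      (\<lambda>g. trans_germ V \<zeta> \<eta> (if act g \<xi> = ?z then \<one>\<^bsub>\<M> ?z\<^esub> else \<zero>\<^bsub>\<M> ?z\<^esub>)) (carrier K)"
    unfolding orbit_sum_apply[OF \<xi> z] by (rule trans_germ_finsum[OF \<zeta> \<eta>]) simp
  also have "\<dots> = finsum (\<M> \<eta>)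
      (\<lambda>g. if \<zeta> \<otimes>\<^bsub>V\<^esub> act g \<xi> = \<eta> then \<one>\<^bsub>\<M> \<eta>\<^esub> else \<zero>\<^bsub>\<M> \<eta>\<^esub>) (carrier K)"
    by (rule M.finsum_cong') (simp_all add: eq one trans_germ_zero \<zeta> \<eta>)
  finally have tr: "trans_germ V \<zeta> \<eta> (orbit_sum \<xi> ?z) = \<dots>" .
  have "f \<eta> \<otimes>\<^bsub>\<M> \<eta>\<^esub> trans_germ V \<zeta> \<eta> (orbit_sum \<xi> ?z) = finsum (\<M> \<eta>)
      (\<lambda>g. f \<eta> \<otimes>\<^bsub>\<M> \<eta>\<^esub> (if \<zeta> \<otimes>\<^bsub>V\<^esub> act g \<xi> = \<eta> then \<one>\<^bsub>\<M> \<eta>\<^esub> else \<zero>\<^bsub>\<M> \<eta>\<^esub>)) (carrier K)"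
    unfolding tr by (rule M.finsum_rdistr) (simp_all add: finite_group f\<eta>)
  also have "\<dots> = finsum (\<M> \<eta>)
      (\<lambda>g. if \<zeta> \<otimes>\<^bsub>V\<^esub> act g \<xi> = \<eta> then f \<eta> else \<zero>\<^bsub>\<M> \<eta>\<^esub>) (carrier K)"
    by (rule M.finsum_cong') (simp_all add: f\<eta>)
  finally show ?thesis
    using skew_apply_monom[OF f \<zeta> S_family[OF orbit_sum_S[OF \<xi>]] \<eta>] by simp
qed

text \<open>
  Both sides are sums over triples \<open>(g, h, i)\<close>: on the left \<open>g\<close> comes from \<open>orbit_sum \<xi>\<close> and \<open>(h, i)\<close>
  from the element of the algebra; on the right is the germ \<open>H\<close> of the graph condition.
\<close>

lemma apply_orbit_sum:
  fixes n :: nat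
  assumes f: "\<And>i. i < n \<Longrightarrow> f i \<in> mero_sections V" and \<zeta>: "\<And>i. i < n \<Longrightarrow> \<zeta> i \<in> carrier V"
    and \<xi>: "\<xi> \<in> X" and \<eta>: "\<eta> \<in> carrier V"
  shows "skew_apply V (finsum (skew_ring V) (\<lambda>i. finsum (skew_ring V)
        (\<lambda>h. act_skew V K act h (skew_monom V (f i) (\<zeta> i))) (carrier K)) {..<n}) (orbit_sum \<xi>) \<eta> =
    finsum (mero_ring V) (\<lambda>(g, h, i). act_section V K act h (f i))
      {(g, h, i). g \<in> carrier K \<and> h \<in> carrier K \<and> i < n \<and> act h (\<zeta> i) \<otimes>\<^bsub>V\<^esub> act g \<xi> = \<eta>} \<eta>"
proof -
  interpret M: cring "\<M> \<eta>" using cring_mero_germs[OF \<eta>] .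
  interpret R: abelian_monoid "skew_ring V" by (rule abelian_monoid_skew_ring)
  let ?K = "carrier K" and ?I = "{..<n}"
  note sf = S_family[OF orbit_sum_S[OF \<xi>]]
  let ?t = "\<lambda>g h i. if act h (\<zeta> i) \<otimes>\<^bsub>V\<^esub> act g \<xi> = \<eta> then act_section V K act h (f i) \<eta> else \<zero>\<^bsub>\<M> \<eta>\<^esub>"
  have t: "?t g h i \<in> carrier (\<M> \<eta>)" if "h \<in> ?K" "i \<in> ?I" for g h i
    using that f \<eta> by (simp add: mero_sectionsD(2) act_section_in)
  have m: "act_skew V K act h (skew_monom V (f i) (\<zeta> i)) =
      skew_monom V (act_section V K act h (f i)) (act h (\<zeta> i))" if "h \<in> ?K" "i \<in> ?I" for h i
    using that f \<zeta> by (intro act_skew_monom) auto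
  have m_in: "act_skew V K act h (skew_monom V (f i) (\<zeta> i)) \<in> carrier (skew_ring V)"
    if "h \<in> ?K" "i \<in> ?I" for h i
    using that f by (simp add: m skew_monom_in act_section_in)
  have sum_in: "finsum (\<M> \<eta>) (\<lambda>g. ?t g h i) ?K \<in> carrier (\<M> \<eta>)" if "h \<in> ?K" "i \<in> ?I" for h i
    using t that by (intro M.finsum_closed) simp
  have inner: "skew_apply V (finsum (skew_ring V)
        (\<lambda>h. act_skew V K act h (skew_monom V (f i) (\<zeta> i))) ?K) (orbit_sum \<xi>) \<eta> =
      finsum (\<M> \<eta>) (\<lambda>h. finsum (\<M> \<eta>) (\<lambda>g. ?t g h i) ?K) ?K" if i: "i \<in> ?I" for i
  proof -
    have "skew_apply V (finsum (skew_ring V)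
        (\<lambda>h. act_skew V K act h (skew_monom V (f i) (\<zeta> i))) ?K) (orbit_sum \<xi>) \<eta> =
      finsum (\<M> \<eta>) (\<lambda>h. skew_apply V (act_skew V K act h (skew_monom V (f i) (\<zeta> i))) (orbit_sum \<xi>) \<eta>) ?K"
      using m_in i by (intro skew_apply_finsum sf \<eta> finite_group)
    also have "\<dots> = finsum (\<M> \<eta>) (\<lambda>h. finsum (\<M> \<eta>) (\<lambda>g. ?t g h i) ?K) ?K"
    proof (rule M.finsum_cong')
      fix h assume h: "h \<in> ?K"
      show "skew_apply V (act_skew V K act h (skew_monom V (f i) (\<zeta> i))) (orbit_sum \<xi>) \<eta> =
          finsum (\<M> \<eta>) (\<lambda>g. ?t g h i) ?K"
        unfolding m[OF h i] using h i f \<zeta>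
        by (intro skew_apply_monom_orbit_sum act_section_in \<xi> \<eta>) auto
    qed (use sum_in i in auto)
    finally show ?thesis .
  qed
  have "skew_apply V (finsum (skew_ring V) (\<lambda>i. finsum (skew_ring V)
        (\<lambda>h. act_skew V K act h (skew_monom V (f i) (\<zeta> i))) ?K) ?I) (orbit_sum \<xi>) \<eta> =
      finsum (\<M> \<eta>) (\<lambda>i. skew_apply V (finsum (skew_ring V)
        (\<lambda>h. act_skew V K act h (skew_monom V (f i) (\<zeta> i))) ?K) (orbit_sum \<xi>) \<eta>) ?I"
    using m_in by (intro skew_apply_finsum sf \<eta> R.finsum_closed) auto
  also have "\<dots> = finsum (\<M> \<eta>) (\<lambda>i. finsum (\<M> \<eta>) (\<lambda>h. finsum (\<M> \<eta>) (\<lambda>g. ?t g h i) ?K) ?K) ?I"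
  proof (rule M.finsum_cong')
    show "(\<lambda>i. finsum (\<M> \<eta>) (\<lambda>h. finsum (\<M> \<eta>) (\<lambda>g. ?t g h i) ?K) ?K) \<in> ?I \<rightarrow> carrier (\<M> \<eta>)"
      using t by (intro funcsetI M.finsum_closed) simp
  qed (simp_all only: inner)
  also have "\<dots> = finsum (\<M> \<eta>) (\<lambda>(g, h, i). ?t g h i) (?K \<times> ?K \<times> ?I)"
    using t finite_group by (intro M.finsum_triple) simp_all
  also have "\<dots> = finsum (\<M> \<eta>) (\<lambda>(g, h, i). act_section V K act h (f i) \<eta>)
      {(g, h, i). g \<in> ?K \<and> h \<in> ?K \<and> i < n \<and> act h (\<zeta> i) \<otimes>\<^bsub>V\<^esub> act g \<xi> = \<eta>}" (is "_ = finsum _ _ ?\<Lambda>")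
  proof (rule M.add.finprod_mono_neutral_cong_right)
    show "finite (?K \<times> ?K \<times> ?I)" using finite_group by simp
    show "?\<Lambda> \<subseteq> ?K \<times> ?K \<times> ?I" by auto
    show "(\<lambda>(g, h, i). ?t g h i) \<in> ?K \<times> ?K \<times> ?I \<rightarrow> carrier (\<M> \<eta>)"
      using t by (simp add: Pi_def)
    show "(\<lambda>(g, h, i). ?t g h i) ghi = \<zero>\<^bsub>\<M> \<eta>\<^esub>" if "ghi \<in> ?K \<times> ?K \<times> ?I - ?\<Lambda>" for ghi
      using that by (cases ghi) simp
    show "(\<lambda>(g, h, i). ?t g h i) ghi = (\<lambda>(g, h, i). act_section V K act h (f i) \<eta>) ghi"
      if "ghi \<in> ?\<Lambda>" for ghi
      using that by (cases ghi) simp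
  qed
  also have "\<dots> = finsum (mero_ring V) (\<lambda>(g, h, i). act_section V K act h (f i)) ?\<Lambda> \<eta>"
  proof -
    have eq: "(\<lambda>(g, h, i). act_section V K act h (f i) \<eta>) =
        (\<lambda>ghi. (\<lambda>(g, h, i). act_section V K act h (f i)) ghi \<eta>)"
      by (simp add: fun_eq_iff)
    have sec: "(\<lambda>(g, h, i). act_section V K act h (f i)) ghi \<in> mero_sections V"
      if "ghi \<in> ?\<Lambda>" for ghi
      using that f by (cases ghi) (simp add: act_section_in)
    show ?thesis unfolding eq by (rule mero_ring_finsum_apply[OF sec \<eta>, symmetric])
  qed
  finally show ?thesis .
qed

end

context separating_algebra
begin

text \<open>
  The element of the algebra given by the arrow maps \<open>orbit_sum \<xi>\<close>, which lies over \<open>B\<close>, to an element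
  with non-zero value at a point of \<open>C\<close>.
\<close>

lemma arrow_part_subset:
  assumes B: "B \<in> orbs" and C: "C \<in> orbs" and arr: "arrow V K act A B C"
    and N: "submodule A N" and BN: "part B \<subseteq> N"
  shows "part C \<subseteq> N"
proof -
  obtain n :: nat and f \<zeta> \<xi> \<eta> where fz: "\<forall>i<n. f i \<in> mero_sections V \<and> \<zeta> i \<in> carrier V"
    and a: "finsum (skew_ring V) (\<lambda>i. finsum (skew_ring V)
        (\<lambda>h. act_skew V K act h (skew_monom V (f i) (\<zeta> i))) (carrier K)) {..<n} \<in> A" (is "?a \<in> A")
    and \<xi>: "\<xi> \<in> B" and \<eta>: "\<eta> \<in> C"
    and H: "germ_value V \<eta> (finsum (mero_ring V) (\<lambda>(g, h, i). act_section V K act h (f i))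
        {(g, h, i). g \<in> carrier K \<and> h \<in> carrier K \<and> i < n \<and> act h (\<zeta> i) \<otimes>\<^bsub>V\<^esub> act g \<xi> = \<eta>} \<eta>) \<noteq> 0"
    using arr unfolding arrow_def Let_def by blast
  have \<xi>X: "\<xi> \<in> X" using orbit_in[OF B \<xi>] .
  have \<eta>V: "\<eta> \<in> carrier V" using orbit_in[OF C \<eta>] by (rule X_in)
  have s: "orbit_sum \<xi> \<in> S" using \<xi>X by (rule orbit_sum_S)
  have "orbit_sum \<xi> x = \<zero>\<^bsub>\<M> x\<^esub>" if x: "x \<in> X" "x \<notin> B" for x
  proof -
    have xV: "x \<in> carrier V" using x(1) by (rule X_in)
    interpret M: cring "\<M> x" using cring_mero_germs[OF xV] .
    have "act g \<xi> \<noteq> x" if g: "g \<in> carrier K" for g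
    proof
      assume "act g \<xi> = x"
      then have "act (inv\<^bsub>K\<^esub> g) x = \<xi>" using g X_in[OF \<xi>X] by auto
      then show False using orbit_stable[OF B g xV] \<xi> x(2) by simp
    qed
    then have "orbit_sum \<xi> x = finsum (\<M> x) (\<lambda>_. \<zero>\<^bsub>\<M> x\<^esub>) (carrier K)"
      unfolding orbit_sum_apply[OF \<xi>X xV] by (intro M.finsum_cong') auto
    then show ?thesis by simp
  qed
  then have "cls (orbit_sum \<xi>) \<in> N" using BN cls_in_part[OF s, of B] by blast
  then have "cls (skew_apply V ?a (orbit_sum \<xi>)) \<in> N"
    using submodule_act[OF N subset_refl a s] by blast
  moreover have "germ_value V \<eta> (skew_apply V ?a (orbit_sum \<xi>) \<eta>) \<noteq> 0"
    using H fz apply_orbit_sum[of n f \<zeta> \<xi> \<eta>] \<xi>X \<eta>V by simp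
  ultimately show ?thesis
    using part_subset_if_value[OF N A_preserves[OF a s] _ C \<eta>] by blast
qed

lemma submodule_eq_carrier_if_connected:
  assumes conn: "graph_connected orbs (orbit_graph V K act X A)"
    and N: "submodule A N" and B: "B \<in> orbs" and BN: "part B \<subseteq> N"
  shows "N = carrier M"
proof (rule submodule_eq_carrier[OF N])
  fix C assume C: "C \<in> orbs"
  have "(B, C) \<in> (orbit_graph V K act X A)\<^sup>*"
    using conn B C unfolding graph_connected_def by blast
  then show "part C \<subseteq> N"
  proof (induction rule: rtrancl_induct)
    case base
    show ?case by (rule BN)
  next
    case (step D E)
    then show ?case
      using arrow_part_subset[of D E N] N unfolding orbit_graph_def by blast
  qed
qed

lemma generated_by_const_class:
  assumes conn: "graph_connected orbs (orbit_graph V K act X A)" and B: "B \<in> orbs" and c: "c \<noteq> 0"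
  shows "carrier M = submodule_gen V K act X A {const_class V K act X B c}"
proof -
  obtain \<xi> where \<xi>: "\<xi> \<in> B" using orbit_nonempty[OF B] by blast
  have "N = carrier M" if N: "submodule A N" and cN: "const_class V K act X B c \<in> N" for N
  proof (rule submodule_eq_carrier_if_connected[OF conn N B])
    show "part B \<subseteq> N"
      using cN c const_on_value[OF B \<xi>]
      by (intro part_subset_if_value[OF N const_on_S[OF B] _ B \<xi>]) (simp_all add: const_class_eq)
  qed
  moreover have "const_class V K act X B c \<in> carrier M"
    by (simp add: const_class_eq cls_in const_on_S B)
  ultimately have "submodule A N \<and> {const_class V K act X B c} \<subseteq> N \<longleftrightarrow> N = carrier M" for N
    using submodule_carrier by (metis empty_subsetI insert_subset)
  then show ?thesis by (simp add: submodule_gen_def)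
qed

lemma ex1_maximal_if_connected:
  assumes conn: "graph_connected orbs (orbit_graph V K act X A)" and "X \<noteq> {}"
  shows "\<exists>!N. maximal_in {N. submodule A N \<and> N \<noteq> carrier M} N"
proof -
  obtain x where "x \<in> X" using \<open>X \<noteq> {}\<close> by blast
  then obtain B where B: "B \<in> orbs" using orbit_of(1) by blast
  have "part B \<subseteq> carrier M" by (auto simp: orbit_part_def)
  then have "submodule A N \<and> N \<noteq> carrier M \<longleftrightarrow> submodule A N \<and> \<not> part B \<subseteq> N" for N
    using submodule_eq_carrier_if_connected[OF conn _ B, of N] by metis
  then show ?thesis using ex1_maximal_not_containing_part[OF B] by simp
qed

end

section \<open>The stabilizer of a coset\<close>

lemma (in finite_holomorphic_action) action_of_subgroup:
  assumes H: "subgroup H G"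
  shows "finite_holomorphic_action (G\<lparr>carrier := H\<rparr>) V act"
proof -
  have sub: "H \<subseteq> carrier G" using H by (rule subgroup.subset)
  have "group_hom (G\<lparr>carrier := H\<rparr>) (BijGroup (carrier V)) act"
  proof (intro group_hom.intro group_hom_axioms.intro)
    show "group (G\<lparr>carrier := H\<rparr>)" using subgroup.subgroup_is_group[OF H group_G] .
    show "group (BijGroup (carrier V))" by (rule group_BijGroup)
    show "act \<in> hom (G\<lparr>carrier := H\<rparr>) (BijGroup (carrier V))"
      using group_hom.homh[OF group_hom] sub by (auto simp: hom_def Pi_def)
  qed
  then show ?thesis
    using sub finite_group act_hom act_holomorphic
    by (intro finite_holomorphic_action.intro complex_lie_group_axioms group_action.intro
        finite_holomorphic_action_axioms.intro) (auto intro: finite_subset)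
qed

lemma (in finite_holomorphic_action) subgroup_set_stabilizer:
  assumes X: "X \<subseteq> carrier V"
  shows "subgroup {g \<in> carrier G. act g ` X = X} G"
proof (rule group.subgroupI[OF group_G])
  have img: "act (g \<otimes>\<^bsub>G\<^esub> h) ` X = act g ` act h ` X" if "g \<in> carrier G" "h \<in> carrier G" for g h
    unfolding image_image using that X by (intro image_cong) (auto simp: act_mult_G)
  show "{g \<in> carrier G. act g ` X = X} \<noteq> {}"
  proof -
    have "act \<one>\<^bsub>G\<^esub> ` X = id ` X" using X by (intro image_cong) auto
    then have "\<one>\<^bsub>G\<^esub> \<in> {g \<in> carrier G. act g ` X = X}" by simp
    then show ?thesis by blast
  qed
  show "inv\<^bsub>G\<^esub> g \<in> {g \<in> carrier G. act g ` X = X}" if "g \<in> {g \<in> carrier G. act g ` X = X}" for g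
  proof -
    have g: "g \<in> carrier G" "act g ` X = X" using that by auto
    have "act (inv\<^bsub>G\<^esub> g) ` act g ` X = id ` X"
      unfolding image_image using X g by (intro image_cong) auto
    then show ?thesis using g by simp
  qed
  show "g \<otimes>\<^bsub>G\<^esub> h \<in> {g \<in> carrier G. act g ` X = X}"
    if "g \<in> {g \<in> carrier G. act g ` X = X}" "h \<in> {g \<in> carrier G. act g ` X = X}" for g h
    using that by (simp add: img)
qed auto

theorem theorem31:
  fixes V :: "('v, 'n::finite) lie_data"
    and G :: "('g, 'k) monoid_scheme"
    and act :: "'g \<Rightarrow> 'v \<Rightarrow> 'v"
    and L :: "'v set"
    and v :: 'v
    and X :: "'v set"
    and K :: "('g, 'k) monoid_scheme"
    and A :: "('v \<Rightarrow> 'v \<Rightarrow> 'v germ) set"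
  assumes action: "finite_holomorphic_action G V act"
    and L_subgroup: "subgroup L V"
    and L_invariant: "\<forall>g\<in>carrier G. act g ` L = L"
    and v: "v \<in> carrier V"
    and X: "X = L #>\<^bsub>V\<^esub> v"
    and K: "K = set_stabilizer G act X"
    and A_subalgebra: "subring A (skew_ring V)" "A \<subseteq> skew_invariants V K act"
    and A_fin_gen: "fin_gen_over_H0 V K act A"
    and A_preserves: "\<forall>a\<in>A. \<forall>s\<in>inv_germ_sums V K act X. skew_apply V a s \<in> inv_germ_sums V K act X"
    and separates: "\<forall>B\<in>orbits K X act. \<forall>C\<in>orbits K X act. B \<noteq> C \<longrightarrow>
      (\<forall>x\<in>B. \<forall>y\<in>C. \<exists>f\<in>invariant_hol_funs V K act. f x \<noteq> f y)"
    and const_generated: "\<forall>B\<in>orbits K X act. \<exists>c. c \<noteq> 0 \<and>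
      orbit_part V K act X B = submodule_gen V K act X (H0 V K act) {const_class V K act X B c}"
  shows
    "(\<forall>B\<in>orbits K X act. \<exists>!N.
        maximal_in {N. submodule_of V K act X A N \<and> \<not> orbit_part V K act X B \<subseteq> N} N) \<and>
     (graph_connected (orbits K X act) (orbit_graph V K act X A) \<longrightarrow>
        (\<forall>B\<in>orbits K X act. \<forall>c. c \<noteq> 0 \<longrightarrow>
           carrier (quot_module V K act X) = submodule_gen V K act X A {const_class V K act X B c}) \<and>
        (\<exists>!N. maximal_in {N. submodule_of V K act X A N \<and> N \<noteq> carrier (quot_module V K act X)} N))"
proof -
  interpret G: finite_holomorphic_action G V act by (rule action)
  have X_subset: "X \<subseteq> carrier V"
    unfolding X using G.r_coset_subset_G[OF subgroup.subset[OF L_subgroup] v] .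
  have "\<one>\<^bsub>V\<^esub> \<otimes>\<^bsub>V\<^esub> v \<in> X"
    unfolding X r_coset_def using subgroup.one_closed[OF L_subgroup] by blast
  then have X_nonempty: "X \<noteq> {}" by blast
  have "finite_holomorphic_action K V act"
    unfolding K set_stabilizer_def
    by (rule G.action_of_subgroup[OF G.subgroup_set_stabilizer[OF X_subset]])
  then interpret K: finite_holomorphic_action K V act .
  interpret separating_algebra K V act X A
  proof unfold_locales
    show "A \<subseteq> carrier (skew_ring V)" using A_subalgebra(2) by (auto simp: skew_invariants_def)
    show "act g x \<in> X" if "g \<in> carrier K" "x \<in> X" for g x
      using that by (auto simp: K set_stabilizer_def)
    show "a \<otimes>\<^bsub>skew_ring V\<^esub> b \<in> A" if "a \<in> A" "b \<in> A" for a b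
      using submonoid.m_closed[OF subring.axioms(2)[OF A_subalgebra(1)] that] .
    show "H0 V K act \<subseteq> A" using A_fin_gen by (simp add: fin_gen_over_H0_def)
    show "skew_apply V a s \<in> inv_germ_sums V K act X"
      if "a \<in> A" "s \<in> inv_germ_sums V K act X" for a s
      using A_preserves that by blast
    show "\<exists>f\<in>invariant_hol_funs V K act. f x \<noteq> f y"
      if "B \<in> orbits K X act" "C \<in> orbits K X act" "B \<noteq> C" "x \<in> B" "y \<in> C" for B C x y
      using separates that by blast
    show "\<exists>c. c \<noteq> 0 \<and>
        orbit_part V K act X B = submodule_gen V K act X (H0 V K act) {const_class V K act X B c}"
      if "B \<in> orbits K X act" for B
      using const_generated that by blast
  qed (rule X_subset)
  show ?thesis
    using ex1_maximal_not_containing_part generated_by_const_class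
      ex1_maximal_if_connected[OF _ X_nonempty] by simp
qed

end
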